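(* Let $\mu,\nu\in\mathcal{P}_2(\mathbb{R}^d)$, let $\phi:\mathbb{R}^d\to\mathbb{R}$ be strictly convex with $\int_{\mathbb{R}^d}\phi(y)\nu(dy)<\infty$, and let $$\mathcal{I}_{\mu,\phi}^\nu=\Big\{\eta\in\mathcal{I}_\mu^\nu:\int_{\mathbb{R}^d}\phi(z)\eta(dz)=\inf_{\eta'\in\mathcal{I}_\mu^\nu}\int_{\mathbb{R}^d}\phi(z)\eta'(dz)\Big\}.$$ Then: (i) $\emptyset\neq\mathcal{I}_{\mu,\phi}^\nu\subset\tilde{\mathcal{I}}_\mu^\nu$, and for each $\eta\in\mathcal{I}_{\mu,\phi}^\nu$ there is a measurable map $T:\mathbb{R}^d\to\mathbb{R}^d$ such that $\Pi^{opt}(\mu,\eta)=\{(I_d,T)\#\mu\}$. (ii) There is exactly one $\eta_\phi\in\mathcal{I}_{\mu,\phi}^\nu$ such that $\int_{\mathbb{R}^d}|z|^2\eta_\phi(dz)=\inf_{\eta\in\mathcal{I}_{\mu,\phi}^\nu}\int_{\mathbb{R}^d}|z|^2\eta(dz)$. (iii) For the choice $\phi(x)=|x|^2$, the set $\mathcal{I}_{\mu,|x|^2}^\nu$ contains exactly one element $\underline\eta$.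
   Context: $\mathcal{P}_2(\mathbb{R}^d)$ is the set of Borel probability measures on $\mathbb{R}^d$ with finite second order moment, $|\cdot|$ is the Euclidean norm, $\Pi(\mu,\nu)$ is the set of probability measures on $\mathbb{R}^d\times\mathbb{R}^d$ with first marginal $\mu$ and second marginal $\nu$, $W_2^2(\mu,\nu)=\inf_{\pi\in\Pi(\mu,\nu)}\int|y-x|^2\pi(dx,dy)$, and $\Pi^{opt}(\mu,\nu)$ is the (non-empty) set of $\pi\in\Pi(\mu,\nu)$ attaining this infimum. $I_d$ is the identity map of $\mathbb{R}^d$ and $T\#\mu$ is the image (push-forward) of $\mu$ by $T$. Any coupling $\pi\in\Pi(\mu,\nu)$ disintegrates as $\pi(dx,dy)=\mu(dx)k(x,dy)$ with $k$ a Markov kernel on $\mathbb{R}^d$. Convex order: $\eta\le_{\mathrm{cx}}\nu$ means $\int\phi\,d\eta\le\int\phi\,d\nu$ for every convex $\phi:\mathbb{R}^d\to\mathbb{R}$ such that the integrals make sense. For $\mu,\nu\in\mathcal{P}_2(\mathbb{R}^d)$ define $$\mathcal{I}_\mu^\nu=\Big\{\eta\in\mathcal{P}_2(\mathbb{R}^d):\eta\le_{\mathrm{cx}}\nu\text{ and }W_2^2(\mu,\nu)=W_2^2(\mu,\eta)+\int_{\mathbb{R}^d}|y|^2\nu(dy)-\int_{\mathbb{R}^d}|z|^2\eta(dz)\Big\},$$ $$\tilde{\mathcal{I}}_\mu^\nu=\Big\{\mathcal{T}\#\mu:\ \exists\,\mu(dx)k(x,dy)\in\Pi^{opt}(\mu,\nu),\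 \mathcal{T}(x)=\int_{\mathbb{R}^d}y\,k(x,dy)\Big\}.$$ *)

theory Defs
  imports "HOL-Probability.Probability"
begin

definition P2 :: "'a::euclidean_space measure set" where
  "P2 = {\<mu>. sets \<mu> = sets borel \<and> prob_space \<mu> \<and> integrable \<mu> (\<lambda>x. (norm x)\<^sup>2)}"

definition couplings :: "'a::euclidean_space measure \<Rightarrow> 'a measure \<Rightarrow> ('a \<times> 'a) measure set" where
  "couplings \<mu> \<nu> = {\<pi>. sets \<pi> = sets borel \<and> prob_space \<pi> \<and>
     distr \<pi> borel fst = \<mu> \<and> distr \<pi> borel snd = \<nu>}"

text \<open>For marginals in \<open>P2\<close> the cost is integrable under every coupling, so the
  Bochner integral and the real infimum below are the usual ones.\<close>

definition transport_cost :: "('a::euclidean_space \<times> 'a) measure \<Rightarrow> real" where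
  "transport_cost \<pi> = (\<integral>(x, y). (norm (y - x))\<^sup>2 \<partial>\<pi>)"

definition W2sq :: "'a::euclidean_space measure \<Rightarrow> 'a measure \<Rightarrow> real" where
  "W2sq \<mu> \<nu> = (INF \<pi>\<in>couplings \<mu> \<nu>. transport_cost \<pi>)"

definition opt_couplings :: "'a::euclidean_space measure \<Rightarrow> 'a measure \<Rightarrow> ('a \<times> 'a) measure set" where
  "opt_couplings \<mu> \<nu> = {\<pi> \<in> couplings \<mu> \<nu>. transport_cost \<pi> = W2sq \<mu> \<nu>}"

text \<open>Integral with values in the extended reals. It makes sense unless both the positive
  and the negative part have infinite integral; as \<open>\<infinity> - \<infinity> = \<infinity>\<close> in \<^typ>\<open>ereal\<close>, the
  condition \<open>ereal_integral M f < \<infinity>\<close> says that the positive part has finite integral.\<close>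

definition integral_makes_sense :: "'a measure \<Rightarrow> ('a \<Rightarrow> real) \<Rightarrow> bool" where
  "integral_makes_sense M f \<longleftrightarrow>
     (\<integral>\<^sup>+ x. ennreal (f x) \<partial>M) < \<infinity> \<or> (\<integral>\<^sup>+ x. ennreal (- f x) \<partial>M) < \<infinity>"

definition ereal_integral :: "'a measure \<Rightarrow> ('a \<Rightarrow> real) \<Rightarrow> ereal" where
  "ereal_integral M f =
     enn2ereal (\<integral>\<^sup>+ x. ennreal (f x) \<partial>M) - enn2ereal (\<integral>\<^sup>+ x. ennreal (- f x) \<partial>M)"

definition convex_le :: "'a::euclidean_space measure \<Rightarrow> 'a measure \<Rightarrow> bool" (infix "\<le>\<^sub>c\<^sub>x" 50) where
  "\<eta> \<le>\<^sub>c\<^sub>x \<nu> \<longleftrightarrow> (\<forall>\<phi>. convex_on UNIV \<phi> \<longrightarrow>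
     integral_makes_sense \<eta> \<phi> \<longrightarrow> integral_makes_sense \<nu> \<phi> \<longrightarrow>
     ereal_integral \<eta> \<phi> \<le> ereal_integral \<nu> \<phi>)"

definition strictly_convex :: "('a::real_vector \<Rightarrow> real) \<Rightarrow> bool" where
  "strictly_convex \<phi> \<longleftrightarrow> (\<forall>x y t. x \<noteq> y \<longrightarrow> 0 < t \<longrightarrow> t < 1 \<longrightarrow>
     \<phi> ((1 - t) *\<^sub>R x + t *\<^sub>R y) < (1 - t) * \<phi> x + t * \<phi> y)"

definition I_set :: "'a::euclidean_space measure \<Rightarrow> 'a measure \<Rightarrow> 'a measure set" where
  "I_set \<mu> \<nu> = {\<eta> \<in> P2. \<eta> \<le>\<^sub>c\<^sub>x \<nu> \<and>
     W2sq \<mu> \<nu> = W2sq \<mu> \<eta> + (\<integral>y. (norm y)\<^sup>2 \<partial>\<nu>) - (\<integral>z. (norm z)\<^sup>2 \<partial>\<eta>)}"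

text \<open>The measure \<open>\<mu>(dx) k(x,dy)\<close> on the product space, for a Markov kernel \<open>k\<close>, i.e.\
  a measurable map into \<^term>\<open>prob_algebra borel\<close>.\<close>

definition kernel_prod ::
  "'a::euclidean_space measure \<Rightarrow> ('a \<Rightarrow> 'a measure) \<Rightarrow> ('a \<times> 'a) measure" where
  "kernel_prod \<mu> k = \<mu> \<bind> (\<lambda>x. distr (k x) borel (Pair x))"

text \<open>The Bochner integral is \<open>0\<close> at points \<open>x\<close> where \<open>k x\<close> has no first moment; when
  the second marginal is in \<open>P2\<close> these form a \<open>\<mu>\<close>-null set.\<close>

definition I_tilde :: "'a::euclidean_space measure \<Rightarrow> 'a measure \<Rightarrow> 'a measure set" where
  "I_tilde \<mu> \<nu> = {distr \<mu> borel (\<lambda>x. \<integral>y. y \<partial>k x) | k.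
     k \<in> borel \<rightarrow>\<^sub>M prob_algebra borel \<and> kernel_prod \<mu> k \<in> opt_couplings \<mu> \<nu>}"

definition I_min :: "'a::euclidean_space measure \<Rightarrow> 'a measure \<Rightarrow> ('a \<Rightarrow> real) \<Rightarrow> 'a measure set" where
  "I_min \<mu> \<nu> \<phi> = {\<eta> \<in> I_set \<mu> \<nu>.
     ereal_integral \<eta> \<phi> = (INF \<eta>'\<in>I_set \<mu> \<nu>. ereal_integral \<eta>' \<phi>)}"

end

theory Submission
  imports Defs
begin

text \<open>
  Expanding the squares, \<open>\<eta> \<le>\<^sub>c\<^sub>x \<nu>\<close> belongs to \<open>I_set \<mu> \<nu>\<close> iff \<open>\<mu>\<close> has the same maximal
  correlation \<open>\<integral> x \<bullet> y\<close> with \<open>\<eta>\<close> as with \<open>\<nu>\<close>. The correlation of \<open>\<mu>(dx) k(x,dy)\<close> depends on \<open>k\<close>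
  only through its barycenter map \<open>T(x) = \<integral> y k(x,dy)\<close>. By Strassen's theorem, the barycenter
  map of an optimal kernel for \<open>(\<mu>, \<eta>)\<close>, where \<open>\<eta> \<in> I_set \<mu> \<nu>\<close>, is also that of an optimal kernel
  for \<open>(\<mu>, \<nu>)\<close>; conversely such maps push \<open>\<mu>\<close> to elements of \<open>I_set \<mu> \<nu>\<close>. Jensen's inequality
  thus reduces the minimisation of \<open>\<integral> \<phi> d\<eta>\<close> to that of \<open>\<integral> \<phi>(T) d\<mu>\<close> over the barycenter maps of
  optimal kernels for \<open>(\<mu>, \<nu>)\<close>. These form a convex set, on which the functional is finite, strictly
  convex and lower semicontinuous, so that the minimiser is unique; strict convexity in Jensen's
  inequality forces every optimal coupling with it to be carried by a graph.

  Compactness of the set of couplings is replaced by a parallelogram argument for the conditional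
  distribution functions. Strassen's theorem follows by projecting in \<open>L\<^sup>2\<close> onto the barycenter
  maps and comparing correlations; for finitely many slopes this comparison uses explicit soft-max
  densities whose dual potential is convex.
\<close>

section \<open>A Borel encoding of Euclidean space in the unit interval\<close>

text \<open>Kernels with mixture \<open>N\<close> are compared through the countably many functions
  \<open>x \<mapsto> measure (k x) (lower q)\<close>, which take values in [0, 1] and so live in a
  Hilbert space. The obstacle is that bounded sequences there converge only weakly. Points of nearly
  minimal norm in nested sets closed under midpoints converge strongly instead, hence almost
  everywhere along a subsequence, and Fatou's lemma then yields lower semicontinuity. Coding points
  by numbers in [0, 1) makes one-dimensional distribution functions available, at the price that
  their convergence is unrelated to the topology of the target. The fixed mixture repairs this: the
  error of approximating \<open>f\<close> in L^1(\<open>N\<close>) is bounded uniformly in the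
  kernels. In Strassen's theorem the comparison for finitely many slopes has an error bounded by
  their number. The correlation scales with the slopes while this bound does not, so large multiples
  of the slopes make the error negligible.\<close>

definition ternary :: "(nat \<Rightarrow> bool) \<Rightarrow> real" where
  "ternary b = (\<Sum>j. of_bool (b j) * (1/3) ^ Suc j)"

lemma ternary_sums: "(\<lambda>j. (1/3::real) ^ Suc j) sums (1/2)"
  using geometric_sums[of "1/3::real"] sums_mult[of "\<lambda>j. (1/3::real)^j" "1 / (1 - 1/3)" "1/3"]
  by simp

lemma ternary_summable: "summable (\<lambda>j. of_bool (b j) * (1/3::real) ^ Suc j)"
  by (rule summable_comparison_test'[OF sums_summable[OF ternary_sums], of 0]) auto

lemma ternary_nonneg: "0 \<le> ternary b"
  unfolding ternary_def by (rule suminf_nonneg[OF ternary_summable]) simp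

lemma ternary_le: "ternary b \<le> 1/2"
  unfolding ternary_def sums_unique[OF ternary_sums]
  by (rule suminf_le[OF _ ternary_summable sums_summable[OF ternary_sums]]) auto

lemma ternary_Suc: "3 * ternary b = of_bool (b 0) + ternary (\<lambda>j. b (Suc j))"
proof -
  have "ternary b = of_bool (b 0) * (1/3) + (\<Sum>j. of_bool (b (Suc j)) * (1/3) ^ Suc (Suc j))"
    unfolding ternary_def using suminf_split_head[OF ternary_summable, of b] by simp
  also have "(\<Sum>j. of_bool (b (Suc j)) * (1/3::real) ^ Suc (Suc j)) = ternary (\<lambda>j. b (Suc j)) * (1/3)"
    unfolding ternary_def by (subst suminf_mult2[OF ternary_summable]) (simp add: mult_ac)
  finally show ?thesis by simp
qed

text \<open>Digits 0 and 1 keep every tail at most 1/2 < 1 (\<open>ternary_le\<close>), so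
  multiplying by \<open>3 ^ Suc n\<close> and rounding down cuts exactly behind digit
  \<open>n\<close>, and the earlier digits contribute a multiple of 3. In base 2 a tail could reach
  1 and the reading would fail.\<close>

lemma ternary_digit: "\<lfloor>3 ^ Suc n * ternary b\<rfloor> mod 3 = of_bool (b n)"
proof (induction n arbitrary: b)
  case 0
  have "\<lfloor>3 * ternary b\<rfloor> = of_bool (b 0)"
    unfolding ternary_Suc using ternary_nonneg[of "\<lambda>j. b (Suc j)"] ternary_le[of "\<lambda>j. b (Suc j)"]
    by (intro floor_unique) auto
  then show ?case by simp
next
  case (Suc n)
  have "3 ^ Suc (Suc n) * ternary b = 3 ^ Suc n * (3 * ternary b)" by simp
  also have "\<dots> = of_int (3 ^ Suc n * of_bool (b 0)) + 3 ^ Suc n * ternary (\<lambda>j. b (Suc j))"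
    unfolding ternary_Suc by (simp add: algebra_simps)
  finally have eq: "3 ^ Suc (Suc n) * ternary b
      = of_int (3 ^ Suc n * of_bool (b 0)) + 3 ^ Suc n * ternary (\<lambda>j. b (Suc j))" .
  have "\<lfloor>3 ^ Suc (Suc n) * ternary b\<rfloor>
      = 3 * (3 ^ n * of_bool (b 0)) + \<lfloor>3 ^ Suc n * ternary (\<lambda>j. b (Suc j))\<rfloor>"
    unfolding eq int_add_floor[symmetric] by simp
  then show ?case using Suc[of "\<lambda>j. b (Suc j)"] by simp
qed

text \<open>A point is coded by the comparisons of its coordinates with the rationals, and this bit
  sequence by a real number with ternary digits 0 and 1, which determine the number uniquely.\<close>

definition halfspace_code :: "nat \<Rightarrow> 'a::euclidean_space \<times> real" where
  "halfspace_code = from_nat_into (Basis \<times> \<rat>)"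

lemma range_halfspace_code: "range (halfspace_code :: nat \<Rightarrow> 'a::euclidean_space \<times> real) = Basis \<times> \<rat>"
proof -
  have "(Basis::'a set) \<times> (\<rat>::real set) \<noteq> {}" using nonempty_Basis Rats_0 by blast
  moreover have "countable ((Basis::'a set) \<times> (\<rat>::real set))"
    by (intro countable_SIGMA) (auto intro: countable_finite countable_rat)
  ultimately show ?thesis unfolding halfspace_code_def by (rule range_from_nat_into)
qed

definition enc :: "'a::euclidean_space \<Rightarrow> real" where
  "enc y = ternary (\<lambda>j. snd (halfspace_code j :: 'a \<times> real) < y \<bullet> fst (halfspace_code j :: 'a \<times> real))"

text \<open>A coordinate is the supremum of the rationals below it, and those are the ones whose
  digit is 1. A countable supremum of measurable terms gives \<open>enc\<close> a Borel left inverse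
  on all reals, without any theorem on images of Borel sets.\<close>

definition dec :: "real \<Rightarrow> 'a::euclidean_space" where
  "dec t = (\<Sum>i\<in>Basis. real_of_ereal (SUP j.
     if \<lfloor>3 ^ Suc j * t\<rfloor> mod 3 = 1 \<and> fst (halfspace_code j :: 'a \<times> real) = i
     then ereal (snd (halfspace_code j :: 'a \<times> real)) else - \<infinity>) *\<^sub>R i)"

lemma enc_measurable [measurable]: "enc \<in> borel_measurable borel"
  unfolding enc_def ternary_def by measurable

lemma dec_measurable [measurable]: "dec \<in> borel_measurable borel"
  unfolding dec_def by measurable

lemma enc_bounds: "0 \<le> enc y" "enc y < 1"
  using ternary_nonneg ternary_le[of "\<lambda>j. snd (halfspace_code j :: 'a \<times> real) < y \<bullet> fst (halfspace_code j :: 'a \<times> real)"]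
  unfolding enc_def by auto

lemma dec_enc [simp]: "dec (enc y) = (y :: 'a::euclidean_space)"
proof -
  have "(SUP j. if \<lfloor>3 ^ Suc j * enc y\<rfloor> mod 3 = 1 \<and> fst (halfspace_code j :: 'a \<times> real) = i
     then ereal (snd (halfspace_code j :: 'a \<times> real)) else - \<infinity>) = ereal (y \<bullet> i)"
    (is "(SUP j. ?s j) = _") if i: "i \<in> Basis" for i
  proof (rule antisym)
    show "(SUP j. ?s j) \<le> ereal (y \<bullet> i)"
      unfolding enc_def ternary_digit by (rule SUP_least) auto
    show "ereal (y \<bullet> i) \<le> (SUP j. ?s j)"
    proof (rule dense_le)
      fix z assume "z < ereal (y \<bullet> i)"
      then obtain r where r: "z < ereal (real_of_rat r)" "real_of_rat r < y \<bullet> i"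
        using ereal_dense3 by fastforce
      have "(i, real_of_rat r) \<in> range (halfspace_code :: nat \<Rightarrow> 'a \<times> real)"
        unfolding range_halfspace_code using i by auto
      then obtain j where j: "halfspace_code j = (i, real_of_rat r)" by (metis imageE)
      have "z \<le> ?s j" unfolding enc_def ternary_digit using r j by auto
      also have "\<dots> \<le> (SUP j. ?s j)" by (rule SUP_upper) simp
      finally show "z \<le> (SUP j. ?s j)" .
    qed
  qed
  then have "dec (enc y) = (\<Sum>i\<in>Basis. (y \<bullet> i) *\<^sub>R i)"
    unfolding dec_def by simp
  then show ?thesis by (simp add: euclidean_representation)
qed

text \<open>Preimages of rational half-lines under the code: a countable \<pi>-system on which a
  measure on the Euclidean space acts like a distribution function on the line.\<close>

definition lower :: "rat \<Rightarrow> 'a::euclidean_space set" where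
  "lower q = {y. enc y \<le> real_of_rat q}"

lemma lower_sets [measurable]: "lower q \<in> sets borel"
  unfolding lower_def by measurable

lemma Int_stable_lower: "Int_stable (range lower)"
proof (rule Int_stableI_image)
  fix p q :: rat
  have "lower p \<inter> lower q = (lower (min p q) :: 'a set)"
    unfolding lower_def by (cases "p \<le> q") (auto simp: of_rat_less_eq min_def intro: order_trans)
  then show "\<exists>c\<in>UNIV. lower p \<inter> lower q = (lower c :: 'a set)" by blast
qed

text \<open>For the nontrivial inclusion, \<open>enc\<close> is measurable for the \<sigma>-algebra
  generated by the sets \<open>lower q\<close>, and any Borel set \<open>B\<close> equals
  \<open>enc -\<close> dec -\<open>B\<close> because \<open>dec\<close> inverts
  \<open>enc\<close>.\<close>

lemma sets_borel_lower: "sets (borel :: 'a::euclidean_space measure) = sigma_sets UNIV (range lower)"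
proof (rule antisym)
  show "sigma_sets UNIV (range lower) \<subseteq> sets (borel :: 'a measure)"
    by (rule sets.sigma_sets_subset'[of _ borel UNIV, simplified]) auto
  let ?S = "sigma UNIV (range lower) :: 'a measure"
  have S: "sets ?S = sigma_sets UNIV (range lower)" "space ?S = UNIV" by auto
  have e: "enc \<in> borel_measurable ?S"
  proof (rule borel_measurableI_le)
    fix t :: real
    have "{y::'a. enc y \<le> t} = (\<Inter>q\<in>{q. t < real_of_rat q}. lower q)"
    proof (intro set_eqI iffI INT_I)
      fix y :: 'a assume y: "y \<in> (\<Inter>q\<in>{q. t < real_of_rat q}. lower q)"
      have "enc y \<le> t"
      proof (rule dense_ge)
        fix z assume "t < z"
        then obtain q where "t < real_of_rat q" "real_of_rat q < z" using of_rat_dense by blast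
        with y show "enc y \<le> z" by (force simp: lower_def)
      qed
      then show "y \<in> {y. enc y \<le> t}" by simp
    qed (auto simp: lower_def)
    moreover have "(\<Inter>q\<in>{q. t < real_of_rat q}. lower q) \<in> sets ?S"
    proof (rule sets.countable_INT')
      obtain q where "t < real_of_rat q" by (metis of_rat_dense lt_ex gt_ex)
      then show "{q. t < real_of_rat q} \<noteq> {}" by auto
    qed (auto intro: countable_subset)
    ultimately show "{y \<in> space ?S. enc y \<le> t} \<in> sets ?S" by simp
  qed
  show "sets (borel :: 'a measure) \<subseteq> sigma_sets UNIV (range lower)"
  proof
    fix B :: "'a set" assume "B \<in> sets borel"
    then have "dec -` B \<in> sets borel" using measurable_sets[OF dec_measurable, of B] by simp
    from measurable_sets[OF e this] have "enc -` dec -` B \<in> sets ?S" by simp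
    moreover have "enc -` dec -` B = B" by auto
    ultimately show "B \<in> sigma_sets UNIV (range lower)" by simp
  qed
qed

lemma sets_borel_induct_lower [consumes 1, case_names lower empty compl union]:
  fixes B :: "'a::euclidean_space set"
  assumes "B \<in> sets borel"
    and "\<And>q. P (lower q)" and "P {}"
    and "\<And>A. A \<in> sets borel \<Longrightarrow> P A \<Longrightarrow> P (- A)"
    and "\<And>A. disjoint_family A \<Longrightarrow> range A \<subseteq> sets borel \<Longrightarrow> (\<And>i::nat. P (A i)) \<Longrightarrow> P (\<Union>i. A i)"
  shows "P B"
proof -
  have G: "range lower \<subseteq> Pow (UNIV :: 'a set)" by simp
  from Int_stable_lower G assms(1)[unfolded sets_borel_lower] show ?thesis
  proof (induction rule: sigma_sets_induct_disjoint)
  case (compl A)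
  then show ?case using assms(4)[of A] by (simp add: sets_borel_lower Compl_eq_Diff_UNIV)
next
  case (union A)
  then show ?case using assms(5)[of A] by (simp add: sets_borel_lower)
qed (use assms in auto)
qed

section \<open>Probability kernels with a prescribed mixture\<close>

text \<open>With \<open>M\<close> a first marginal and \<open>N\<close> a second one, these kernels
  stand for the couplings (\<open>kernel_prod_couplings\<close>, \<open>disintegration\<close>). The
  source space is arbitrary, so that a coin toss can serve as one in
  \<open>mid_kernel_mixture\<close>.\<close>

definition kernels :: "'x measure \<Rightarrow> 'a::euclidean_space measure \<Rightarrow> ('x \<Rightarrow> 'a measure) set" where
  "kernels M N = {k \<in> M \<rightarrow>\<^sub>M prob_algebra borel. M \<bind> k = N}"

lemma kernels_measurable: "k \<in> kernels M N \<Longrightarrow> k \<in> M \<rightarrow>\<^sub>M prob_algebra borel"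
  by (simp add: kernels_def)

lemma kernels_measurable_subprob: "k \<in> kernels M N \<Longrightarrow> k \<in> M \<rightarrow>\<^sub>M subprob_algebra borel"
  by (simp add: kernels_def measurable_prob_algebraD)

lemma kernels_in_space:
  assumes "k \<in> kernels M N" "x \<in> space M"
  shows "k x \<in> space (prob_algebra borel)"
  using measurable_space[OF kernels_measurable[OF assms(1)] assms(2)] .

lemma kernels_prob: "k \<in> kernels M N \<Longrightarrow> x \<in> space M \<Longrightarrow> prob_space (k x)"
  by (drule (1) kernels_in_space) (simp add: space_prob_algebra)

lemma kernels_sets: "k \<in> kernels M N \<Longrightarrow> x \<in> space M \<Longrightarrow> sets (k x) = sets borel"
  by (drule (1) kernels_in_space) (simp add: space_prob_algebra)

lemma kernels_space: "k \<in> kernels M N \<Longrightarrow> x \<in> space M \<Longrightarrow> space (k x) = UNIV"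
  using kernels_sets sets_eq_imp_space_eq by (metis space_borel)

lemma kernels_nn_integral:
  assumes "k \<in> kernels M N" "f \<in> borel_measurable borel"
  shows "(\<integral>\<^sup>+y. f y \<partial>N) = (\<integral>\<^sup>+x. \<integral>\<^sup>+y. f y \<partial>k x \<partial>M)"
  using nn_integral_bind[OF assms(2) kernels_measurable_subprob[OF assms(1)]] assms(1)
  by (simp add: kernels_def)

lemma kernels_AE:
  assumes "k \<in> kernels M N" "Measurable.pred borel P"
  shows "(AE y in N. P y) \<longleftrightarrow> (AE x in M. AE y in k x. P y)"
proof -
  have "N = M \<bind> k" using assms(1) by (simp add: kernels_def)
  then show ?thesis using AE_bind[OF kernels_measurable_subprob[OF assms(1)] assms(2)] by (simp only:)
qed

context prob_space
begin

lemma in_space_prob_algebra_self: "M \<in> space (prob_algebra M)"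
  by (simp add: space_prob_algebra prob_space_axioms)

lemma kernels_sets_mixture: "k \<in> kernels M N \<Longrightarrow> sets N = sets borel"
  using sets_bind'[OF in_space_prob_algebra_self kernels_measurable] by (auto simp: kernels_def)

lemma kernels_prob_mixture: "k \<in> kernels M N \<Longrightarrow> prob_space N"
  using prob_space_bind'[OF in_space_prob_algebra_self kernels_measurable] by (auto simp: kernels_def)

lemma kernels_emeasure:
  assumes "k \<in> kernels M N" "B \<in> sets borel"
  shows "emeasure N B = (\<integral>\<^sup>+x. emeasure (k x) B \<partial>M)"
  using emeasure_bind_prob_algebra[OF in_space_prob_algebra_self kernels_measurable[OF assms(1)] assms(2)] assms(1)
  by (simp add: kernels_def)

lemma kernels_measure_measurable:
  assumes "k \<in> kernels M N" "B \<in> sets borel"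
  shows "(\<lambda>x. measure (k x) B) \<in> borel_measurable M"
  using measurable_compose[OF kernels_measurable[OF assms(1)] measurable_measure_prob_algebra[OF assms(2)]] .

lemma kernels_measure:
  assumes k: "k \<in> kernels M N" and B: "B \<in> sets borel"
  shows "integrable M (\<lambda>x. measure (k x) B)" "(\<integral>x. measure (k x) B \<partial>M) = measure N B"
proof -
  note [measurable] = kernels_measure_measurable[OF k B]
  show I: "integrable M (\<lambda>x. measure (k x) B)"
    by (rule integrable_const_bound[of _ 1])
       (use prob_space.prob_le_1[OF kernels_prob[OF k]] in auto)
  have "emeasure N B = (\<integral>\<^sup>+x. ennreal (measure (k x) B) \<partial>M)"
    unfolding kernels_emeasure[OF k B]
    by (intro nn_integral_cong finite_measure.emeasure_eq_measure prob_space.finite_measure kernels_prob[OF k])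
  also have "\<dots> = ennreal (\<integral>x. measure (k x) B \<partial>M)"
    by (rule nn_integral_eq_integral[OF I]) simp
  finally show "(\<integral>x. measure (k x) B \<partial>M) = measure N B"
    by (simp add: measure_def)
qed

lemma kernels_integral_measurable:
  fixes f :: "'b::euclidean_space \<Rightarrow> 'c::{banach, second_countable_topology}"
  assumes "k \<in> kernels M N" "f \<in> borel_measurable borel"
  shows "(\<lambda>x. \<integral>y. f y \<partial>k x) \<in> borel_measurable M"
  using measurable_compose[OF kernels_measurable_subprob[OF assms(1)] integral_measurable_subprob_algebra[OF assms(2)]] .

lemma kernels_AE_integrable:
  fixes f :: "'b::euclidean_space \<Rightarrow> 'c::{banach, second_countable_topology}"
  assumes k: "k \<in> kernels M N" and f: "integrable N f"
  shows "AE x in M. integrable (k x) f"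
    and "integrable M (\<lambda>x. \<integral>y. norm (f y) \<partial>k x)"
proof -
  have [measurable]: "f \<in> borel_measurable borel"
    using f kernels_sets_mixture[OF k] by (auto cong: measurable_cong_sets)
  have nm: "(\<lambda>x. \<integral>\<^sup>+y. norm (f y) \<partial>k x) \<in> borel_measurable M"
    using measurable_compose[OF kernels_measurable_subprob[OF k]
        nn_integral_measurable_subprob_algebra[of "\<lambda>y. ennreal (norm (f y))" borel]] by simp
  have fin: "(\<integral>\<^sup>+x. \<integral>\<^sup>+y. norm (f y) \<partial>k x \<partial>M) < \<infinity>"
    using f by (simp add: kernels_nn_integral[OF k, symmetric] integrable_iff_bounded)
  then have "AE x in M. (\<integral>\<^sup>+y. norm (f y) \<partial>k x) \<noteq> \<infinity>"
    using nm by (intro nn_integral_PInf_AE) auto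
  then show AI: "AE x in M. integrable (k x) f"
    using AE_space
  proof eventually_elim
    case (elim x)
    then show ?case using kernels_sets[OF k elim(2)]
      by (intro integrableI_bounded) (auto cong: measurable_cong_sets simp: top.not_eq_extremum)
  qed
  have [measurable]: "(\<lambda>x. \<integral>y. norm (f y) \<partial>k x) \<in> borel_measurable M"
    by (rule kernels_integral_measurable[OF k]) simp
  have "(\<integral>\<^sup>+x. ennreal (norm (\<integral>y. norm (f y) \<partial>k x)) \<partial>M) \<le> (\<integral>\<^sup>+x. \<integral>\<^sup>+y. norm (f y) \<partial>k x \<partial>M)"
    using AI
  proof (intro nn_integral_mono_AE, eventually_elim)
    case (elim x)
    then show ?case by (subst nn_integral_eq_integral) auto
  qed
  then show "integrable M (\<lambda>x. \<integral>y. norm (f y) \<partial>k x)"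
    using fin by (intro integrableI_bounded) auto
qed

text \<open>Fubini's theorem for the mixture. It is proved by approximation rather than from
  positive parts because \<open>f\<close> is vector-valued: it is needed for the identity and for
  the pair \<open>moments\<close>.\<close>

lemma kernels_integral:
  fixes f :: "'b::euclidean_space \<Rightarrow> 'c::{banach, second_countable_topology}"
  assumes k: "k \<in> kernels M N" and f: "integrable N f"
  shows "integrable M (\<lambda>x. \<integral>y. f y \<partial>k x)"
    and "(\<integral>x. \<integral>y. f y \<partial>k x \<partial>M) = (\<integral>y. f y \<partial>N)"
proof -
  have sN: "sets N = sets borel" by (rule kernels_sets_mixture[OF k])
  have "integrable M (\<lambda>x. \<integral>y. f y \<partial>k x) \<and> (\<integral>x. \<integral>y. f y \<partial>k x \<partial>M) = (\<integral>y. f y \<partial>N)"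
    using f
  proof (induction rule: integrable_induct)
    case (base A c)
    have A: "A \<in> sets borel" using base sN by simp
    have eq: "(\<integral>y. indicator A y *\<^sub>R c \<partial>k x) = measure (k x) A *\<^sub>R c" if x: "x \<in> space M" for x
    proof -
      interpret kx: prob_space "k x" by (rule kernels_prob[OF k x])
      have "A \<in> sets (k x)" using kernels_sets[OF k x] A by simp
      then show ?thesis
        by (intro has_bochner_integral_integral_eq has_bochner_integral_indicator)
           (simp_all add: kx.emeasure_eq_measure)
    qed
    interpret N: prob_space N by (rule kernels_prob_mixture[OF k])
    show ?case
      using kernels_measure[OF k A] base
      by (auto simp: eq cong: Bochner_Integration.integrable_cong Bochner_Integration.integral_cong)
  next
    case (add f g)
    note [measurable] = kernels_integral_measurable[OF k]
    have [measurable]: "f \<in> borel_measurable borel" "g \<in> borel_measurable borel"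
      using add.hyps sN by (auto cong: measurable_cong_sets)
    have *: "AE x in M. (\<integral>y. f y + g y \<partial>k x) = (\<integral>y. f y \<partial>k x) + (\<integral>y. g y \<partial>k x)"
      using kernels_AE_integrable(1)[OF k add.hyps(1)] kernels_AE_integrable(1)[OF k add.hyps(2)]
      by eventually_elim simp
    then have "integrable M (\<lambda>x. \<integral>y. f y + g y \<partial>k x)"
      using add.IH by (subst integrable_cong_AE[OF _ _ *]) (auto intro: borel_measurable_integrable)
    moreover have "(\<integral>x. \<integral>y. f y + g y \<partial>k x \<partial>M) = (\<integral>x. (\<integral>y. f y \<partial>k x) + (\<integral>y. g y \<partial>k x) \<partial>M)"
      using * by (intro integral_cong_AE) (auto simp: add.IH borel_measurable_integrable)
    ultimately show ?case using add by simp
  next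
    case (lim f s)
    have [measurable]: "f \<in> borel_measurable borel" "\<And>i. s i \<in> borel_measurable borel"
      using lim.hyps sN by (auto cong: measurable_cong_sets)
    have spN: "space N = UNIV" using sets_eq_imp_space_eq[OF sN] by simp
    have meas: "(\<lambda>x. \<integral>y. f y \<partial>k x) \<in> borel_measurable M" "\<And>i. (\<lambda>x. \<integral>y. s i y \<partial>k x) \<in> borel_measurable M"
      by (auto intro!: kernels_integral_measurable[OF k])
    have AI: "AE x in M. integrable (k x) f \<and> x \<in> space M"
      using kernels_AE_integrable(1)[OF k lim.hyps(4)] AE_space by eventually_elim simp
    \<comment> \<open>Dominated convergence is used twice, under \<open>k x\<close> with bound
      \<open>2 * norm (f y)\<close> and under \<open>M\<close> with the conditional integral of that
      bound.\<close>
    have w: "integrable M (\<lambda>x. \<integral>y. 2 * norm (f y) \<partial>k x)"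
      using kernels_AE_integrable(2)[OF k lim.hyps(4)] by simp
    have dc: "(\<lambda>i. \<integral>y. s i y \<partial>k x) \<longlonglongrightarrow> (\<integral>y. f y \<partial>k x)"
      and nb: "norm (\<integral>y. s i y \<partial>k x) \<le> (\<integral>y. 2 * norm (f y) \<partial>k x)"
      if x: "integrable (k x) f \<and> x \<in> space M" for x i
    proof -
      have mk: "f \<in> borel_measurable (k x)" "\<And>i. s i \<in> borel_measurable (k x)"
        using x kernels_sets[OF k] by (auto cong: measurable_cong_sets)
      have i2: "integrable (k x) (\<lambda>y. 2 * norm (f y))" using x by simp
      show "(\<lambda>i. \<integral>y. s i y \<partial>k x) \<longlonglongrightarrow> (\<integral>y. f y \<partial>k x)"
        using lim.hyps by (intro integral_dominated_convergence[OF mk i2]) (auto simp: spN)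
      have "integrable (k x) (s i)"
        by (rule Bochner_Integration.integrable_bound[OF i2 mk(2)]) (use lim.hyps in \<open>auto simp: spN\<close>)
      then have "norm (\<integral>y. s i y \<partial>k x) \<le> (\<integral>y. norm (s i y) \<partial>k x)" by simp
      also have "\<dots> \<le> (\<integral>y. 2 * norm (f y) \<partial>k x)"
        using \<open>integrable (k x) (s i)\<close> i2 lim.hyps(3) by (intro integral_mono) (auto simp: spN)
      finally show "norm (\<integral>y. s i y \<partial>k x) \<le> (\<integral>y. 2 * norm (f y) \<partial>k x)" .
    qed
    have aedc: "AE x in M. (\<lambda>i. \<integral>y. s i y \<partial>k x) \<longlonglongrightarrow> (\<integral>y. f y \<partial>k x)"
      using AI by eventually_elim (rule dc)
    have aenb: "\<And>i. AE x in M. norm (\<integral>y. s i y \<partial>k x) \<le> (\<integral>y. 2 * norm (f y) \<partial>k x)"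
      using AI by eventually_elim (rule nb)
    have 1: "(\<lambda>i. \<integral>x. \<integral>y. s i y \<partial>k x \<partial>M) \<longlonglongrightarrow> (\<integral>x. \<integral>y. f y \<partial>k x \<partial>M)"
      by (rule integral_dominated_convergence[OF meas w aedc aenb])
    have 2: "(\<lambda>i. \<integral>y. s i y \<partial>N) \<longlonglongrightarrow> (\<integral>y. f y \<partial>N)"
      using lim.hyps by (intro integral_dominated_convergence[where w="\<lambda>y. 2 * norm (f y)"])
        (auto intro: borel_measurable_integrable)
    have "integrable M (\<lambda>x. \<integral>y. f y \<partial>k x)"
      by (rule integrable_dominated_convergence[OF meas w aedc aenb])
    moreover have "(\<integral>x. \<integral>y. f y \<partial>k x \<partial>M) = (\<integral>y. f y \<partial>N)"
      using LIMSEQ_unique[OF 1] 2 lim.IH by simp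
    ultimately show ?case by simp
  qed
  then show "integrable M (\<lambda>x. \<integral>y. f y \<partial>k x)" "(\<integral>x. \<integral>y. f y \<partial>k x \<partial>M) = (\<integral>y. f y \<partial>N)" by auto
qed

end

section \<open>Kernels from conditional distribution functions; disintegration\<close>

lemma lower_one [simp]: "lower 1 = UNIV"
  unfolding lower_def using enc_bounds(2) by (auto intro: less_imp_le)

lemma lower_ge_one: "1 \<le> q \<Longrightarrow> lower q = UNIV"
  unfolding lower_def using enc_bounds(2) by (metis (mono_tags) UNIV_eq_I mem_Collect_eq less_imp_le of_rat_1 of_rat_less_eq order_trans)

lemma lower_neg: "q < 0 \<Longrightarrow> lower q = {}"
  unfolding lower_def using enc_bounds(1) by (auto simp: not_le intro: less_le_trans[OF _ enc_bounds(1)])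

lemma lower_mono: "p \<le> q \<Longrightarrow> lower p \<subseteq> lower q"
  unfolding lower_def by (auto simp: of_rat_less_eq intro: order_trans)

text \<open>A quantile construction controls the second distribution function only up to a shift of
  the argument. Rationals decreasing to \<open>t\<close> and right continuity of both functions
  absorb the shift.\<close>

lemma real_distribution_eq_squeeze:
  assumes D: "real_distribution D" and E: "real_distribution E"
    and "\<And>q. cdf D (real_of_rat q) \<le> cdf E (real_of_rat q)"
    and "\<And>p q. p < q \<Longrightarrow> cdf E (real_of_rat p) \<le> cdf D (real_of_rat q)"
  shows "D = E"
proof (rule cdf_unique[OF D E])
  interpret D: real_distribution D by (rule D)
  interpret E: real_distribution E by (rule E)
  show "cdf D = cdf E"
  proof
    fix t :: real
    have "\<exists>q. t < real_of_rat q \<and> real_of_rat q < t + 1 / real (Suc n)" for n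
      using of_rat_dense[of t "t + 1 / real (Suc n)"] by auto
    then obtain p where p: "\<And>n. t < real_of_rat (p n)" "\<And>n. real_of_rat (p n) < t + 1 / real (Suc n)"
      by metis
    have "(\<lambda>n. real_of_rat (p n)) \<longlonglongrightarrow> t"
    proof (rule tendsto_sandwich[of "\<lambda>_. t" _ _ "\<lambda>n. t + 1 / real (Suc n)"])
      show "(\<lambda>n. t + 1 / real (Suc n)) \<longlonglongrightarrow> t"
        using tendsto_add[OF tendsto_const[of t] LIMSEQ_inverse_real_of_nat] by (simp add: inverse_eq_divide)
      show "\<forall>\<^sub>F n in sequentially. real_of_rat (p n) \<le> t + 1 / real (Suc n)"
        using p(2) by (intro always_eventually allI less_imp_le)
    qed (use p(1) in \<open>auto intro!: always_eventually less_imp_le\<close>)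
    then have lim: "filterlim (\<lambda>n. real_of_rat (p n)) (at_right t) sequentially"
      using p(1) by (auto simp: filterlim_at intro!: always_eventually dest: less_imp_neq)
    have "(\<lambda>n. cdf D (real_of_rat (p n))) \<longlonglongrightarrow> cdf D t" "(\<lambda>n. cdf E (real_of_rat (p n))) \<longlonglongrightarrow> cdf E t"
      using filterlim_compose[OF _ lim] D.cdf_is_right_cont[of t] E.cdf_is_right_cont[of t]
      by (auto simp: continuous_within)
    moreover have "cdf E t \<le> cdf D (real_of_rat (p n))" for n
    proof -
      obtain q where q: "t < real_of_rat q" "real_of_rat q < real_of_rat (p n)" using of_rat_dense[OF p(1)] by blast
      have "cdf E t \<le> cdf E (real_of_rat q)" using q by (intro E.cdf_nondecreasing) simp
      also have "\<dots> \<le> cdf D (real_of_rat (p n))" using q by (intro assms(4)) (simp add: of_rat_less)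
      finally show ?thesis .
    qed
    moreover have "cdf D t \<le> cdf E (real_of_rat (p n))" for n
      using D.cdf_nondecreasing[of t "real_of_rat (p n)"] assms(3)[of "p n"] p(1)[of n] by simp
    ultimately show "cdf D t = cdf E t"
      by (meson LIMSEQ_le_const antisym)
  qed
qed

text \<open>The rigidity principle behind every equality case below: the atoms of the constructed
  kernels, strict Jensen, and uniqueness of the minimiser.\<close>

lemma AE_eq_of_le_integral_eq:
  fixes f g :: "'x \<Rightarrow> real"
  assumes f: "integrable M f" and g: "integrable M g" and le: "AE x in M. f x \<le> g x"
    and eq: "(\<integral>x. f x \<partial>M) = (\<integral>x. g x \<partial>M)"
  shows "AE x in M. f x = g x"
proof -
  have "AE x in M. g x - f x = 0"
    using assms by (subst integral_nonneg_eq_0_iff_AE[symmetric]) auto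
  then show ?thesis by eventually_elim simp
qed

lemma AE_le_of_set_integral_le:
  fixes f g :: "'x \<Rightarrow> real"
  assumes f: "integrable M f" and g: "integrable M g"
    and le: "\<And>A. A \<in> sets M \<Longrightarrow> (\<integral>x. indicator A x * f x \<partial>M) \<le> (\<integral>x. indicator A x * g x \<partial>M)"
  shows "AE x in M. f x \<le> g x"
proof -
  note [measurable] = borel_measurable_integrable[OF f] borel_measurable_integrable[OF g]
  define A where "A = {x \<in> space M. g x < f x}"
  have A[measurable]: "A \<in> sets M" unfolding A_def by measurable
  have iA: "integrable M (\<lambda>x. indicator A x * f x)" "integrable M (\<lambda>x. indicator A x * g x)"
    using integrable_mult_indicator[OF A f] integrable_mult_indicator[OF A g] by auto
  have "AE x in M. indicator A x * g x = indicator A x * f x"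
  proof (rule AE_eq_of_le_integral_eq[OF iA(2,1)])
    show "AE x in M. indicator A x * g x \<le> indicator A x * f x"
      by (auto simp: A_def indicator_def)
    then show "(\<integral>x. indicator A x * g x \<partial>M) = (\<integral>x. indicator A x * f x \<partial>M)"
      using le[OF A] integral_mono_AE[OF iA(2,1)] by simp
  qed
  with AE_space show ?thesis
    by eventually_elim (auto simp: A_def indicator_def split: if_splits)
qed

context prob_space
begin

text \<open>The kernel is the law of \<open>dec\<close> composed with the quantile function of \<open>m _ x\<close>. No right
  continuity of \<open>m _ x\<close> is assumed; the atoms are correct almost everywhere because the mixture
  of the laws has the distribution function of \<open>N\<close>.\<close>

lemma kernel_of_cdf:
  fixes N :: "'b::euclidean_space measure" and m :: "rat \<Rightarrow> 'a \<Rightarrow> real"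
  assumes N: "prob_space N" "sets N = sets borel"
    and m[measurable]: "\<And>q. m q \<in> borel_measurable M"
    and mono: "AE x in M. \<forall>p q. p \<le> q \<longrightarrow> m p x \<le> m q x"
    and low: "AE x in M. \<forall>q<0. m q x = 0" and high: "AE x in M. \<forall>q\<ge>1. m q x = 1"
    and int: "\<And>q. (\<integral>x. m q x \<partial>M) = measure N (lower q)"
  obtains k where "k \<in> kernels M N" "AE x in M. \<forall>q. measure (k x) (lower q) = m q x"
proof -
  interpret N: prob_space N by (rule N)
  define good where "good x \<longleftrightarrow> (\<forall>p q. p \<le> q \<longrightarrow> m p x \<le> m q x) \<and> (\<forall>q<0. m q x = 0) \<and> (\<forall>q\<ge>1. m q x = 1)" for x
  have good: "AE x in M. good x"
    using mono low high by eventually_elim (simp add: good_def)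
  have m01: "0 \<le> m q x" "m q x \<le> 1" if "good x" for q x
  proof -
    have "m (min q (-1)) x \<le> m q x" "m q x \<le> m (max q 1) x"
      using that unfolding good_def by (meson min.cobounded1 max.cobounded1)+
    moreover have "m (min q (-1)) x = 0" "m (max q 1) x = 1"
      using that unfolding good_def by (auto simp: min_def)
    ultimately show "0 \<le> m q x" "m q x \<le> 1" by auto
  qed
  have intm: "integrable M (m q)" for q
    by (rule integrable_const_bound[of _ 1]) (use good m01 in \<open>auto elim: eventually_mono\<close>)
  \<comment> \<open>The point 0 is left out: at \<open>u = 0\<close> all negative \<open>q\<close>
    satisfy \<open>u \<le> m q x\<close>, and the infimum \<open>Q x u\<close> would be minus
    infinity.\<close>
  define U where "U = uniform_measure lborel {0<..1::real}"
  interpret U: prob_space U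
    unfolding U_def by (rule prob_space_uniform_measure) auto
  have sU[measurable_cong]: "sets U = sets borel" by (simp add: U_def)
  have spU: "space U = UNIV" by (simp add: U_def)
  have Ule: "measure U {u. u \<le> c} = c" if "0 \<le> c" "c \<le> 1" for c
  proof -
    have "{0<..1} \<inter> {u. u \<le> c} = {0<..c}" using that by auto
    then show ?thesis using that divide_ennreal[of c 1] by (simp add: U_def measure_def emeasure_uniform_measure)
  qed
  have AEU: "AE u in U. 0 < u \<and> u \<le> 1"
    unfolding U_def by (rule AE_uniform_measureI) auto
  \<comment> \<open>A countable infimum, hence jointly measurable in \<open>x\<close> and
    \<open>u\<close>. It need not be attained, which is why \<open>Rge\<close> asks for a strict
    inequality and \<open>Kle\<close> for \<open>p < q\<close>.\<close>
  define Q where "Q x u = (INF q. if u \<le> m q x then ereal (real_of_rat q) else \<infinity>)" for x and u :: real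
  define R where "R x u = real_of_ereal (Q x u)" for x u
  have R[measurable]: "(\<lambda>(x, u). R x u) \<in> borel_measurable (M \<Otimes>\<^sub>M borel)"
    unfolding R_def Q_def by measurable
  define K where "K x = distr U borel (R x)" for x
  have Kmeas: "K \<in> M \<rightarrow>\<^sub>M prob_algebra borel"
    unfolding K_def
    by (rule measurable_distr_prob_space2[where M=borel])
       (auto simp: space_prob_algebra sU U.prob_space_axioms)
  have Rx: "R x \<in> borel_measurable borel" if "x \<in> space M" for x
    using measurable_Pair2[OF R that] by simp
  have Rle: "u \<le> m q x \<Longrightarrow> R x u \<le> real_of_rat q"
    and Rge: "R x u < real_of_rat q \<Longrightarrow> u \<le> m q x"
    if gx: "good x" and u: "0 < u" "u \<le> 1" for x u q
  proof -
    have "Q x u \<ge> ereal 0"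
      unfolding Q_def
    proof (rule INF_greatest)
      fix q
      show "ereal 0 \<le> (if u \<le> m q x then ereal (real_of_rat q) else \<infinity>)"
        using gx u by (cases "q < 0") (auto simp: good_def)
    qed
    moreover have "Q x u \<le> ereal 1"
      unfolding Q_def using gx u by (intro INF_lower2[of 1]) (auto simp: good_def)
    ultimately have QR: "Q x u = ereal (R x u)"
      unfolding R_def by (cases "Q x u") auto
    show "R x u \<le> real_of_rat q" if "u \<le> m q x"
    proof -
      have "Q x u \<le> ereal (real_of_rat q)"
        unfolding Q_def using that by (intro INF_lower2[of q]) auto
      then show ?thesis by (simp add: QR)
    qed
    show "u \<le> m q x" if "R x u < real_of_rat q"
    proof -
      have "Q x u < ereal (real_of_rat q)" using that by (simp add: QR)
      then obtain p where "(if u \<le> m p x then ereal (real_of_rat p) else \<infinity>) < ereal (real_of_rat q)"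
        unfolding Q_def INF_less_iff by blast
      then have "u \<le> m p x" "p < q" by (auto split: if_splits simp: of_rat_less)
      then show ?thesis using gx unfolding good_def by (meson less_imp_le order_trans)
    qed
  qed
  have Kge: "m q x \<le> measure (K x) {..real_of_rat q}"
    and Kle: "p < q \<Longrightarrow> measure (K x) {..real_of_rat p} \<le> m q x"
    if gx: "good x" and x: "x \<in> space M" for x p q
  proof -
    note [measurable] = Rx[OF x]
    have eq: "measure (K x) {..t} = measure U {u. R x u \<le> t}" for t
      unfolding K_def by (subst measure_distr) (auto simp: spU vimage_def)
    have "m q x = measure U {u. u \<le> m q x}"
      using m01[OF gx] by (simp add: Ule)
    also have "\<dots> \<le> measure U {u. R x u \<le> real_of_rat q}"
    proof (rule U.finite_measure_mono_AE)
      show "AE u in U. u \<in> {u. u \<le> m q x} \<longrightarrow> u \<in> {u. R x u \<le> real_of_rat q}"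
        using AEU by eventually_elim (use Rle[OF gx] in blast)
    qed (simp add: sU)
    finally show "m q x \<le> measure (K x) {..real_of_rat q}" by (simp add: eq)
    assume "p < q"
    then have pq: "real_of_rat p < real_of_rat q" by (simp add: of_rat_less)
    have "measure U {u. R x u \<le> real_of_rat p} \<le> measure U {u. u \<le> m q x}"
    proof (rule U.finite_measure_mono_AE)
      show "AE u in U. u \<in> {u. R x u \<le> real_of_rat p} \<longrightarrow> u \<in> {u. u \<le> m q x}"
        using AEU by eventually_elim (use Rge[OF gx] pq in force)
    qed (simp add: sU)
    also have "\<dots> = m q x" using m01[OF gx] by (simp add: Ule)
    finally show "measure (K x) {..real_of_rat p} \<le> m q x" by (simp add: eq)
  qed
  have encN[measurable]: "enc \<in> borel_measurable N"
    using N(2) by (simp cong: measurable_cong_sets)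
  define D where "D = distr N borel (enc :: 'b \<Rightarrow> real)"
  interpret D: real_distribution D
    unfolding D_def by (rule N.real_distribution_distr) simp
  have cdfD: "cdf D (real_of_rat q) = measure N (lower q)" for q
    unfolding D_def cdf_def
    by (subst measure_distr) (auto simp: lower_def sets_eq_imp_space_eq[OF N(2)] vimage_def)
  define E where "E = M \<bind> K"
  have KE: "K \<in> kernels M E" using Kmeas by (simp add: kernels_def E_def)
  interpret E: real_distribution E
    using kernels_prob_mixture[OF KE] kernels_sets_mixture[OF KE]
    by (simp add: real_distribution_def real_distribution_axioms_def)
  have cdfE: "cdf E t = (\<integral>x. measure (K x) {..t} \<partial>M)" for t
    using kernels_measure(2)[OF KE, of "{..t}"] by (simp add: cdf_def)
  have gs: "AE x in M. good x \<and> x \<in> space M" using good AE_space by eventually_elim simp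
  \<comment> \<open>Averaged over \<open>x\<close>, the bounds \<open>Kge\<close> and
    \<open>Kle\<close> are the two hypotheses of the squeeze, since \<open>int\<close> says that the
    mean of \<open>m q\<close> is the distribution function of \<open>D\<close>.\<close>
  have DE: "D = E"
  proof (rule real_distribution_eq_squeeze)
    show "real_distribution D" "real_distribution E" by unfold_locales
    show "cdf D (real_of_rat q) \<le> cdf E (real_of_rat q)" for q
      unfolding cdfD cdfE int[symmetric]
    proof (intro integral_mono_AE intm kernels_measure(1)[OF KE])
      show "AE x in M. m q x \<le> measure (K x) {..real_of_rat q}"
        using gs by eventually_elim (simp add: Kge)
    qed simp
    show "p < q \<Longrightarrow> cdf E (real_of_rat p) \<le> cdf D (real_of_rat q)" for p q
      unfolding cdfD cdfE int[symmetric]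
    proof (intro integral_mono_AE intm kernels_measure(1)[OF KE])
      assume pq: "p < q"
      show "AE x in M. measure (K x) {..real_of_rat p} \<le> m q x"
        using gs by eventually_elim (simp add: Kle[OF _ _ pq])
    qed simp
  qed
  \<comment> \<open>The inequality \<open>Kge\<close> now has the same integral on both sides, so it
    is an equality almost everywhere, also at rationals where \<open>m _ x\<close> might
    jump.\<close>
  have Keq: "AE x in M. measure (K x) {..real_of_rat q} = m q x" for q
  proof -
    have "AE x in M. m q x = measure (K x) {..real_of_rat q}"
    proof (rule AE_eq_of_le_integral_eq[OF intm kernels_measure(1)[OF KE]])
      show "AE x in M. m q x \<le> measure (K x) {..real_of_rat q}"
        using gs by eventually_elim (simp add: Kge)
      show "(\<integral>x. m q x \<partial>M) = (\<integral>x. measure (K x) {..real_of_rat q} \<partial>M)"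
        unfolding cdfE[symmetric] int DE[symmetric] cdfD ..
    qed simp
    then show ?thesis by eventually_elim simp
  qed
  define k where "k x = distr (K x) borel (dec :: real \<Rightarrow> 'b)" for x
  have kmeas: "k \<in> M \<rightarrow>\<^sub>M prob_algebra borel"
    unfolding k_def by (rule measurable_compose[OF Kmeas measurable_distr_prob_space]) simp
  have "M \<bind> k = distr E borel dec"
    unfolding k_def E_def
    by (rule distr_bind[symmetric, OF measurable_prob_algebraD[OF Kmeas] not_empty]) simp
  also have "\<dots> = distr N borel (\<lambda>y. y)"
    unfolding DE[symmetric] D_def by (subst distr_distr) (auto simp: comp_def)
  also have "\<dots> = N" using N(2) by (simp add: distr_id2)
  finally have kk: "k \<in> kernels M N" using kmeas by (simp add: kernels_def)
  \<comment> \<open>Only points in the range of \<open>enc\<close> satisfy this, but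
    \<open>E\<close> is the law of \<open>enc\<close> under \<open>N\<close>. Almost every
    \<open>K x\<close> is therefore carried by that range, where preimages of \<open>lower q\<close>
    under \<open>dec\<close> are half-lines.\<close>
  have "AE t in E. enc (dec t :: 'b) = t"
    unfolding DE[symmetric] D_def by (subst AE_distr_iff) auto
  then have "AE x in M. AE t in K x. enc (dec t :: 'b) = t"
    by (subst (asm) kernels_AE[OF KE]) auto
  then have "AE x in M. \<forall>q. measure (k x) (lower q) = measure (K x) {..real_of_rat q}"
    using AE_space
  proof eventually_elim
    case (elim x)
    have [measurable_cong]: "sets (K x) = sets borel" by (simp add: K_def)
    show ?case
    proof
      fix q
      have "measure (k x) (lower q) = measure (K x) {t \<in> space (K x). enc (dec t :: 'b) \<le> real_of_rat q}"
        unfolding k_def by (subst measure_distr) (auto simp: lower_def vimage_def Int_def conj_commute)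
      also have "\<dots> = measure (K x) {..real_of_rat q}"
        using elim(1) by (intro measure_eq_AE) (auto elim!: eventually_mono simp: K_def)
      finally show "measure (k x) (lower q) = measure (K x) {..real_of_rat q}" .
    qed
  qed
  moreover have "AE x in M. \<forall>q. measure (K x) {..real_of_rat q} = m q x"
    using Keq by (simp add: AE_all_countable)
  ultimately have "AE x in M. \<forall>q. measure (k x) (lower q) = m q x"
    by eventually_elim simp
  with kk show ?thesis by (rule that)
qed

end

section \<open>Disintegration of couplings\<close>

lemma measure_eq_of_rectangles:
  fixes P Q :: "('a::euclidean_space \<times> 'b::euclidean_space) measure"
  assumes P: "prob_space P" "sets P = sets borel" and Q: "prob_space Q" "sets Q = sets borel"
    and eq: "\<And>A q. A \<in> sets borel \<Longrightarrow> measure P (A \<times> lower q) = measure Q (A \<times> lower q)"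
  shows "P = Q"
proof -
  interpret P: prob_space P by (rule P)
  interpret Q: prob_space Q by (rule Q)
  have rect[measurable]: "A \<times> B \<in> sets borel" if "A \<in> sets borel" "B \<in> sets borel" for A :: "'a set" and B :: "'b set"
    unfolding borel_prod[symmetric] by (rule pair_measureI[OF that])
  have all: "measure P (A \<times> B) = measure Q (A \<times> B)" if A: "A \<in> sets borel" and "B \<in> sets borel" for A B
    using that(2)
  proof (induction rule: sets_borel_induct_lower)
    case (compl B)
    have "A \<times> - B = A \<times> UNIV - A \<times> B" by auto
    moreover have "measure P (A \<times> UNIV) = measure Q (A \<times> UNIV)" using eq[OF A, of 1] by simp
    ultimately show ?case
      using A compl rect[OF A, of UNIV] rect[OF A compl(1)] P(2) Q(2)
      by (simp add: P.finite_measure_Diff Q.finite_measure_Diff Sigma_mono)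
  next
    case (union B)
    have e: "A \<times> (\<Union>i. B i) = (\<Union>i. A \<times> B i)" by auto
    have d: "disjoint_family (\<lambda>i. A \<times> B i)"
      using union(1) by (auto simp: disjoint_family_on_def)
    have "(\<lambda>i. measure P (A \<times> B i)) sums measure P (\<Union>i. A \<times> B i)"
      using union A P(2) d by (intro P.finite_measure_UNION) auto
    moreover have "(\<lambda>i. measure Q (A \<times> B i)) sums measure Q (\<Union>i. A \<times> B i)"
      using union A Q(2) d by (intro Q.finite_measure_UNION) auto
    ultimately show ?case unfolding e using union(3) sums_unique2 by simp
  qed (use eq A in auto)
  have sb: "sets (borel :: ('a \<times> 'b) measure)
      = sigma_sets UNIV {A \<times> B | A B. A \<in> sets (borel :: 'a measure) \<and> B \<in> sets (borel :: 'b measure)}"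
    unfolding borel_prod[symmetric] sets_pair_measure by simp
  let ?E = "{A \<times> B | A B. A \<in> sets (borel :: 'a measure) \<and> B \<in> sets (borel :: 'b measure)}"
  show ?thesis
  proof (rule measure_eqI_generator_eq[where \<Omega>=UNIV and A="\<lambda>_. UNIV" and E="?E"])
    show "Int_stable ?E"
      using Int_stable_pair_measure_generator by auto
    show "range (\<lambda>_::nat. UNIV) \<subseteq> ?E"
      by (intro image_subsetI CollectI exI[of _ UNIV] conjI) simp_all
    show "sets P = sigma_sets UNIV ?E" "sets Q = sigma_sets UNIV ?E"
      by (rule P(2)[unfolded sb], rule Q(2)[unfolded sb])
    show "emeasure P X = emeasure Q X" if "X \<in> ?E" for X
    proof -
      obtain A B where "X = A \<times> B" "A \<in> sets borel" "B \<in> sets borel" using \<open>X \<in> ?E\<close> by blast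
      then show ?thesis by (simp only: P.emeasure_eq_measure Q.emeasure_eq_measure all)
    qed
    show "emeasure P UNIV \<noteq> \<infinity>" for i :: nat
      by (simp add: P.emeasure_eq_measure)
  qed auto
qed

lemma couplingsD:
  fixes \<pi> :: "('a::euclidean_space \<times> 'a) measure"
  assumes "\<pi> \<in> couplings \<mu> \<nu>"
  shows "sets \<pi> = sets borel" "prob_space \<pi>" "distr \<pi> borel fst = \<mu>" "distr \<pi> borel snd = \<nu>"
    "prob_space \<mu>" "prob_space \<nu>" "sets \<mu> = sets borel" "sets \<nu> = sets borel"
proof -
  show a: "sets \<pi> = sets borel" "prob_space \<pi>" "distr \<pi> borel fst = \<mu>" "distr \<pi> borel snd = \<nu>"
    using assms by (auto simp: couplings_def)
  have [measurable_cong]: "sets \<pi> = sets (borel \<Otimes>\<^sub>M borel)" unfolding borel_prod by (rule a(1))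
  show "prob_space \<mu>" "prob_space \<nu>"
    unfolding a(3)[symmetric] a(4)[symmetric] by (intro prob_space.prob_space_distr[OF a(2)]; measurable)+
  show "sets \<mu> = sets borel" "sets \<nu> = sets borel"
    unfolding a(3)[symmetric] a(4)[symmetric] by simp_all
qed

lemma pair_kernel_measurable:
  fixes k :: "'a::euclidean_space \<Rightarrow> 'a measure"
  assumes "k \<in> borel \<rightarrow>\<^sub>M prob_algebra borel"
  shows "(\<lambda>x. distr (k x) borel (Pair x)) \<in> borel \<rightarrow>\<^sub>M prob_algebra borel"
proof (rule measurable_distr_prob_space2[OF assms])
  have "(\<lambda>(x, y). (x, y)) \<in> borel \<Otimes>\<^sub>M borel \<rightarrow>\<^sub>M (borel \<Otimes>\<^sub>M borel :: ('a \<times> 'a) measure)" by simp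
  then show "(\<lambda>(x, y). (x, y)) \<in> borel \<Otimes>\<^sub>M borel \<rightarrow>\<^sub>M (borel :: ('a \<times> 'a) measure)"
    by (simp add: borel_prod)
qed

text \<open>The coupling itself becomes a mixture over the first marginal, of laws on the product
  space, so the integration lemmas for kernels apply to it.\<close>

lemma kernel_prod_kernels:
  fixes \<mu> :: "'a::euclidean_space measure"
  assumes "sets \<mu> = sets borel" "k \<in> kernels \<mu> \<nu>"
  shows "(\<lambda>x. distr (k x) borel (Pair x)) \<in> kernels \<mu> (kernel_prod \<mu> k)"
proof -
  have "k \<in> borel \<rightarrow>\<^sub>M prob_algebra borel"
    using kernels_measurable[OF assms(2)] assms(1) by (simp cong: measurable_cong_sets)
  from pair_kernel_measurable[OF this] show ?thesis
    using assms(1) by (simp add: kernels_def kernel_prod_def cong: measurable_cong_sets)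
qed

lemma kernel_prod_couplings:
  fixes \<mu> :: "'a::euclidean_space measure"
  assumes "prob_space \<mu>" "sets \<mu> = sets borel" "k \<in> kernels \<mu> \<nu>"
  shows "kernel_prod \<mu> k \<in> couplings \<mu> \<nu>"
proof -
  interpret prob_space \<mu> by (rule assms)
  note kk = kernel_prod_kernels[OF assms(2,3)]
  let ?P = "\<lambda>x. distr (k x) borel (Pair x)"
  have sp: "space \<mu> = UNIV" using sets_eq_imp_space_eq[OF assms(2)] by simp
  have fm: "fst \<in> (borel :: ('a \<times> 'a) measure) \<rightarrow>\<^sub>M borel" and sm: "snd \<in> (borel :: ('a \<times> 'a) measure) \<rightarrow>\<^sub>M borel"
    by (simp_all add: borel_prod[symmetric])
  have Pm: "Pair x \<in> (borel :: 'a measure) \<rightarrow>\<^sub>M (borel :: ('a \<times> 'a) measure)" for x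
    by (simp add: borel_prod[symmetric])
  have Pk: "Pair x \<in> k x \<rightarrow>\<^sub>M (borel :: ('a \<times> 'a) measure)" for x
    using Pm[of x] kernels_sets[OF assms(3)] sp by (simp cong: measurable_cong_sets)
  have "distr (kernel_prod \<mu> k) borel fst = \<mu> \<bind> (\<lambda>x. distr (?P x) borel fst)"
    unfolding kernel_prod_def
    by (rule distr_bind[OF kernels_measurable_subprob[OF kk] not_empty fm])
  also have "\<dots> = \<mu> \<bind> return \<mu>"
  proof (rule bind_cong)
    fix x
    interpret kx: prob_space "k x" using kernels_prob[OF assms(3)] sp by simp
    have "distr (?P x) borel fst = distr (k x) borel (\<lambda>_. x)"
      by (subst distr_distr[OF fm Pk]) (simp add: comp_def)
    also have "\<dots> = return \<mu> x"
      using kx.distr_const[of x borel] return_sets_cong[OF assms(2)] by simp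
    finally show "distr (?P x) borel fst = return \<mu> x" .
  qed simp
  also have "\<dots> = \<mu>" by (rule bind_return'')  simp
  finally have 1: "distr (kernel_prod \<mu> k) borel fst = \<mu>" .
  have "distr (kernel_prod \<mu> k) borel snd = \<mu> \<bind> (\<lambda>x. distr (?P x) borel snd)"
    unfolding kernel_prod_def
    by (rule distr_bind[OF kernels_measurable_subprob[OF kk] not_empty sm])
  also have "\<dots> = \<mu> \<bind> k"
  proof (rule bind_cong)
    fix x
    have "distr (?P x) borel snd = distr (k x) borel (\<lambda>y. y)"
      by (subst distr_distr[OF sm Pk]) (simp add: comp_def)
    then show "distr (?P x) borel snd = k x"
      using kernels_sets[OF assms(3)] sp by (simp add: distr_id2)
  qed simp
  also have "\<dots> = \<nu>" using assms(3) by (simp add: kernels_def)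
  finally have 2: "distr (kernel_prod \<mu> k) borel snd = \<nu>" .
  show ?thesis
    using 1 2 kernels_prob_mixture[OF kk] kernels_sets_mixture[OF kk] by (simp add: couplings_def)
qed

text \<open>The conditional distribution function \<open>m q\<close> is the Radon-Nikodym density of
  \<open>A \<mapsto> \<pi>(A \<times> lower q)\<close> with respect to \<mu>. Its monotonicity and
  boundary values hold almost everywhere for each rational or pair of rationals, hence
  simultaneously. \<open>kernel_of_cdf\<close> supplies the kernel, and rectangles identify the
  coupling.\<close>

theorem disintegration:
  fixes \<mu> \<nu> :: "'a::euclidean_space measure"
  assumes "\<pi> \<in> couplings \<mu> \<nu>"
  obtains k where "k \<in> kernels \<mu> \<nu>" "kernel_prod \<mu> k = \<pi>"
proof -
  note C = couplingsD[OF assms]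
  interpret \<pi>: prob_space \<pi> by (rule C)
  interpret prob_space \<mu> by (rule C)
  note [measurable_cong] = C(7,8)
  have [measurable_cong]: "sets \<pi> = sets (borel \<Otimes>\<^sub>M borel)" unfolding borel_prod by (rule C(1))
  have sp: "space \<mu> = UNIV" "space \<nu> = UNIV" "space \<pi> = UNIV"
    using C(1,7,8)[THEN sets_eq_imp_space_eq] by simp_all
  define L where "L q = distr (density \<pi> (indicator (UNIV \<times> lower q))) \<mu> fst" for q
  have L: "emeasure (L q) A = emeasure \<pi> (A \<times> lower q)" if [measurable]: "A \<in> sets borel" for A q
  proof -
    have "emeasure (L q) A = emeasure (density \<pi> (indicator (UNIV \<times> lower q))) (A \<times> UNIV)"
      unfolding L_def by (subst emeasure_distr) (auto simp: sp intro!: arg_cong2[where f=emeasure])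
    also have "\<dots> = (\<integral>\<^sup>+x. indicator (UNIV \<times> lower q) x * indicator (A \<times> UNIV) x \<partial>\<pi>)"
      by (rule emeasure_density) auto
    also have "\<dots> = (\<integral>\<^sup>+x. indicator (A \<times> lower q) x \<partial>\<pi>)"
      by (intro nn_integral_cong) (auto simp: indicator_def)
    finally show ?thesis by simp
  qed
  have sL: "sets (L q) = sets \<mu>" for q by (simp add: L_def)
  have ac: "absolutely_continuous \<mu> (L q)" for q
  proof -
    have "emeasure (L q) A = 0" if "A \<in> null_sets \<mu>" for A
    proof -
      have A[measurable]: "A \<in> sets borel" and "emeasure \<mu> A = 0" using that C(7) by auto
      have "emeasure \<mu> A = emeasure \<pi> (A \<times> UNIV)"
        unfolding C(3)[symmetric]
        by (subst emeasure_distr) (auto simp: sp intro!: arg_cong2[where f=emeasure])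
      moreover have "emeasure \<pi> (A \<times> lower q) \<le> emeasure \<pi> (A \<times> UNIV)"
        by (rule emeasure_mono) auto
      ultimately show ?thesis using L[OF A] \<open>emeasure \<mu> A = 0\<close> by simp
    qed
    then show ?thesis using sL by (auto simp: absolutely_continuous_def null_sets_def)
  qed
  define f where "f q = RN_deriv \<mu> (L q)" for q
  have f[measurable]: "f q \<in> borel_measurable \<mu>" for q by (simp add: f_def)
  have dens: "density \<mu> (f q) = L q" for q unfolding f_def by (rule density_RN_deriv[OF ac sL])
  have nf: "(\<integral>\<^sup>+x. f q x * indicator A x \<partial>\<mu>) = emeasure \<pi> (A \<times> lower q)" if "A \<in> sets borel" for A q
    using L[OF that] that by (simp add: dens[symmetric] emeasure_density)
  have "(\<integral>\<^sup>+x. f q x \<partial>\<mu>) \<noteq> \<infinity>" for q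
    using nf[of UNIV q] \<pi>.emeasure_finite by simp
  then have fin: "AE x in \<mu>. f q x \<noteq> \<infinity>" for q by (intro nn_integral_PInf_AE) auto
  define m where "m q x = enn2real (f q x)" for q x
  have m[measurable]: "m q \<in> borel_measurable \<mu>" for q unfolding m_def by measurable
  have nm: "(\<integral>\<^sup>+x. ennreal (indicator A x * m q x) \<partial>\<mu>) = ennreal (measure \<pi> (A \<times> lower q))"
    if "A \<in> sets borel" for A q
  proof -
    have "(\<integral>\<^sup>+x. ennreal (indicator A x * m q x) \<partial>\<mu>) = (\<integral>\<^sup>+x. f q x * indicator A x \<partial>\<mu>)"
      using fin[of q]
      by (intro nn_integral_cong_AE, eventually_elim) (auto simp: m_def indicator_def less_top[symmetric])
    then show ?thesis using nf[OF that] by (simp add: \<pi>.emeasure_eq_measure)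
  qed
  have hm: "has_bochner_integral \<mu> (\<lambda>x. indicator A x * m q x) (measure \<pi> (A \<times> lower q))"
    if [measurable]: "A \<in> sets borel" for A q
    by (rule has_bochner_integral_nn_integral[OF _ _ _ nm[OF that]]) (auto simp: m_def)
  have im: "integrable \<mu> (m q)" for q using hm[of UNIV q] by (auto simp: has_bochner_integral_iff)
  have mA: "(\<integral>x. indicator A x * m q x \<partial>\<mu>) = measure \<pi> (A \<times> lower q)" if "A \<in> sets borel" for A q
    using hm[OF that] by (simp add: has_bochner_integral_iff)
  have \<nu>l: "measure \<nu> (lower q) = measure \<pi> (UNIV \<times> lower q)" for q
    unfolding C(4)[symmetric] by (subst measure_distr) (auto simp: sp intro!: arg_cong2[where f=measure])
  have \<mu>A: "measure \<mu> A = measure \<pi> (A \<times> UNIV)" if "A \<in> sets borel" for A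
    unfolding C(3)[symmetric] using that
    by (subst measure_distr) (auto simp: sp intro!: arg_cong2[where f=measure])
  obtain k where k: "k \<in> kernels \<mu> \<nu>" and kq: "AE x in \<mu>. \<forall>q. measure (k x) (lower q) = m q x"
  proof (rule kernel_of_cdf[OF C(6,8) m])
    have "AE x in \<mu>. m p x \<le> m q x" if "p \<le> q" for p q
      using lower_mono[OF that]
      by (intro AE_le_of_set_integral_le[OF im im]) (auto simp: mA C(7) intro!: \<pi>.finite_measure_mono)
    then show "AE x in \<mu>. \<forall>p q. p \<le> q \<longrightarrow> m p x \<le> m q x"
      by (simp add: AE_all_countable)
    have AE_le0: "AE x in \<mu>. m q x \<le> 0" if "q < 0" for q
      by (intro AE_le_of_set_integral_le[OF im]) (auto simp: mA C(7) lower_neg[OF that])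
    have "AE x in \<mu>. m q x = 0" if "q < 0" for q
      using AE_le0[OF that]
    proof eventually_elim
      case (elim x)
      then show ?case using enn2real_nonneg[of "f q x"] by (simp add: m_def)
    qed
    then have "AE x in \<mu>. q < 0 \<longrightarrow> m q x = 0" for q by (cases "q < 0") auto
    then show "AE x in \<mu>. \<forall>q<0. m q x = 0" by (simp add: AE_all_countable)
    have AE_le1: "AE x in \<mu>. m q x \<le> 1" and AE_ge1: "AE x in \<mu>. 1 \<le> m q x" if "1 \<le> q" for q
      by (intro AE_le_of_set_integral_le im; simp add: mA C(7) lower_ge_one[OF that] \<mu>A[symmetric])+
    have "AE x in \<mu>. m q x = 1" if "1 \<le> q" for q
      using AE_le1[OF that] AE_ge1[OF that] by eventually_elim (rule antisym)
    then have "AE x in \<mu>. 1 \<le> q \<longrightarrow> m q x = 1" for q by (cases "1 \<le> q") auto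
    then show "AE x in \<mu>. \<forall>q\<ge>1. m q x = 1" by (simp add: AE_all_countable)
    show "(\<integral>x. m q x \<partial>\<mu>) = measure \<nu> (lower q)" for q
      using mA[of UNIV q] by (simp add: \<nu>l)
  qed
  note K = couplingsD[OF kernel_prod_couplings[OF C(5,7) k]]
  have "kernel_prod \<mu> k = \<pi>"
  proof (rule measure_eq_of_rectangles[OF K(2,1) C(2,1)])
    fix A :: "'a set" and q assume A[measurable]: "A \<in> sets borel"
    have AL: "A \<times> lower q \<in> sets (borel :: ('a \<times> 'a) measure)"
      unfolding borel_prod[symmetric] by measurable
    have "measure (kernel_prod \<mu> k) (A \<times> lower q)
        = (\<integral>x. measure (distr (k x) borel (Pair x)) (A \<times> lower q) \<partial>\<mu>)"
      by (rule kernels_measure(2)[OF kernel_prod_kernels[OF C(7) k] AL, symmetric])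
    also have "\<dots> = (\<integral>x. indicator A x * m q x \<partial>\<mu>)"
    proof (rule integral_cong_AE)
      show "AE x in \<mu>. measure (distr (k x) borel (Pair x)) (A \<times> lower q) = indicator A x * m q x"
        using kq
      proof eventually_elim
        case (elim x)
        have s: "sets (k x) = sets borel" "space (k x) = UNIV"
          using kernels_sets[OF k, of x] kernels_space[OF k, of x] by (simp_all add: sp)
        have "Pair x \<in> k x \<rightarrow>\<^sub>M (borel :: ('a \<times> 'a) measure)"
          unfolding borel_prod[symmetric] using s(1) by (simp cong: measurable_cong_sets)
        then have "measure (distr (k x) borel (Pair x)) (A \<times> lower q) = measure (k x) (Pair x -` (A \<times> lower q))"
          using AL by (simp add: measure_distr s)
        then show ?case using elim by (cases "x \<in> A") (auto simp: vimage_def)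
      qed
    qed (use kernels_measure(1)[OF kernel_prod_kernels[OF C(7) k] AL] in \<open>auto intro: borel_measurable_integrable\<close>)
    finally show "measure (kernel_prod \<mu> k) (A \<times> lower q) = measure \<pi> (A \<times> lower q)"
      by (simp add: mA)
  qed
  with k show ?thesis by (rule that)
qed

section \<open>Compactness of kernels with a prescribed mixture\<close>

context prob_space
begin

text \<open>Pointwise limits of distribution functions keep monotonicity and boundary values.
  Dominated convergence keeps the mean, which is the same for every term because the mixture is;
  this excludes a loss of mass and makes \<open>kernel_of_cdf\<close> applicable.\<close>

lemma kernels_limit:
  fixes N :: "'b::euclidean_space measure"
  assumes kn: "\<And>n::nat. kn n \<in> kernels M N"
    and conv: "AE x in M. \<forall>q. convergent (\<lambda>n. measure (kn n x) (lower q))"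
  obtains k where "k \<in> kernels M N"
    "AE x in M. \<forall>q. (\<lambda>n. measure (kn n x) (lower q)) \<longlonglongrightarrow> measure (k x) (lower q)"
proof -
  note [measurable] = kernels_measure_measurable[OF kn]
  define m where "m q x = lim (\<lambda>n. measure (kn n x) (lower q))" for q x
  have m[measurable]: "m q \<in> borel_measurable M" for q unfolding m_def by measurable
  have lim: "AE x in M. (\<forall>q. (\<lambda>n. measure (kn n x) (lower q)) \<longlonglongrightarrow> m q x) \<and> x \<in> space M"
    using conv AE_space by eventually_elim (simp add: m_def convergent_LIMSEQ_iff)
  have le: "measure (kn n x) A \<le> measure (kn n x) B"
    if "x \<in> space M" "A \<subseteq> B" "B \<in> sets borel" for x n A B
    using that kernels_sets[OF kn] by (intro finite_measure.finite_measure_mono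
        prob_space.finite_measure kernels_prob[OF kn]) auto
  obtain k where k: "k \<in> kernels M N" and kq: "AE x in M. \<forall>q. measure (k x) (lower q) = m q x"
  proof (rule kernel_of_cdf[OF kernels_prob_mixture[OF kn] kernels_sets_mixture[OF kn] m])
    show "AE x in M. \<forall>p q. p \<le> q \<longrightarrow> m p x \<le> m q x"
      using lim
    proof eventually_elim
      case (elim x)
      show ?case
      proof (intro allI impI)
        fix p q :: rat assume "p \<le> q"
        show "m p x \<le> m q x"
          by (rule LIMSEQ_le[of "\<lambda>n. measure (kn n x) (lower p)" _ "\<lambda>n. measure (kn n x) (lower q)"])
             (use elim le[OF _ lower_mono[OF \<open>p \<le> q\<close>]] in auto)
      qed
    qed
    show "AE x in M. \<forall>q<0. m q x = 0"
      using lim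
    proof eventually_elim
      case (elim x)
      show ?case
      proof (intro allI impI)
        fix q :: rat assume "q < 0"
        have "(\<lambda>n. measure (kn n x) (lower q)) \<longlonglongrightarrow> m q x" using elim by blast
        then have "(\<lambda>n. 0) \<longlonglongrightarrow> m q x" by (simp add: lower_neg[OF \<open>q < 0\<close>])
        from LIMSEQ_unique[OF this tendsto_const] show "m q x = 0" .
      qed
    qed
    show "AE x in M. \<forall>q\<ge>1. m q x = 1"
      using lim
    proof eventually_elim
      case (elim x)
      show ?case
      proof (intro allI impI)
        fix q :: rat assume "1 \<le> q"
        have "measure (kn n x) (lower q) = 1" for n
          using prob_space.prob_space[OF kernels_prob[OF kn, of x n]] kernels_space[OF kn, of x n]
            elim lower_ge_one[OF \<open>1 \<le> q\<close>, where ?'a='b] by simp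
        moreover have "(\<lambda>n. measure (kn n x) (lower q)) \<longlonglongrightarrow> m q x" using elim by blast
        ultimately have "(\<lambda>n. 1) \<longlonglongrightarrow> m q x" by simp
        from LIMSEQ_unique[OF this tendsto_const] show "m q x = 1" .
      qed
    qed
    show "(\<integral>x. m q x \<partial>M) = measure N (lower q)" for q
    proof -
      have "(\<lambda>n. \<integral>x. measure (kn n x) (lower q) \<partial>M) \<longlonglongrightarrow> (\<integral>x. m q x \<partial>M)"
      proof (rule integral_dominated_convergence[where w="\<lambda>_. 1"])
        show "AE x in M. (\<lambda>n. measure (kn n x) (lower q)) \<longlonglongrightarrow> m q x"
          using lim by eventually_elim simp
        show "AE x in M. norm (measure (kn n x) (lower q)) \<le> 1" for n
          using prob_space.prob_le_1[OF kernels_prob[OF kn]] by auto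
      qed auto
      then show ?thesis
        unfolding kernels_measure(2)[OF kn lower_sets] using LIMSEQ_unique tendsto_const by blast
    qed
  qed
  have "AE x in M. \<forall>q. (\<lambda>n. measure (kn n x) (lower q)) \<longlonglongrightarrow> measure (k x) (lower q)"
    using kq lim by eventually_elim simp
  with k show ?thesis by (rule that)
qed

lemma kernels_diff_integrable:
  fixes f :: "'b::euclidean_space \<Rightarrow> 'c::{banach, second_countable_topology}"
  assumes "k \<in> kernels M N" "l \<in> kernels M N" "integrable N f"
  shows "integrable M (\<lambda>x. norm ((\<integral>y. f y \<partial>k x) - (\<integral>y. f y \<partial>l x)))"
  using kernels_integral(1)[OF assms(1,3)] kernels_integral(1)[OF assms(2,3)] by simp

text \<open>Each kernel contributes the mean of its conditional integral of
  \<open>norm (f y - g y)\<close>, and this mean is the integral under \<open>N\<close>. The error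
  does not depend on the kernels, which permits density arguments along a sequence.\<close>

lemma kernels_diff_approx:
  fixes f g :: "'b::euclidean_space \<Rightarrow> 'c::{banach, second_countable_topology}"
  assumes k: "k \<in> kernels M N" and l: "l \<in> kernels M N" and f: "integrable N f" and g: "integrable N g"
  shows "(\<integral>x. norm ((\<integral>y. f y \<partial>k x) - (\<integral>y. f y \<partial>l x)) \<partial>M)
    \<le> (\<integral>x. norm ((\<integral>y. g y \<partial>k x) - (\<integral>y. g y \<partial>l x)) \<partial>M) + 2 * (\<integral>y. norm (f y - g y) \<partial>N)"
proof -
  have fg: "integrable N (\<lambda>y. norm (f y - g y))" using f g by simp
  note I = kernels_integral[OF k fg] kernels_integral[OF l fg]
  have le: "AE x in M. norm ((\<integral>y. f y \<partial>p x) - (\<integral>y. g y \<partial>p x)) \<le> (\<integral>y. norm (f y - g y) \<partial>p x)"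
    if "p \<in> kernels M N" for p
    using kernels_AE_integrable(1)[OF that f] kernels_AE_integrable(1)[OF that g]
  proof eventually_elim
    case (elim x)
    then have "norm (\<integral>y. f y - g y \<partial>p x) \<le> (\<integral>y. norm (f y - g y) \<partial>p x)"
      by (intro integral_norm_bound)
    then show ?case unfolding Bochner_Integration.integral_diff[OF elim] .
  qed
  have "(\<integral>x. norm ((\<integral>y. f y \<partial>k x) - (\<integral>y. f y \<partial>l x)) \<partial>M)
    \<le> (\<integral>x. norm ((\<integral>y. g y \<partial>k x) - (\<integral>y. g y \<partial>l x))
         + ((\<integral>y. norm (f y - g y) \<partial>k x) + (\<integral>y. norm (f y - g y) \<partial>l x)) \<partial>M)"
  proof (rule integral_mono_AE)
    show "AE x in M. norm ((\<integral>y. f y \<partial>k x) - (\<integral>y. f y \<partial>l x)) \<le> norm ((\<integral>y. g y \<partial>k x) - (\<integral>y. g y \<partial>l x))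
         + ((\<integral>y. norm (f y - g y) \<partial>k x) + (\<integral>y. norm (f y - g y) \<partial>l x))"
      using le[OF k] le[OF l]
    proof eventually_elim
      case (elim x)
      then show ?case by norm
    qed
  qed (auto intro!: kernels_diff_integrable[OF k l] f g I Bochner_Integration.integrable_add)
  also have "\<dots> = (\<integral>x. norm ((\<integral>y. g y \<partial>k x) - (\<integral>y. g y \<partial>l x)) \<partial>M) + 2 * (\<integral>y. norm (f y - g y) \<partial>N)"
    using I kernels_diff_integrable[OF k l g] by simp
  finally show ?thesis .
qed

lemma kernels_diff_add:
  fixes f g :: "'b::euclidean_space \<Rightarrow> 'c::{banach, second_countable_topology}"
  assumes k: "k \<in> kernels M N" and l: "l \<in> kernels M N" and f: "integrable N f" and g: "integrable N g"
  shows "(\<integral>x. norm ((\<integral>y. f y + g y \<partial>k x) - (\<integral>y. f y + g y \<partial>l x)) \<partial>M)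
    \<le> (\<integral>x. norm ((\<integral>y. f y \<partial>k x) - (\<integral>y. f y \<partial>l x)) \<partial>M)
     + (\<integral>x. norm ((\<integral>y. g y \<partial>k x) - (\<integral>y. g y \<partial>l x)) \<partial>M)"
proof -
  note I = kernels_diff_integrable[OF k l]
  have "(\<integral>x. norm ((\<integral>y. f y + g y \<partial>k x) - (\<integral>y. f y + g y \<partial>l x)) \<partial>M)
    \<le> (\<integral>x. norm ((\<integral>y. f y \<partial>k x) - (\<integral>y. f y \<partial>l x)) + norm ((\<integral>y. g y \<partial>k x) - (\<integral>y. g y \<partial>l x)) \<partial>M)"
  proof (rule integral_mono_AE)
    show "AE x in M. norm ((\<integral>y. f y + g y \<partial>k x) - (\<integral>y. f y + g y \<partial>l x))
       \<le> norm ((\<integral>y. f y \<partial>k x) - (\<integral>y. f y \<partial>l x)) + norm ((\<integral>y. g y \<partial>k x) - (\<integral>y. g y \<partial>l x))"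
      using kernels_AE_integrable(1)[OF k f] kernels_AE_integrable(1)[OF l f]
        kernels_AE_integrable(1)[OF k g] kernels_AE_integrable(1)[OF l g]
    proof eventually_elim
      case (elim x)
      then show ?case by simp norm
    qed
  qed (auto intro!: I f g Bochner_Integration.integrable_add)
  then show ?thesis using I[OF f] I[OF g] by simp
qed

text \<open>Dominated convergence treats the indicators of \<open>lower q\<close>. The functions
  whose \<open>gap\<close> tends to 0 are closed under sums and under L^1(\<open>N\<close>) limits,
  so complements and disjoint unions lead to all Borel sets and simple functions to all integrable
  \<open>f\<close>.\<close>

lemma kernels_L1_limit:
  fixes N :: "'b::euclidean_space measure" and f :: "'b \<Rightarrow> 'c::{banach, second_countable_topology}"
  assumes kn: "\<And>n::nat. kn n \<in> kernels M N" and k: "k \<in> kernels M N"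
    and conv: "AE x in M. \<forall>q. (\<lambda>n. measure (kn n x) (lower q)) \<longlonglongrightarrow> measure (k x) (lower q)"
    and f: "integrable N f"
  shows "(\<lambda>n. \<integral>x. norm ((\<integral>y. f y \<partial>kn n x) - (\<integral>y. f y \<partial>k x)) \<partial>M) \<longlonglongrightarrow> 0"
proof -
  interpret N: prob_space N by (rule kernels_prob_mixture[OF k])
  have sN: "sets N = sets borel" by (rule kernels_sets_mixture[OF k])
  have spN: "space N = UNIV" using sets_eq_imp_space_eq[OF sN] by simp
  define gap where "gap g n = (\<integral>x. norm ((\<integral>y. g y \<partial>kn n x) - (\<integral>y. g y \<partial>k x)) \<partial>M)"
    for g :: "'b \<Rightarrow> 'c" and n
  have gap0: "0 \<le> gap g n" for g n unfolding gap_def by simp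
  have approx: "gap g \<longlonglongrightarrow> 0"
    if g: "integrable N g" and s: "\<And>i::nat. integrable N (s i)" "\<And>i. gap (s i) \<longlonglongrightarrow> 0"
      and sg: "(\<lambda>i. \<integral>y. norm (g y - s i y) \<partial>N) \<longlonglongrightarrow> 0" for g s
  proof (rule LIMSEQ_I)
    fix r :: real assume "0 < r"
    then obtain i where i: "norm ((\<integral>y. norm (g y - s i y) \<partial>N) - 0) < r / 4"
      using LIMSEQ_D[OF sg, of "r / 4"] by auto
    obtain n0 where n0: "\<And>n. n \<ge> n0 \<Longrightarrow> norm (gap (s i) n - 0) < r / 4"
      using LIMSEQ_D[OF s(2)[of i], of "r / 4"] \<open>0 < r\<close> by auto
    have "norm (gap g n - 0) < r" if "n \<ge> n0" for n
      using kernels_diff_approx[OF kn[of n] k g s(1)[of i]] i n0[OF that] gap0[of g n] gap0[of "s i" n] \<open>0 < r\<close>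
      unfolding gap_def[symmetric] by simp
    then show "\<exists>n0. \<forall>n\<ge>n0. norm (gap g n - 0) < r" by blast
  qed
  have gap_add: "gap (\<lambda>y. g y + h y) \<longlonglongrightarrow> 0"
    if "integrable N g" "integrable N h" "gap g \<longlonglongrightarrow> 0" "gap h \<longlonglongrightarrow> 0" for g h
  proof (rule tendsto_sandwich[of "\<lambda>_. 0" _ _ "\<lambda>n. gap g n + gap h n"])
    show "\<forall>\<^sub>F n in sequentially. gap (\<lambda>y. g y + h y) n \<le> gap g n + gap h n"
      using kernels_diff_add[OF kn k that(1,2)] unfolding gap_def by simp
    show "(\<lambda>n. gap g n + gap h n) \<longlonglongrightarrow> 0" using tendsto_add[OF that(3,4)] by simp
  qed (simp_all add: gap0)
  have indi: "integrable N (\<lambda>y. indicator B y *\<^sub>R c)" if "B \<in> sets borel" for B and c :: 'c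
    using that sN N.emeasure_finite by (intro integrable_scaleR_left integrable_real_indicator) (auto simp: less_top[symmetric])
  have ind: "(\<integral>y. indicator B y *\<^sub>R c \<partial>l x) = measure (l x) B *\<^sub>R c"
    if "l \<in> kernels M N" "x \<in> space M" "B \<in> sets borel" for l x B and c :: 'c
  proof -
    interpret lx: prob_space "l x" by (rule kernels_prob[OF that(1,2)])
    show ?thesis using kernels_sets[OF that(1,2)] that(3)
      by (intro has_bochner_integral_integral_eq has_bochner_integral_indicator)
         (simp_all add: lx.emeasure_eq_measure)
  qed
  have sets: "\<forall>c. gap (\<lambda>y. indicator B y *\<^sub>R c) \<longlonglongrightarrow> 0" if "B \<in> sets borel" for B
    using that
  proof (induction rule: sets_borel_induct_lower)
    case (lower q)
    show ?case
    proof
      fix c :: 'c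
      have "gap (\<lambda>y. indicator (lower q) y *\<^sub>R c) \<longlonglongrightarrow> (\<integral>x. 0 \<partial>M)"
        unfolding gap_def
      proof (rule integral_dominated_convergence[where w="\<lambda>_. norm c"])
        show "(\<lambda>x. norm ((\<integral>y. indicator (lower q) y *\<^sub>R c \<partial>kn n x) - (\<integral>y. indicator (lower q) y *\<^sub>R c \<partial>k x))) \<in> borel_measurable M" for n
          using kernels_diff_integrable[OF kn k indi[OF lower_sets]] by (rule borel_measurable_integrable)
        show "AE x in M. (\<lambda>n. norm ((\<integral>y. indicator (lower q) y *\<^sub>R c \<partial>kn n x) - (\<integral>y. indicator (lower q) y *\<^sub>R c \<partial>k x))) \<longlonglongrightarrow> 0"
          using conv AE_space
        proof eventually_elim
          case (elim x)
          have "(\<lambda>n. norm (measure (kn n x) (lower q) *\<^sub>R c - measure (k x) (lower q) *\<^sub>R c)) \<longlonglongrightarrow>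
               norm (measure (k x) (lower q) *\<^sub>R c - measure (k x) (lower q) *\<^sub>R c)"
            using elim by (intro tendsto_intros) auto
          then show ?case using elim by (simp add: ind[OF kn] ind[OF k])
        qed
        show "AE x in M. norm (norm ((\<integral>y. indicator (lower q) y *\<^sub>R c \<partial>kn n x) - (\<integral>y. indicator (lower q) y *\<^sub>R c \<partial>k x))) \<le> norm c" for n
          using AE_space
        proof eventually_elim
          case (elim x)
          have "\<bar>measure (kn n x) (lower q) - measure (k x) (lower q)\<bar> \<le> 1"
            using prob_space.prob_le_1[OF kernels_prob[OF kn elim], of n "lower q"]
              prob_space.prob_le_1[OF kernels_prob[OF k elim], of "lower q"]
              measure_nonneg[of "kn n x" "lower q"] measure_nonneg[of "k x" "lower q"] by linarith
          then have "\<bar>measure (kn n x) (lower q) - measure (k x) (lower q)\<bar> * norm c \<le> 1 * norm c"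
            by (intro mult_right_mono) auto
          then show ?case using elim by (simp add: ind[OF kn] ind[OF k] scaleR_diff_left[symmetric])
        qed
      qed auto
      then show "gap (\<lambda>y. indicator (lower q) y *\<^sub>R c) \<longlonglongrightarrow> 0" by simp
    qed
  next
    case empty
    show ?case by (simp add: gap_def)
  next
    case (compl A)
    show ?case
    proof
      fix c :: 'c
      have const: "gap (\<lambda>y. c) n = 0" for n
      proof -
        have "(\<integral>y. c \<partial>l x) = c" if "l \<in> kernels M N" "x \<in> space M" for l x
          using prob_space.prob_space[OF kernels_prob[OF that]] by simp
        then show ?thesis using kn k unfolding gap_def by (simp cong: Bochner_Integration.integral_cong)
      qed
      have "gap (\<lambda>y. c + indicator A y *\<^sub>R (- c)) \<longlonglongrightarrow> 0"
      proof (rule gap_add)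
        show "gap (\<lambda>y. c) \<longlonglongrightarrow> 0" by (subst tendsto_cong[of _ "\<lambda>_. 0"]) (simp_all add: const)
      qed (rule compl(2)[rule_format] indi[OF compl(1)] N.integrable_const)+
      moreover have "(\<lambda>y. c + indicator A y *\<^sub>R (- c)) = (\<lambda>y. indicator (- A) y *\<^sub>R c)"
        by (auto simp: indicator_def)
      ultimately show "gap (\<lambda>y. indicator (- A) y *\<^sub>R c) \<longlonglongrightarrow> 0" by simp
    qed
  next
    case (union A)
    show ?case
    proof
      fix c :: 'c
      have A: "A i \<in> sets borel" for i using union(2) by auto
      have I: "indicator (\<Union>i<m. A i) y *\<^sub>R c = (\<Sum>i<m. indicator (A i) y *\<^sub>R c)" for m y
        using union(1) by (subst indicator_UN_disjoint)
          (auto simp: scaleR_sum_left disjoint_family_on_def)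
      have G: "gap (\<lambda>y. indicator (\<Union>i<m. A i) y *\<^sub>R c) \<longlonglongrightarrow> 0" for m
        unfolding I
      proof (induction m)
        case 0
        show ?case by (simp add: gap_def)
      next
        case (Suc m)
        show ?case unfolding sum.lessThan_Suc
          using union(3) Suc A by (intro gap_add Bochner_Integration.integrable_sum indi) auto
      qed
      show "gap (\<lambda>y. indicator (\<Union>i. A i) y *\<^sub>R c) \<longlonglongrightarrow> 0"
      proof (rule approx[OF _ _ G])
        have "(\<lambda>m. \<integral>y. norm (indicator (\<Union>i. A i) y *\<^sub>R c - indicator (\<Union>i<m. A i) y *\<^sub>R c) \<partial>N) \<longlonglongrightarrow> (\<integral>y. 0 \<partial>N)"
        proof (rule integral_dominated_convergence[where w="\<lambda>_. norm c"])
          show "AE y in N. (\<lambda>m. norm (indicator (\<Union>i. A i) y *\<^sub>R c - indicator (\<Union>i<m. A i) y *\<^sub>R c)) \<longlonglongrightarrow> 0"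
          proof (rule AE_I2)
            fix y
            have "(\<lambda>m. indicator (\<Union>i<m. A i) y :: real) \<longlonglongrightarrow> indicator (\<Union>i. A i) y"
              by (rule LIMSEQ_indicator_UN)
            then have "(\<lambda>m. norm (indicator (\<Union>i. A i) y *\<^sub>R c - indicator (\<Union>i<m. A i) y *\<^sub>R c)) \<longlonglongrightarrow>
              norm (indicator (\<Union>i. A i) y *\<^sub>R c - indicator (\<Union>i. A i) y *\<^sub>R c)"
              by (intro tendsto_intros)
            then show "(\<lambda>m. norm (indicator (\<Union>i. A i) y *\<^sub>R c - indicator (\<Union>i<m. A i) y *\<^sub>R c)) \<longlonglongrightarrow> 0" by simp
          qed
          show "(\<lambda>y. norm (indicator (\<Union>i. A i) y *\<^sub>R c - indicator (\<Union>i<m. A i) y *\<^sub>R c)) \<in> borel_measurable N" for m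
            by (rule borel_measurable_integrable, intro integrable_norm Bochner_Integration.integrable_diff indi)
              (use A in auto)
          show "AE y in N. norm (norm (indicator (\<Union>i. A i) y *\<^sub>R c - indicator (\<Union>i<m. A i) y *\<^sub>R c)) \<le> norm c" for m
            by (auto simp: indicator_def)
        qed auto
        then show "(\<lambda>m. \<integral>y. norm (indicator (\<Union>i. A i) y *\<^sub>R c - indicator (\<Union>i<m. A i) y *\<^sub>R c) \<partial>N) \<longlonglongrightarrow> 0" by simp
      qed (use A in \<open>auto intro!: indi\<close>)
    qed
  qed
  from f have "gap f \<longlonglongrightarrow> 0"
  proof (induction rule: integrable_induct)
    case (base A c)
    then show ?case using sets sN by simp
  next
    case (add f g)
    then show ?case by (intro gap_add) auto
  next
    case (lim f s)
    have "(\<lambda>i. \<integral>y. norm (f y - s i y) \<partial>N) \<longlonglongrightarrow> (\<integral>y. 0 \<partial>N)"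
    proof (rule integral_dominated_convergence[where w="\<lambda>y. 3 * norm (f y)"])
      show "AE y in N. (\<lambda>i. norm (f y - s i y)) \<longlonglongrightarrow> 0"
      proof (rule AE_I2)
        fix y assume "y \<in> space N"
        then have "(\<lambda>i. norm (f y - s i y)) \<longlonglongrightarrow> norm (f y - f y)"
          by (intro tendsto_intros lim.hyps(2))
        then show "(\<lambda>i. norm (f y - s i y)) \<longlonglongrightarrow> 0" by simp
      qed
      show "AE y in N. norm (norm (f y - s i y)) \<le> 3 * norm (f y)" for i
      proof (rule AE_I2)
        fix y assume "y \<in> space N"
        then show "norm (norm (f y - s i y)) \<le> 3 * norm (f y)"
          using norm_triangle_ineq4[of "f y" "s i y"] lim.hyps(3)[of y i] by simp
      qed
    qed (use lim.hyps in \<open>auto intro: borel_measurable_integrable\<close>)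
    then show ?case by (intro approx[OF lim.hyps(4) lim.hyps(1) lim.IH]) simp
  qed
  then show ?thesis unfolding gap_def .
qed

end

text \<open>The average of \<open>k x\<close> and \<open>l x\<close>, written as the mixture of a
  fair coin, so that its masses and integrals come from the lemmas on \<open>kernels\<close> over
  \<open>measure_pmf\<close>.\<close>

definition mid_kernel :: "('x \<Rightarrow> 'b measure) \<Rightarrow> ('x \<Rightarrow> 'b measure) \<Rightarrow> 'x \<Rightarrow> 'b measure" where
  "mid_kernel k l x = measure_pmf (bernoulli_pmf (1/2)) \<bind> (\<lambda>b. if b then k x else l x)"

context prob_space
begin

lemma mid_kernel_mixture:
  assumes k: "k \<in> kernels M N" and l: "l \<in> kernels M N" and x: "x \<in> space M"
  shows "(\<lambda>b. if b then k x else l x) \<in> kernels (measure_pmf (bernoulli_pmf (1/2))) (mid_kernel k l x)"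
proof -
  have "(\<lambda>b. if b then k x else l x) \<in> count_space UNIV \<rightarrow>\<^sub>M prob_algebra borel"
    using kernels_in_space[OF k x] kernels_in_space[OF l x] by (auto simp: measurable_def)
  then show ?thesis by (simp add: kernels_def mid_kernel_def cong: measurable_cong_sets)
qed

lemma mid_kernel_measure:
  assumes k: "k \<in> kernels M N" and l: "l \<in> kernels M N" and x: "x \<in> space M" and B: "B \<in> sets borel"
  shows "measure (mid_kernel k l x) B = (measure (k x) B + measure (l x) B) / 2"
  using measure_pmf.kernels_measure(2)[OF mid_kernel_mixture[OF k l x] B] by (simp add: field_simps)

lemma mid_kernel_emeasure:
  assumes k: "k \<in> kernels M N" and l: "l \<in> kernels M N" and x: "x \<in> space M" and B: "B \<in> sets borel"
  shows "emeasure (mid_kernel k l x) B = ennreal ((measure (k x) B + measure (l x) B) / 2)"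
  using mid_kernel_measure[OF assms] measure_pmf.kernels_prob_mixture[OF mid_kernel_mixture[OF k l x]]
  by (simp add: finite_measure.emeasure_eq_measure prob_space.finite_measure)

lemma mid_kernel_kernels:
  fixes N :: "'b::euclidean_space measure"
  assumes k: "k \<in> kernels M N" and l: "l \<in> kernels M N"
  shows "mid_kernel k l \<in> kernels M N"
proof -
  have m: "mid_kernel k l \<in> M \<rightarrow>\<^sub>M prob_algebra borel"
  proof (rule measurable_prob_algebra_generated[where \<Omega>=UNIV and G="sets (borel :: 'b measure)"])
    show "sets borel = sigma_sets UNIV (sets (borel :: 'b measure))"
      using sets.sigma_sets_eq[of "borel :: 'b measure"] by simp
    show "Int_stable (sets (borel :: 'b measure))" by (auto simp: Int_stable_def)
    fix x assume x: "x \<in> space M"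
    show "prob_space (mid_kernel k l x)" "sets (mid_kernel k l x) = sets borel"
      using measure_pmf.kernels_prob_mixture[OF mid_kernel_mixture[OF k l x]]
        measure_pmf.kernels_sets_mixture[OF mid_kernel_mixture[OF k l x]] by auto
  next
    fix B :: "'b set" assume B: "B \<in> sets borel"
    note [measurable] = kernels_measure_measurable[OF k B] kernels_measure_measurable[OF l B]
    have "(\<lambda>x. ennreal ((measure (k x) B + measure (l x) B) / 2)) \<in> borel_measurable M" by measurable
    then show "(\<lambda>x. emeasure (mid_kernel k l x) B) \<in> borel_measurable M"
      using mid_kernel_emeasure[OF k l _ B] by (simp cong: measurable_cong)
  qed simp
  have "M \<bind> mid_kernel k l = N"
  proof (rule measure_eqI)
    have mk: "mid_kernel k l \<in> kernels M (M \<bind> mid_kernel k l)" using m by (simp add: kernels_def)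
    show s: "sets (M \<bind> mid_kernel k l) = sets N"
      using kernels_sets_mixture[OF mk] kernels_sets_mixture[OF k] by simp
    fix B assume "B \<in> sets (M \<bind> mid_kernel k l)"
    then have B: "B \<in> sets borel" using s kernels_sets_mixture[OF k] by simp
    interpret N: prob_space N by (rule kernels_prob_mixture[OF k])
    interpret N': prob_space "M \<bind> mid_kernel k l" by (rule kernels_prob_mixture[OF mk])
    have "measure (M \<bind> mid_kernel k l) B = (\<integral>x. (measure (k x) B + measure (l x) B) / 2 \<partial>M)"
      unfolding kernels_measure(2)[OF mk B, symmetric]
      by (intro Bochner_Integration.integral_cong refl mid_kernel_measure[OF k l _ B])
    also have "\<dots> = measure N B"
      using kernels_measure[OF k B] kernels_measure[OF l B] by simp
    finally show "emeasure (M \<bind> mid_kernel k l) B = emeasure N B"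
      by (simp add: N.emeasure_eq_measure N'.emeasure_eq_measure)
  qed
  with m show ?thesis by (simp add: kernels_def)
qed

lemma mid_kernel_integral:
  fixes f :: "'b::euclidean_space \<Rightarrow> 'c::euclidean_space"
  assumes k: "k \<in> kernels M N" and l: "l \<in> kernels M N" and f: "integrable N f"
  shows "AE x in M. (\<integral>y. f y \<partial>mid_kernel k l x) = (1/2) *\<^sub>R ((\<integral>y. f y \<partial>k x) + (\<integral>y. f y \<partial>l x))"
  using kernels_AE_integrable(1)[OF mid_kernel_kernels[OF k l] f] AE_space
proof eventually_elim
  case (elim x)
  have "(\<integral>b. (\<integral>y. f y \<partial>(if b then k x else l x)) \<partial>measure_pmf (bernoulli_pmf (1/2))) = (\<integral>y. f y \<partial>mid_kernel k l x)"
    by (rule measure_pmf.kernels_integral(2)[OF mid_kernel_mixture[OF k l elim(2)] elim(1)])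
  then show ?case
    by (subst (asm) integral_measure_pmf[of UNIV]) (auto simp: UNIV_bool scaleR_add_right add.commute)
qed

text \<open>The approximate minimisers over \<open>D n\<close> of the \<open>L\<^sup>2\<close> norm of the distribution functions form
  a Cauchy sequence, by the parallelogram identity.\<close>

lemma kernels_selection:
  fixes N :: "'b::euclidean_space measure"
  assumes D: "\<And>n::nat. D n \<subseteq> kernels M N" and ne: "\<And>n. D n \<noteq> {}"
    and dec: "\<And>m n. m \<le> n \<Longrightarrow> D n \<subseteq> D m"
    and mid: "\<And>n k l. k \<in> D n \<Longrightarrow> l \<in> D n \<Longrightarrow> mid_kernel k l \<in> D n"
  obtains kn k where "\<And>n. kn n \<in> D n" "k \<in> kernels M N"
    "AE x in M. \<forall>q. (\<lambda>n. measure (kn n x) (lower q)) \<longlonglongrightarrow> measure (k x) (lower q)"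
proof -
  \<comment> \<open>Any law charging every natural number would do: almost everywhere under
    \<open>G\<close> then means for all indices, hence for all rationals
    \<open>from_nat j\<close>.\<close>
  define G where "G = measure_pmf (geometric_pmf (1/2))"
  have sG[measurable_cong]: "sets G = sets (count_space UNIV)" by (simp add: G_def)
  interpret G: prob_space G unfolding G_def by (rule prob_space_measure_pmf)
  interpret P: pair_prob_space M G ..
  define H where "H k = (\<lambda>(x, j). measure (k x) (lower (from_nat j) :: 'b set))" for k :: "'a \<Rightarrow> 'b measure"
  have H[measurable]: "H k \<in> borel_measurable (M \<Otimes>\<^sub>M G)" if "k \<in> kernels M N" for k
  proof -
    note [measurable] = kernels_measure_measurable[OF that]
    have "H k \<in> borel_measurable (M \<Otimes>\<^sub>M count_space UNIV)"
      unfolding H_def by measurable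
    then show ?thesis by (simp cong: measurable_cong_sets sets_pair_measure_cong add: sG)
  qed
  have H01: "0 \<le> H k z" "H k z \<le> 1" if "k \<in> kernels M N" "z \<in> space (M \<Otimes>\<^sub>M G)" for k z
    using that prob_space.prob_le_1[OF kernels_prob[OF that(1)]]
    by (auto simp: H_def space_pair_measure split: prod.splits)
  have I: "integrable (M \<Otimes>\<^sub>M G) (\<lambda>z. H k z * H l z)" if "k \<in> kernels M N" "l \<in> kernels M N" for k l
    using that
    by (intro P.integrable_const_bound[of _ 1] AE_I2) (auto simp: abs_mult H01 mult_le_one)
  have I1: "integrable (M \<Otimes>\<^sub>M G) (H k)" if "k \<in> kernels M N" for k
    using that by (intro P.integrable_const_bound[of _ 1] AE_I2) (auto simp: H01)
  define E where "E k = (\<integral>z. H k z * H k z \<partial>(M \<Otimes>\<^sub>M G))" for k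
  have E0: "0 \<le> E k" for k unfolding E_def by simp
  have E1: "E k \<le> 1" if "k \<in> kernels M N" for k
  proof -
    have "E k \<le> (\<integral>z. 1 \<partial>(M \<Otimes>\<^sub>M G))"
      unfolding E_def using that by (intro integral_mono I) (auto simp: H01 mult_le_one)
    then show ?thesis by (simp add: P.prob_space)
  qed
  have parallelogram: "(\<integral>z. (H k z - H l z)\<^sup>2 \<partial>(M \<Otimes>\<^sub>M G)) = 2 * E k + 2 * E l - 4 * E (mid_kernel k l)"
    if k: "k \<in> kernels M N" and l: "l \<in> kernels M N" for k l
  proof -
    have "E (mid_kernel k l) = (\<integral>z. (H k z * H k z + 2 * (H k z * H l z) + H l z * H l z) / 4 \<partial>(M \<Otimes>\<^sub>M G))"
      unfolding E_def
    proof (intro Bochner_Integration.integral_cong refl)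
      fix z assume "z \<in> space (M \<Otimes>\<^sub>M G)"
      then have m: "H (mid_kernel k l) z = (H k z + H l z) / 2"
        by (auto simp: H_def space_pair_measure mid_kernel_measure[OF k l])
      show "H (mid_kernel k l) z * H (mid_kernel k l) z = (H k z * H k z + 2 * (H k z * H l z) + H l z * H l z) / 4"
        unfolding m by (simp add: field_simps)
    qed
    also have "\<dots> = (E k + 2 * (\<integral>z. H k z * H l z \<partial>(M \<Otimes>\<^sub>M G)) + E l) / 4"
      unfolding E_def using I k l by simp
    finally have "4 * E (mid_kernel k l) = E k + 2 * (\<integral>z. H k z * H l z \<partial>(M \<Otimes>\<^sub>M G)) + E l" by simp
    moreover have "(\<integral>z. (H k z - H l z)\<^sup>2 \<partial>(M \<Otimes>\<^sub>M G))
        = (\<integral>z. H k z * H k z - 2 * (H k z * H l z) + H l z * H l z \<partial>(M \<Otimes>\<^sub>M G))"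
      by (intro Bochner_Integration.integral_cong) (auto simp: power2_eq_square algebra_simps)
    moreover have "\<dots> = E k - 2 * (\<integral>z. H k z * H l z \<partial>(M \<Otimes>\<^sub>M G)) + E l"
      unfolding E_def using I k l by simp
    ultimately show ?thesis by simp
  qed
  \<comment> \<open>The infima increase because the sets \<open>D n\<close> shrink, and they are
    bounded by 1, so they converge.\<close>
  define c where "c n = (INF k\<in>D n. E k)" for n
  have bdd: "bdd_below (E ` D n)" for n using E0 by (auto intro!: bdd_belowI[of _ 0])
  have c_le: "c n \<le> E k" if "k \<in> D n" for n k
    unfolding c_def using that by (intro cINF_lower bdd)
  have "\<exists>k\<in>D n. E k < c n + 1 / real (Suc n)" for n
    using cINF_less_iff[OF ne[of n] bdd, of "c n + 1 / real (Suc n)"] unfolding c_def by simp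
  then obtain kn where kn: "\<And>n. kn n \<in> D n" "\<And>n. E (kn n) < c n + 1 / real (Suc n)" by metis
  have knk: "kn n \<in> kernels M N" for n using kn(1) D by blast
  have incc: "c m \<le> c n" if "m \<le> n" for m n
    unfolding c_def using dec[OF that] by (intro cINF_superset_mono ne bdd) auto
  have "c n \<le> 1" for n using c_le[OF kn(1)] E1[OF knk] order_trans by blast
  then obtain c0 where c0: "c \<longlonglongrightarrow> c0" "\<And>n. c n \<le> c0"
    using incseq_convergent[of c 1] incc by (metis incseq_def)
  \<comment> \<open>The midpoint of \<open>kn n\<close> and \<open>kn m\<close> lies in the larger
    set \<open>D n\<close>, so its \<open>E\<close> is at least \<open>c n\<close>. The
    parallelogram identity then bounds the squared distance by \<open>2 * (c m - c n)\<close> plus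
    \<open>2 / Suc n\<close> and \<open>2 / Suc m\<close>.\<close>
  have dist: "(\<integral>z. (H (kn n) z - H (kn m) z)\<^sup>2 \<partial>(M \<Otimes>\<^sub>M G)) \<le> 2 * (c0 - c n) + 4 / real (Suc n)"
    if "n \<le> m" for n m
  proof -
    have "c n \<le> E (mid_kernel (kn n) (kn m))"
      using kn(1)[of m] dec[OF that] by (intro c_le mid kn) auto
    moreover have "c m \<le> c0" by (rule c0)
    moreover have "1 / real (Suc m) \<le> 1 / real (Suc n)" using that by (simp add: field_simps)
    moreover have "2 * a + 2 * b - 4 * d \<le> 2 * (e - f) + 4 * g"
      if "f \<le> d" "h \<le> e" "i \<le> g" "a < f + g" "b < h + i" for a b d e f g h i :: real
      using that by argo
    ultimately have "2 * E (kn n) + 2 * E (kn m) - 4 * E (mid_kernel (kn n) (kn m))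
        \<le> 2 * (c0 - c n) + 4 * (1 / real (Suc n))"
      using kn(2)[of n] kn(2)[of m] by blast
    then show ?thesis unfolding parallelogram[OF knk knk] by simp
  qed
  have cauchy: "\<exists>n0. \<forall>i\<ge>n0. \<forall>j\<ge>n0. (\<integral>z. norm (H (kn i) z - H (kn j) z) \<partial>(M \<Otimes>\<^sub>M G)) < e" if "0 < e" for e
  proof -
    have "(\<lambda>n. 2 * (c0 - c n) + 4 / real (Suc n)) \<longlonglongrightarrow> 2 * (c0 - c0) + 4 * 0"
      unfolding divide_inverse by (intro tendsto_intros c0(1) LIMSEQ_inverse_real_of_nat)
    then have "\<forall>\<^sub>F n in sequentially. 2 * (c0 - c n) + 4 / real (Suc n) < e\<^sup>2"
      using that by (intro order_tendstoD) auto
    then obtain n0 where n0: "\<And>n. n0 \<le> n \<Longrightarrow> 2 * (c0 - c n) + 4 / real (Suc n) < e\<^sup>2"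
      by (auto simp: eventually_sequentially)
    have lt: "(\<integral>z. norm (H (kn i) z - H (kn j) z) \<partial>(M \<Otimes>\<^sub>M G)) < e" if "n0 \<le> i" "i \<le> j" for i j
    proof -
      let ?d = "\<lambda>z. H (kn i) z - H (kn j) z"
      have I2: "integrable (M \<Otimes>\<^sub>M G) (\<lambda>z. (?d z)\<^sup>2)"
        using I[OF knk knk] by (simp add: power2_eq_square algebra_simps)
      \<comment> \<open>The weight \<open>e\<close> in this form of Young's inequality turns an L^2
        bound below \<open>e\<^sup>2\<close> into an L^1 bound below \<open>e\<close>.\<close>
      have "norm (?d z) \<le> e / 2 + (?d z)\<^sup>2 / (2 * e)" for z
      proof -
        have "0 \<le> (e - \<bar>?d z\<bar>)\<^sup>2" by simp
        then have "2 * e * \<bar>?d z\<bar> \<le> e\<^sup>2 + (?d z)\<^sup>2" by (simp add: power2_eq_square algebra_simps)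
        then show ?thesis using \<open>0 < e\<close> by (simp add: field_simps power2_eq_square)
      qed
      then have "(\<integral>z. norm (?d z) \<partial>(M \<Otimes>\<^sub>M G)) \<le> (\<integral>z. e / 2 + (?d z)\<^sup>2 / (2 * e) \<partial>(M \<Otimes>\<^sub>M G))"
        using I1[OF knk] I2 by (intro integral_mono) auto
      also have "\<dots> = e / 2 + (\<integral>z. (?d z)\<^sup>2 \<partial>(M \<Otimes>\<^sub>M G)) / (2 * e)"
        using I2 by (simp add: P.prob_space)
      also have "\<dots> < e / 2 + e\<^sup>2 / (2 * e)"
        using dist[OF that(2)] n0[OF that(1)] \<open>0 < e\<close> by (intro add_strict_left_mono divide_strict_right_mono) auto
      also have "\<dots> = e" using \<open>0 < e\<close> by (simp add: power2_eq_square)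
      finally show ?thesis .
    qed
    have "(\<integral>z. norm (H (kn i) z - H (kn j) z) \<partial>(M \<Otimes>\<^sub>M G)) < e" if "n0 \<le> i" "n0 \<le> j" for i j
      using lt[of i j] lt[of j i] that by (cases "i \<le> j") (auto simp: abs_minus_commute)
    then show ?thesis by blast
  qed
  obtain r where r: "strict_mono r" "AE z in M \<Otimes>\<^sub>M G. Cauchy (\<lambda>i. H (kn (r i)) z)"
    by (rule cauchy_L1_AE_cauchy_subseq[OF I1[OF knk] cauchy])
  have "AE x in M. AE j in G. Cauchy (\<lambda>i. H (kn (r i)) (x, j))"
    using P.AE_pair[OF r(2)] .
  then have "AE x in M. \<forall>q. convergent (\<lambda>n. measure (kn (r n) x) (lower q))"
  proof eventually_elim
    case (elim x)
    show ?case
    proof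
      fix q :: rat
      obtain j :: nat where "q = from_nat j" by (metis surj_def surj_from_nat)
      moreover have "Cauchy (\<lambda>i. H (kn (r i)) (x, j))"
        using elim unfolding G_def AE_measure_pmf_iff by (simp add: set_pmf_geometric)
      ultimately show "convergent (\<lambda>n. measure (kn (r n) x) (lower q))"
        by (simp add: H_def Cauchy_convergent_iff)
    qed
  qed
  then obtain k where k: "k \<in> kernels M N"
    "AE x in M. \<forall>q. (\<lambda>n. measure (kn (r n) x) (lower q)) \<longlonglongrightarrow> measure (k x) (lower q)"
    using kernels_limit[of "\<lambda>n. kn (r n)"] knk by blast
  have "kn (r n) \<in> D n" for n
    using kn(1)[of "r n"] dec[OF strict_mono_imp_increasing[OF r(1)], of n] by blast
  then show ?thesis using k by (rule that)
qed

section \<open>The direct method for functionals of kernels\<close>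

lemma integral_fatou:
  fixes g :: "nat \<Rightarrow> 'a \<Rightarrow> real"
  assumes int: "\<And>n. integrable M (g n)" and nonneg: "\<And>n. AE x in M. 0 \<le> g n x"
    and lim: "AE x in M. (\<lambda>n. g n x) \<longlonglongrightarrow> h x" and c: "(\<lambda>n. \<integral>x. g n x \<partial>M) \<longlonglongrightarrow> c"
    and [measurable]: "h \<in> borel_measurable M"
  shows "integrable M h" "(\<integral>x. h x \<partial>M) \<le> c"
proof -
  have "\<And>n. (\<integral>x. g n x \<partial>M) \<ge> 0" using nonneg by (rule integral_nonneg_AE)
  then have c0: "0 \<le> c" by (intro LIMSEQ_le_const[OF c]) auto
  have "AE x in M. \<forall>n. 0 \<le> g n x" using nonneg by (simp add: AE_all_countable)
  then have h0: "AE x in M. 0 \<le> h x"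
    using lim by eventually_elim (auto intro: LIMSEQ_le_const)
  have "(\<integral>\<^sup>+x. ennreal (h x) \<partial>M) = (\<integral>\<^sup>+x. liminf (\<lambda>n. ennreal (g n x)) \<partial>M)"
    using lim by (intro nn_integral_cong_AE, eventually_elim)
      (auto intro!: lim_imp_Liminf[symmetric] tendsto_ennrealI)
  also have "\<dots> \<le> liminf (\<lambda>n. \<integral>\<^sup>+x. ennreal (g n x) \<partial>M)"
    using int by (intro nn_integral_liminf) (auto dest: borel_measurable_integrable)
  also have "\<dots> = liminf (\<lambda>n. ennreal (\<integral>x. g n x \<partial>M))"
    by (intro arg_cong[where f=liminf] ext nn_integral_eq_integral int nonneg)
  also have "\<dots> = ennreal c"
    by (intro lim_imp_Liminf tendsto_ennrealI c) simp
  finally have le: "(\<integral>\<^sup>+x. ennreal (h x) \<partial>M) \<le> ennreal c" .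
  show I: "integrable M h"
  proof (rule integrableI_nonneg)
    show "(\<integral>\<^sup>+x. ennreal (h x) \<partial>M) < \<infinity>" using le by (rule order.strict_trans1) simp
  qed (use h0 in auto)
  have "ennreal (\<integral>x. h x \<partial>M) \<le> ennreal c"
    using le nn_integral_eq_integral[OF I h0] by simp
  then show "(\<integral>x. h x \<partial>M) \<le> c" using c0 by simp
qed

text \<open>By \<open>Fmid\<close> the sets of approximate minimisers are closed under midpoints,
  and they are nested, so \<open>kernels_selection\<close> applies. The assumption
  \<open>lsc\<close> combines closedness of \<open>D\<close> with lower semicontinuity and may use
  only almost everywhere convergence of the conditional means of \<open>f\<close>; the choice of
  \<open>f\<close> decides what a limit can see.\<close>

lemma kernels_minimizer:
  fixes N :: "'b::euclidean_space measure" and F :: "('a \<Rightarrow> 'b measure) \<Rightarrow> real"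
    and f :: "'b \<Rightarrow> 'c::{banach, second_countable_topology}"
  assumes D: "D \<subseteq> kernels M N" "D \<noteq> {}"
    and mid: "\<And>k l. k \<in> D \<Longrightarrow> l \<in> D \<Longrightarrow> mid_kernel k l \<in> D"
    and bound: "\<And>k. k \<in> D \<Longrightarrow> b \<le> F k"
    and Fmid: "\<And>k l. k \<in> D \<Longrightarrow> l \<in> D \<Longrightarrow> F (mid_kernel k l) \<le> max (F k) (F l)"
    and f: "integrable N f"
    and lsc: "\<And>kn k c. (\<And>n::nat. kn n \<in> D) \<Longrightarrow> k \<in> kernels M N \<Longrightarrow>
      AE x in M. (\<lambda>n. \<integral>y. f y \<partial>kn n x) \<longlonglongrightarrow> (\<integral>y. f y \<partial>k x) \<Longrightarrow>
      (\<lambda>n. F (kn n)) \<longlonglongrightarrow> c \<Longrightarrow> k \<in> D \<and> F k \<le> c"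
  obtains k where "k \<in> D" "\<And>l. l \<in> D \<Longrightarrow> F k \<le> F l"
proof -
  define c where "c = (INF k\<in>D. F k)"
  have bdd: "bdd_below (F ` D)" using bound by (auto intro!: bdd_belowI[of _ b])
  have c_le: "c \<le> F k" if "k \<in> D" for k unfolding c_def using that by (intro cINF_lower bdd)
  define E where "E n = {k \<in> D. F k < c + 1 / real (Suc n)}" for n :: nat
  have ne: "E n \<noteq> {}" for n
    using cINF_less_iff[OF D(2) bdd, of "c + 1 / real (Suc n)"] unfolding c_def[symmetric] E_def by auto
  have dec: "E n \<subseteq> E m" if "m \<le> n" for m n
  proof -
    have "1 / real (Suc n) \<le> 1 / real (Suc m)" using that by (simp add: field_simps)
    then show ?thesis unfolding E_def by auto
  qed
  have Emid: "mid_kernel k l \<in> E n" if "k \<in> E n" "l \<in> E n" for k l n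
    using that mid Fmid[of k l] unfolding E_def by (auto intro: le_less_trans)
  have EK: "E n \<subseteq> kernels M N" for n using D(1) unfolding E_def by auto
  obtain kn k where kn: "\<And>n. kn n \<in> E n" and k: "k \<in> kernels M N"
    and conv: "AE x in M. \<forall>q. (\<lambda>n. measure (kn n x) (lower q)) \<longlonglongrightarrow> measure (k x) (lower q)"
    by (rule kernels_selection[of E N, OF EK ne dec Emid]) auto
  have knK: "kn n \<in> kernels M N" for n using kn EK by blast
  let ?u = "\<lambda>n x. (\<integral>y. f y \<partial>kn n x) - (\<integral>y. f y \<partial>k x)"
  have "integrable M (?u n)" for n using kernels_integral(1)[OF knK f] kernels_integral(1)[OF k f] by simp
  from tendsto_L1_AE_subseq[OF this kernels_L1_limit[OF knK k conv f]]
  obtain r where r: "strict_mono r" and ae: "AE x in M. (\<lambda>n. ?u (r n) x) \<longlonglongrightarrow> 0" by blast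
  have lo: "c \<le> F (kn n)" and up: "F (kn n) \<le> c + 1 / real (Suc n)" for n
    using kn[of n] c_le unfolding E_def by auto
  have "(\<lambda>n. c + 1 / real (Suc n)) \<longlonglongrightarrow> c"
    using tendsto_add[OF tendsto_const[of c] LIMSEQ_inverse_real_of_nat] by (simp add: inverse_eq_divide)
  from tendsto_sandwich[OF always_eventually[OF allI[OF lo]] always_eventually[OF allI[OF up]] tendsto_const this]
  have "(\<lambda>n. F (kn n)) \<longlonglongrightarrow> c" .
  from LIMSEQ_subseq_LIMSEQ[OF this r] have "(\<lambda>n. F (kn (r n))) \<longlonglongrightarrow> c"
    by (simp add: comp_def)
  moreover have "AE x in M. (\<lambda>n. \<integral>y. f y \<partial>kn (r n) x) \<longlonglongrightarrow> (\<integral>y. f y \<partial>k x)"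
    using ae by eventually_elim (simp add: LIM_zero_iff)
  ultimately have "k \<in> D" "F k \<le> c"
    using lsc[of "\<lambda>n. kn (r n)" k c] kn k unfolding E_def by auto
  then show ?thesis using c_le by (intro that[of k]) (auto intro: order_trans)
qed

end

section \<open>Supporting affine functions\<close>

lemma convex_on_of_support:
  fixes f :: "'a::real_inner \<Rightarrow> real"
  assumes "\<And>x. \<exists>a. \<forall>y. f x + a \<bullet> (y - x) \<le> f y"
  shows "convex_on UNIV f"
proof (rule convex_onI)
  fix t :: real and x y :: 'a assume t: "0 < t" "t < 1"
  let ?z = "(1 - t) *\<^sub>R x + t *\<^sub>R y"
  obtain a where a: "\<And>y. f ?z + a \<bullet> (y - ?z) \<le> f y" using assms by metis
  have "(1 - t) * (f ?z + a \<bullet> (x - ?z)) + t * (f ?z + a \<bullet> (y - ?z)) \<le> (1 - t) * f x + t * f y"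
    using t by (intro add_mono mult_left_mono a) auto
  moreover have "(1 - t) * (f ?z + a \<bullet> (x - ?z)) + t * (f ?z + a \<bullet> (y - ?z))
      = f ?z + a \<bullet> ((1 - t) *\<^sub>R (x - ?z) + t *\<^sub>R (y - ?z))"
    unfolding inner_add_right inner_scaleR_right by (simp add: ring_distribs)
  moreover have "(1 - t) *\<^sub>R (x - ?z) + t *\<^sub>R (y - ?z) = 0"
    by (simp add: algebra_simps)
  ultimately show "f ?z \<le> (1 - t) * f x + t * f y" by simp
qed simp

text \<open>A hyperplane separates \<open>(x, f x)\<close> from the strict epigraph. It is not
  vertical because \<open>f\<close> is finite everywhere, so dividing by its last component
  \<open>s\<close> gives the slope.\<close>

lemma convex_on_support:
  fixes f :: "'a::euclidean_space \<Rightarrow> real"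
  assumes f: "convex_on UNIV f"
  obtains a where "\<And>y. f x + a \<bullet> (y - x) \<le> f y"
proof -
  let ?S = "{(x, f x)}" and ?T = "{(y, t). f y < t}"
  have "convex ?T"
  proof (rule convexI, clarsimp)
    fix y1 y2 :: 'a and t1 t2 u v :: real
    assume *: "f y1 < t1" "f y2 < t2" "0 \<le> u" "0 \<le> v" "u + v = 1"
    have "f (u *\<^sub>R y1 + v *\<^sub>R y2) \<le> u * f y1 + v * f y2"
      using f * unfolding convex_on_def by blast
    also have "\<dots> < u * t1 + v * t2"
    proof (cases "u = 0")
      case False
      then show ?thesis using * by (intro add_less_le_mono mult_strict_left_mono mult_left_mono) auto
    qed (use * in auto)
    finally show "f (u *\<^sub>R y1 + v *\<^sub>R y2) < u * t1 + v * t2" .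
  qed
  moreover have "(x, f x + 1) \<in> ?T" by simp
  ultimately obtain a b where ab: "a \<noteq> 0" "a \<bullet> (x, f x) \<le> b" "\<forall>z\<in>?T. a \<bullet> z \<ge> b"
    using separating_hyperplane_sets[of ?S ?T] by blast
  obtain u s where a: "a = (u, s)" by (cases a)
  have le: "u \<bullet> x + s * f x \<le> u \<bullet> y + s * t" if "f y < t" for y t
    using ab(2) ab(3)[rule_format, of "(y, t)"] that by (simp add: a)
  have "0 \<le> s" using le[of x "f x + 1"] by (simp add: algebra_simps)
  moreover have "s \<noteq> 0"
  proof
    assume "s = 0"
    \<comment> \<open>A vertical hyperplane would bound \<open>u \<bullet> y\<close> from below for
      all \<open>y\<close>, which the point \<open>x - u\<close> refutes unless \<open>u\<close>
      vanishes.\<close>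
    then have "u \<bullet> x \<le> u \<bullet> (x - u)" using le[of "x - u" "f (x - u) + 1"] by simp
    then have "u = 0" by (simp add: inner_diff_right) (metis inner_gt_zero_iff not_le)
    with \<open>s = 0\<close> a ab(1) show False by (simp add: zero_prod_def)
  qed
  ultimately have s: "0 < s" by simp
  have "f x + ((- 1 / s) *\<^sub>R u) \<bullet> (y - x) \<le> f y" for y
  proof (rule dense_ge)
    fix t assume "f y < t"
    from le[OF this] have "s * (f x + ((- 1 / s) *\<^sub>R u) \<bullet> (y - x)) \<le> s * t"
      using s by (simp add: distrib_left inner_diff_right diff_divide_distrib right_diff_distrib)
    then show "f x + ((- 1 / s) *\<^sub>R u) \<bullet> (y - x) \<le> t" using s by simp
  qed
  then show ?thesis by (rule that)
qed

lemma strictly_convex_convex_on: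
  fixes f :: "'a::real_vector \<Rightarrow> real"
  shows "strictly_convex f \<Longrightarrow> convex_on UNIV f"
proof (rule convex_onI)
  fix t :: real and x y :: 'a assume f: "strictly_convex f" and t: "0 < t" "t < 1"
  show "f ((1 - t) *\<^sub>R x + t *\<^sub>R y) \<le> (1 - t) * f x + t * f y"
  proof (cases "x = y")
    case True
    then show ?thesis by (simp add: scaleR_left_distrib[symmetric] distrib_right[symmetric])
  next
    case False
    then show ?thesis using f t unfolding strictly_convex_def by (auto intro: less_imp_le)
  qed
qed simp

lemma strictly_convex_midpoint:
  assumes "strictly_convex f" "x \<noteq> y"
  shows "f ((1/2) *\<^sub>R (x + y)) < (f x + f y) / 2"
  using assms(1)[unfolded strictly_convex_def, rule_format, OF assms(2), of "1/2"]
  by (simp add: scaleR_add_right field_simps)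

text \<open>At the midpoint the affine bound lies strictly below the average of \<open>f x\<close>
  and \<open>f y\<close>; doubling gives the claim.\<close>

lemma strictly_convex_support_strict:
  fixes f :: "'a::real_inner \<Rightarrow> real"
  assumes "strictly_convex f" and a: "\<And>y. f x + a \<bullet> (y - x) \<le> f y" and "y \<noteq> x"
  shows "f x + a \<bullet> (y - x) < f y"
proof -
  have mid: "(1/2) *\<^sub>R (x + y) - x = (1/2) *\<^sub>R (y - x)"
  proof -
    have "(1/2) *\<^sub>R (x + y) - x = (1/2) *\<^sub>R (x + y) - (1/2) *\<^sub>R (x + x)" by simp
    then show ?thesis unfolding scaleR_diff_right[symmetric] by simp
  qed
  have "f x + a \<bullet> ((1/2) *\<^sub>R (x + y) - x) < (f x + f y) / 2"
    using a strictly_convex_midpoint[OF assms(1), of x y] assms(3) by (metis le_less_trans)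
  then show ?thesis unfolding mid inner_scaleR_right by (simp add: field_simps)
qed

lemma strictly_convex_norm_power2: "strictly_convex (\<lambda>x::'a::real_inner. (norm x)\<^sup>2)"
  unfolding strictly_convex_def
proof (intro allI impI)
  fix x y :: 'a and t :: real assume *: "x \<noteq> y" "0 < t" "t < 1"
  have "(1 - t) * (norm x)\<^sup>2 + t * (norm y)\<^sup>2 - (norm ((1 - t) *\<^sub>R x + t *\<^sub>R y))\<^sup>2
     = t * (1 - t) * (norm (x - y))\<^sup>2"
    unfolding power2_norm_eq_inner by (simp add: inner_simps inner_commute algebra_simps power2_eq_square)
  moreover have "0 < t * (1 - t) * (norm (x - y))\<^sup>2" using * by simp
  ultimately show "(norm ((1 - t) *\<^sub>R x + t *\<^sub>R y))\<^sup>2 < (1 - t) * (norm x)\<^sup>2 + t * (norm y)\<^sup>2" by simp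
qed

lemma convex_on_UNIV_measurable:
  fixes f :: "'a::euclidean_space \<Rightarrow> real"
  assumes "convex_on UNIV f"
  shows "f \<in> borel_measurable borel"
  using convex_on_continuous[OF open_UNIV assms] by (rule borel_measurable_continuous_onI)

section \<open>Soft-max potentials with prescribed masses\<close>

definition partition_sum :: "'a::euclidean_space set \<Rightarrow> ('a \<Rightarrow> real) \<Rightarrow> 'a \<Rightarrow> real" where
  "partition_sum I w y = (\<Sum>b\<in>I. exp (b \<bullet> y - w b))"

text \<open>A smooth version of the maximum of the affine functions
  \<open>a \<bullet> y - w a\<close>, the dual potential of entropically regularised transport to
  finitely many points.\<close>

definition lse :: "'a::euclidean_space set \<Rightarrow> ('a \<Rightarrow> real) \<Rightarrow> 'a \<Rightarrow> real" where
  "lse I w y = ln (partition_sum I w y)"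

text \<open>The Gibbs weights, equal to minus the derivative of \<open>lse I w y\<close> in
  \<open>w a\<close>. For fixed \<open>y\<close> they form a probability on the slopes.\<close>

definition softmax :: "'a::euclidean_space set \<Rightarrow> ('a \<Rightarrow> real) \<Rightarrow> 'a \<Rightarrow> 'a \<Rightarrow> real" where
  "softmax I w a y = exp (a \<bullet> y - w a) / partition_sum I w y"

context
  fixes I :: "'a::euclidean_space set"
  assumes I: "finite I" "I \<noteq> {}"
begin

lemma partition_sum_pos: "0 < partition_sum I w y"
  unfolding partition_sum_def using I by (intro sum_pos) auto

lemma lse_measurable [measurable]: "lse I w \<in> borel_measurable borel"
  unfolding lse_def partition_sum_def by measurable

lemma softmax_measurable [measurable]: "softmax I w a \<in> borel_measurable borel"
  unfolding softmax_def partition_sum_def by measurable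

lemma softmax_pos: "0 < softmax I w a y"
  unfolding softmax_def using partition_sum_pos by simp

lemma softmax_sum: "(\<Sum>a\<in>I. softmax I w a y) = 1"
  unfolding softmax_def sum_divide_distrib[symmetric] partition_sum_def[symmetric]
  using partition_sum_pos[of w y] by simp

lemma softmax_le_1: "a \<in> I \<Longrightarrow> softmax I w a y \<le> 1"
  using sum_nonneg_leq_bound[OF I(1) less_imp_le[OF softmax_pos] softmax_sum] by simp

lemma lse_softmax: "lse I w y = a \<bullet> y - w a - ln (softmax I w a y)"
  unfolding lse_def softmax_def using partition_sum_pos[of w y] by (simp add: ln_div)

lemma lse_ge: "a \<in> I \<Longrightarrow> a \<bullet> y - w a \<le> lse I w y"
  using ln_le_zero_iff[OF softmax_pos] softmax_le_1 by (auto simp: lse_softmax[of w y a])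

lemma lse_diff_le:
  "lse I w y \<le> lse I v y + (\<Sum>a\<in>I. \<bar>w a - v a\<bar>)"
proof -
  let ?D = "\<Sum>a\<in>I. \<bar>w a - v a\<bar>"
  have "partition_sum I w y \<le> (\<Sum>a\<in>I. exp (a \<bullet> y - v a) * exp ?D)"
    unfolding partition_sum_def
  proof (rule sum_mono)
    fix a assume "a \<in> I"
    then have "\<bar>w a - v a\<bar> \<le> ?D" by (intro member_le_sum I) auto
    then show "exp (a \<bullet> y - w a) \<le> exp (a \<bullet> y - v a) * exp ?D"
      unfolding exp_add[symmetric] by simp
  qed
  then have "partition_sum I w y \<le> partition_sum I v y * exp ?D"
    unfolding sum_distrib_right[symmetric] partition_sum_def .
  then have "ln (partition_sum I w y) \<le> ln (partition_sum I v y * exp ?D)"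
    using partition_sum_pos by (subst ln_le_cancel_iff) auto
  then show ?thesis unfolding lse_def using partition_sum_pos[of v y] by (simp add: ln_mult)
qed

lemma lse_shift: "lse I (\<lambda>a. w a + c) y = lse I w y - c"
proof -
  have "partition_sum I (\<lambda>a. w a + c) y = partition_sum I w y * exp (- c)"
    unfolding partition_sum_def sum_distrib_right by (simp add: exp_add[symmetric] algebra_simps)
  then show ?thesis unfolding lse_def using partition_sum_pos[of w y] by (simp add: ln_mult)
qed

lemma lse_cong: "(\<And>a. a \<in> I \<Longrightarrow> w a = v a) \<Longrightarrow> lse I w y = lse I v y"
  unfolding lse_def partition_sum_def by simp

lemma lse_bound: "\<bar>lse I w y\<bar> \<le> ln (card I) + (\<Sum>a\<in>I. \<bar>a \<bullet> y - w a\<bar>)"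
proof -
  have c: "1 \<le> real (card I)" using I by (simp add: Suc_le_eq card_gt_0_iff)
  have "lse I w y = lse I (\<lambda>a. w a - a \<bullet> y) 0" unfolding lse_def partition_sum_def by simp
  also have "\<dots> \<le> lse I (\<lambda>_. 0) 0 + (\<Sum>a\<in>I. \<bar>w a - a \<bullet> y - 0\<bar>)" by (rule lse_diff_le)
  also have "lse I (\<lambda>_. 0) 0 = ln (card I)" by (simp add: lse_def partition_sum_def)
  finally have "lse I w y \<le> ln (card I) + (\<Sum>a\<in>I. \<bar>a \<bullet> y - w a\<bar>)" by (simp add: abs_minus_commute)
  moreover obtain a where a: "a \<in> I" using I by auto
  have "\<bar>a \<bullet> y - w a\<bar> \<le> (\<Sum>a\<in>I. \<bar>a \<bullet> y - w a\<bar>)" using a I by (intro member_le_sum) auto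
  then have "- (\<Sum>a\<in>I. \<bar>a \<bullet> y - w a\<bar>) \<le> lse I w y" using lse_ge[OF a, of y w] by linarith
  moreover have "0 \<le> ln (real (card I))" using c by simp
  ultimately show ?thesis by linarith
qed

text \<open>Changing one weight multiplies the partition sum by
  \<open>1 + softmax I w a y * (exp (- t) - 1)\<close>, and \<open>ln z \<le> z - 1\<close>. The
  bound is linear in \<open>softmax\<close>, so it can be integrated and no differentiation under
  the integral is required.\<close>

lemma lse_update:
  assumes a: "a \<in> I"
  shows "lse I (w(a := w a + t)) y \<le> lse I w y + softmax I w a y * (exp (- t) - 1)"
proof -
  have "partition_sum I (w(a := w a + t)) y
      = exp (a \<bullet> y - w a) * exp (- t) + (\<Sum>b\<in>I - {a}. exp (b \<bullet> y - w b))"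
    unfolding partition_sum_def using I a
    by (subst sum.remove[OF _ a]) (auto simp: exp_add[symmetric] algebra_simps intro!: sum.cong)
  also have "(\<Sum>b\<in>I - {a}. exp (b \<bullet> y - w b)) = partition_sum I w y - exp (a \<bullet> y - w a)"
    unfolding partition_sum_def using I a by (simp add: sum.remove[OF _ a])
  also have "exp (a \<bullet> y - w a) * exp (- t) + (partition_sum I w y - exp (a \<bullet> y - w a))
      = partition_sum I w y * (1 + softmax I w a y * (exp (- t) - 1))"
    unfolding softmax_def using partition_sum_pos[of w y] by (simp add: field_simps)
  finally have eq: "partition_sum I (w(a := w a + t)) y
      = partition_sum I w y * (1 + softmax I w a y * (exp (- t) - 1))" .
  then have pos: "0 < 1 + softmax I w a y * (exp (- t) - 1)"
    using partition_sum_pos[of w y] partition_sum_pos[of "w(a := w a + t)" y] by (simp add: zero_less_mult_iff)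
  then have "lse I (w(a := w a + t)) y = lse I w y + ln (1 + softmax I w a y * (exp (- t) - 1))"
    unfolding lse_def eq using partition_sum_pos[of w y] by (simp add: ln_mult)
  also have "\<dots> \<le> lse I w y + softmax I w a y * (exp (- t) - 1)"
    using ln_le_minus_one[OF pos] by simp
  finally show ?thesis .
qed

text \<open>The weights minimise the dual functional \<open>\<integral> lse I w \<partial>\<nu> + (\<Sum>a\<in>I. p a * w a)\<close>, whose
  derivative in the direction of \<open>w a\<close> is \<open>p a - \<integral> softmax I w a \<partial>\<nu>\<close>.\<close>

lemma softmax_weights_exist:
  fixes \<nu> :: "'a measure"
  assumes \<nu>: "prob_space \<nu>" "sets \<nu> = sets borel" "integrable \<nu> (\<lambda>y. y)"
    and p: "\<And>a. a \<in> I \<Longrightarrow> 0 < p a" "(\<Sum>a\<in>I. p a) = 1"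
  obtains w where "\<And>a. a \<in> I \<Longrightarrow> (\<integral>y. softmax I w a y \<partial>\<nu>) = p a"
proof -
  interpret \<nu>: prob_space \<nu> by (rule \<nu>)
  note [measurable_cong] = \<nu>(2)
  have Ilse: "integrable \<nu> (lse I w)" for w
  proof (rule Bochner_Integration.integrable_bound)
    show "integrable \<nu> (\<lambda>y. ln (card I) + (\<Sum>a\<in>I. \<bar>a \<bullet> y - w a\<bar>))"
      using \<nu>(3) by (intro Bochner_Integration.integrable_add Bochner_Integration.integrable_sum
        integrable_abs Bochner_Integration.integrable_diff integrable_inner_right) auto
    show "AE y in \<nu>. norm (lse I w y) \<le> norm (ln (card I) + (\<Sum>a\<in>I. \<bar>a \<bullet> y - w a\<bar>))"
      using lse_bound[of w] by (intro AE_I2) (metis abs_ge_self order_trans real_norm_def)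
  qed simp
  have Isoft: "integrable \<nu> (softmax I w a)" if "a \<in> I" for w a
    using softmax_le_1[OF that] less_imp_le[OF softmax_pos]
    by (intro \<nu>.integrable_const_bound[of _ 1]) auto
  define G where "G w = (\<integral>y. lse I w y \<partial>\<nu>) + (\<Sum>a\<in>I. p a * w a)" for w
  have p1: "p a \<le> 1" if "a \<in> I" for a
    using sum_nonneg_leq_bound[OF I(1) less_imp_le[OF p(1)] p(2) that] by simp
  have Glip: "G w \<le> G v + 2 * (\<Sum>a\<in>I. \<bar>w a - v a\<bar>)" for w v
  proof -
    have "(\<integral>y. lse I w y \<partial>\<nu>) \<le> (\<integral>y. lse I v y + (\<Sum>a\<in>I. \<bar>w a - v a\<bar>) \<partial>\<nu>)"
      using Ilse lse_diff_le by (intro integral_mono) auto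
    then have "(\<integral>y. lse I w y \<partial>\<nu>) \<le> (\<integral>y. lse I v y \<partial>\<nu>) + (\<Sum>a\<in>I. \<bar>w a - v a\<bar>)"
      using Ilse by (simp add: \<nu>.prob_space)
    moreover have "(\<Sum>a\<in>I. p a * w a) \<le> (\<Sum>a\<in>I. p a * v a + \<bar>w a - v a\<bar>)"
    proof (rule sum_mono)
      fix a assume a: "a \<in> I"
      have "p a * (w a - v a) \<le> p a * \<bar>w a - v a\<bar>" using p(1)[OF a] by (intro mult_left_mono) auto
      also have "\<dots> \<le> 1 * \<bar>w a - v a\<bar>" using p1[OF a] by (intro mult_right_mono) auto
      finally show "p a * w a \<le> p a * v a + \<bar>w a - v a\<bar>" by (simp add: algebra_simps)
    qed
    ultimately show ?thesis unfolding G_def by (simp add: sum.distrib)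
  qed
  \<comment> \<open>As the masses sum to 1, \<open>G\<close> is constant along this direction, so
    coercivity can hold only after normalising the smallest weight to 0.\<close>
  have Gshift: "G (\<lambda>a. w a + c) = G w" for w c
    unfolding G_def lse_shift using Ilse[of w] p(2)
    by (simp add: \<nu>.prob_space ring_distribs sum.distrib sum_distrib_right[symmetric])
  have Gcong: "G w = G v" if "\<And>a. a \<in> I \<Longrightarrow> w a = v a" for w v
  proof -
    have "lse I w = lse I v" using that by (intro ext lse_cong)
    then show ?thesis unfolding G_def using that by simp
  qed
  define K where "K = (\<Sum>b\<in>I. \<bar>\<integral>y. b \<bullet> y \<partial>\<nu>\<bar>)"
  \<comment> \<open>Coercivity on normalised weights: the slope \<open>b\<close> of weight 0 bounds
    the integral of \<open>lse\<close> below by \<open>- K\<close>, and the remaining linear terms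
    are nonnegative.\<close>
  have Glow: "p a * w a - K \<le> G w" if w: "\<And>a. a \<in> I \<Longrightarrow> 0 \<le> w a" and b: "b \<in> I" "w b = 0" and a: "a \<in> I" for w a b
  proof -
    have "(\<integral>y. b \<bullet> y \<partial>\<nu>) \<le> (\<integral>y. lse I w y \<partial>\<nu>)"
      using lse_ge[OF b(1), of _ w] \<nu>(3) Ilse b(2) by (intro integral_mono) auto
    moreover have "\<bar>\<integral>y. b \<bullet> y \<partial>\<nu>\<bar> \<le> K" unfolding K_def using b I by (intro member_le_sum) auto
    moreover have "p a * w a \<le> (\<Sum>a\<in>I. p a * w a)"
      by (rule member_le_sum[OF a _ I(1)]) (use w p(1) in \<open>force intro: mult_nonneg_nonneg less_imp_le\<close>)
    ultimately show ?thesis unfolding G_def by linarith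
  qed
  \<comment> \<open>Chosen so that a normalised weight above \<open>R\<close> gives \<open>G\<close>
    a value above that at 0, by \<open>Glow\<close>. Minimising over the box of side
    \<open>R\<close> is then enough.\<close>
  define R where "R = (\<Sum>a\<in>I. (\<bar>G (\<lambda>_. 0)\<bar> + K) / p a)"
  have K0: "0 \<le> K" unfolding K_def by (intro sum_nonneg) auto
  have Rle: "(\<bar>G (\<lambda>_. 0)\<bar> + K) / p a \<le> R" if "a \<in> I" for a
    unfolding R_def using that I p(1) K0 by (intro member_le_sum) (auto intro!: divide_nonneg_pos)
  \<comment> \<open>The weights are functions on the whole space; freezing them to 0 off
    \<open>I\<close> makes the box compact in the product topology.\<close>
  define W where "W = (\<Pi>\<^sub>E a\<in>UNIV. if a \<in> I then {0..R} else {0})"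
  have "compactin (product_topology (\<lambda>_. euclidean) UNIV) W"
    unfolding W_def by (subst compactin_PiE) auto
  then have cW: "compact W" by (simp add: euclidean_product_topology)
  have R0: "0 \<le> R" unfolding R_def using K0 p(1) by (intro sum_nonneg divide_nonneg_pos) auto
  then have W0: "(\<lambda>_. 0) \<in> W" unfolding W_def by auto
  have cG: "continuous_on W G"
    unfolding continuous_on_def
  proof
    fix v assume "v \<in> W"
    have coord: "((\<lambda>w. w a) \<longlongrightarrow> v a) (at v within W)" for a
      using continuous_on_product_coordinates[of a] unfolding continuous_on_def
      by (auto intro: tendsto_within_subset[of _ _ _ UNIV])
    note tends = tendsto_add tendsto_diff tendsto_mult tendsto_sum tendsto_rabs tendsto_const coord
    have "((\<lambda>w. G v - 2 * (\<Sum>a\<in>I. \<bar>v a - w a\<bar>)) \<longlongrightarrow> G v - 2 * (\<Sum>a\<in>I. \<bar>v a - v a\<bar>)) (at v within W)"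
      by (intro tends)
    moreover have "((\<lambda>w. G v + 2 * (\<Sum>a\<in>I. \<bar>w a - v a\<bar>)) \<longlongrightarrow> G v + 2 * (\<Sum>a\<in>I. \<bar>v a - v a\<bar>)) (at v within W)"
      by (intro tends)
    ultimately show "(G \<longlongrightarrow> G v) (at v within W)"
    proof (intro tendsto_sandwich[of "\<lambda>w. G v - 2 * (\<Sum>a\<in>I. \<bar>v a - w a\<bar>)" G _
          "\<lambda>w. G v + 2 * (\<Sum>a\<in>I. \<bar>w a - v a\<bar>)"] always_eventually allI)
      show "G v - 2 * (\<Sum>a\<in>I. \<bar>v a - w a\<bar>) \<le> G w" for w using Glip[of v w] by simp
      show "G w \<le> G v + 2 * (\<Sum>a\<in>I. \<bar>w a - v a\<bar>)" for w by (rule Glip)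
    qed simp_all
  qed
  obtain w where w: "w \<in> W" "\<And>v. v \<in> W \<Longrightarrow> G w \<le> G v"
    using continuous_attains_inf[OF cW _ cG] W0 by blast
  have wmin: "G w \<le> G v" for v
  proof -
    obtain b where b: "b \<in> I" "\<And>a. a \<in> I \<Longrightarrow> v b \<le> v a"
      using I by (metis (no_types, lifting) arg_min_if_finite(1) arg_min_least)
    define u where "u a = (if a \<in> I then v a - v b else 0)" for a
    have u0: "0 \<le> u a" if "a \<in> I" for a using b that by (simp add: u_def)
    have "G u = G (\<lambda>a. v a + (- v b))" by (rule Gcong) (simp add: u_def)
    then have Gu: "G u = G v" by (simp only: Gshift)
    show ?thesis
    proof (cases "u \<in> W")
      case True
      then show ?thesis using w(2)[OF True] Gu by simp
    next
      case False
      then obtain a where a: "a \<in> I" "R < u a"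
        using u0 unfolding W_def PiE_def Pi_def by (auto simp: u_def split: if_splits)
      have "(\<bar>G (\<lambda>_. 0)\<bar> + K) / p a < u a" using Rle[OF a(1)] a(2) by linarith
      then have "\<bar>G (\<lambda>_. 0)\<bar> + K < p a * u a" using p(1)[OF a(1)] by (simp add: field_simps)
      moreover have "p a * u a - K \<le> G u" using u0 b a by (intro Glow[of u b]) (auto simp: u_def)
      moreover have "G w \<le> G (\<lambda>_. 0)" by (rule w(2)[OF W0])
      ultimately show ?thesis using Gu by linarith
    qed
  qed
  have "(\<integral>y. softmax I w a y \<partial>\<nu>) = p a" if a: "a \<in> I" for a
  proof -
    define m where "m = (\<integral>y. softmax I w a y \<partial>\<nu>)"
    \<comment> \<open>By \<open>lse_update\<close>, \<open>h t\<close> bounds the increase of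
      \<open>G\<close> when \<open>w a\<close> grows by \<open>t\<close>. So \<open>h\<close> has
      its minimum at 0, and its derivative there, \<open>p a - m\<close>, vanishes.\<close>
    define h where "h t = (exp (- t) - 1) * m + p a * t" for t
    have "0 \<le> h t" for t
    proof -
      have "(\<integral>y. lse I (w(a := w a + t)) y \<partial>\<nu>) \<le> (\<integral>y. lse I w y + softmax I w a y * (exp (- t) - 1) \<partial>\<nu>)"
        using Ilse Isoft[OF a] lse_update[OF a] by (intro integral_mono) auto
      also have "\<dots> = (\<integral>y. lse I w y \<partial>\<nu>) + m * (exp (- t) - 1)"
        using Ilse Isoft[OF a] by (simp add: m_def)
      finally have "(\<integral>y. lse I (w(a := w a + t)) y \<partial>\<nu>) \<le> (\<integral>y. lse I w y \<partial>\<nu>) + m * (exp (- t) - 1)" .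
      moreover have "(\<Sum>b\<in>I. p b * (w(a := w a + t)) b) = (\<Sum>b\<in>I. p b * w b) + p a * t"
        using I a by (simp add: sum.remove[OF _ a] algebra_simps)
      ultimately show ?thesis
        using wmin[of "w(a := w a + t)"] unfolding G_def h_def by (simp add: algebra_simps)
    qed
    moreover have "h 0 = 0" by (simp add: h_def)
    moreover have "DERIV h 0 :> - m + p a"
      unfolding h_def by (auto intro!: derivative_eq_intros)
    ultimately have "- m + p a = 0"
      by (intro DERIV_local_min[of h _ 0 1]) auto
    then show ?thesis by (simp add: m_def)
  qed
  then show ?thesis by (rule that)
qed

end

section \<open>Barycenters of kernels\<close>

definition bary :: "('x \<Rightarrow> 'a::euclidean_space measure) \<Rightarrow> 'x \<Rightarrow> 'a" where
  "bary k = (\<lambda>x. \<integral>y. y \<partial>k x)"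

lemma P2D:
  fixes \<mu> :: "'a::euclidean_space measure"
  assumes "\<mu> \<in> P2"
  shows "prob_space \<mu>" "sets \<mu> = sets borel" "space \<mu> = UNIV" "integrable \<mu> (\<lambda>x. (norm x)\<^sup>2)"
    "integrable \<mu> (\<lambda>x. x)"
proof -
  show a: "prob_space \<mu>" "sets \<mu> = sets borel" "integrable \<mu> (\<lambda>x. (norm x)\<^sup>2)"
    using assms by (auto simp: P2_def)
  show "space \<mu> = UNIV" using sets_eq_imp_space_eq[OF a(2)] by simp
  interpret prob_space \<mu> by (rule a)
  show "integrable \<mu> (\<lambda>x. x)"
  proof (rule Bochner_Integration.integrable_bound)
    show "integrable \<mu> (\<lambda>x. 1 + (norm x)\<^sup>2)" using a(3) by simp
    have "norm x \<le> 1 + (norm x)\<^sup>2" for x :: 'a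
    proof -
      have "2 * norm x \<le> 1 + (norm x)\<^sup>2"
        using zero_le_power2[of "norm x - 1"] unfolding power2_diff by simp
      then show ?thesis using norm_ge_zero[of x] by linarith
    qed
    then show "AE x in \<mu>. norm x \<le> norm (1 + (norm x)\<^sup>2)" by simp
    show "(\<lambda>x. x) \<in> borel_measurable \<mu>" by (rule measurable_ident_sets[OF a(2)])
  qed
qed

lemma inner_le_norm_power2: "\<bar>x \<bullet> y\<bar> \<le> (norm x)\<^sup>2 + (norm y)\<^sup>2"
proof -
  have "2 * (norm x * norm y) \<le> (norm x)\<^sup>2 + (norm y)\<^sup>2"
    using zero_le_power2[of "norm x - norm y"] by (simp add: power2_diff)
  moreover have "0 \<le> norm x * norm y" by simp
  ultimately show ?thesis using Cauchy_Schwarz_ineq2[of x y] by linarith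
qed

lemma integrable_inner_of_power2:
  fixes f g :: "'x \<Rightarrow> 'a::euclidean_space"
  assumes [measurable]: "f \<in> borel_measurable M" "g \<in> borel_measurable M"
    and "integrable M (\<lambda>x. (norm (f x))\<^sup>2)" "integrable M (\<lambda>x. (norm (g x))\<^sup>2)"
  shows "integrable M (\<lambda>x. f x \<bullet> g x)"
proof (rule Bochner_Integration.integrable_bound)
  show "integrable M (\<lambda>x. (norm (f x))\<^sup>2 + (norm (g x))\<^sup>2)" using assms by simp
  show "AE x in M. norm (f x \<bullet> g x) \<le> norm ((norm (f x))\<^sup>2 + (norm (g x))\<^sup>2)"
  proof (rule AE_I2)
    show "norm (f x \<bullet> g x) \<le> norm ((norm (f x))\<^sup>2 + (norm (g x))\<^sup>2)" for x
      using inner_le_norm_power2[of "f x" "g x"] by simp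
  qed
qed simp

lemma integrable_norm_power2_diff:
  fixes f g :: "'x \<Rightarrow> 'a::euclidean_space"
  assumes [measurable]: "f \<in> borel_measurable M" "g \<in> borel_measurable M"
    and "integrable M (\<lambda>x. (norm (f x))\<^sup>2)" "integrable M (\<lambda>x. (norm (g x))\<^sup>2)"
  shows "integrable M (\<lambda>x. (norm (f x - g x))\<^sup>2)"
proof -
  have "(norm (f x - g x))\<^sup>2 = (norm (f x))\<^sup>2 - 2 * (f x \<bullet> g x) + (norm (g x))\<^sup>2" for x
    unfolding power2_norm_eq_inner by (simp add: inner_diff inner_commute algebra_simps)
  then show ?thesis using integrable_inner_of_power2[OF assms] assms(3,4) by simp
qed

lemma jensen:
  fixes K :: "'a::euclidean_space measure" and f :: "'a \<Rightarrow> real"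
  assumes K: "prob_space K" and y: "integrable K (\<lambda>y. y)" and f: "integrable K f" and c: "convex_on UNIV f"
  shows "f (\<integral>y. y \<partial>K) \<le> (\<integral>y. f y \<partial>K)"
proof -
  interpret prob_space K by (rule K)
  let ?b = "\<integral>y. y \<partial>K"
  obtain a where a: "\<And>y. f ?b + a \<bullet> (y - ?b) \<le> f y" using convex_on_support[OF c, of ?b] by blast
  have "(\<integral>y. f ?b + a \<bullet> (y - ?b) \<partial>K) \<le> (\<integral>y. f y \<partial>K)"
    using y f a by (intro integral_mono) auto
  then show ?thesis using y by (simp add: prob_space)
qed

lemma jensen_strict:
  fixes K :: "'a::euclidean_space measure" and f :: "'a \<Rightarrow> real"
  assumes K: "prob_space K" and y: "integrable K (\<lambda>y. y)" and f: "integrable K f" and c: "strictly_convex f"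
    and eq: "f (\<integral>y. y \<partial>K) = (\<integral>y. f y \<partial>K)"
  shows "AE y in K. y = (\<integral>y. y \<partial>K)"
proof -
  interpret prob_space K by (rule K)
  let ?b = "\<integral>y. y \<partial>K"
  obtain a where a: "\<And>y. f ?b + a \<bullet> (y - ?b) \<le> f y"
    using convex_on_support[OF strictly_convex_convex_on[OF c], of ?b] by blast
  have "AE y in K. f ?b + a \<bullet> (y - ?b) = f y"
  proof (rule AE_eq_of_le_integral_eq)
    show "(\<integral>y. f ?b + a \<bullet> (y - ?b) \<partial>K) = (\<integral>y. f y \<partial>K)"
      using y eq by (simp add: prob_space)
  qed (use y f a in auto)
  then show ?thesis
    by eventually_elim (use strictly_convex_support_strict[OF c a] in force)
qed

lemma ereal_integral_eq:
  assumes "integrable M f"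
  shows "ereal_integral M f = ereal (\<integral>x. f x \<partial>M)"
proof -
  have fin: "(\<integral>\<^sup>+x. ennreal (f x) \<partial>M) \<noteq> \<infinity>" "(\<integral>\<^sup>+x. ennreal (- f x) \<partial>M) \<noteq> \<infinity>"
    using assms unfolding real_integrable_def by auto
  then obtain a b where ab: "0 \<le> a" "(\<integral>\<^sup>+x. ennreal (f x) \<partial>M) = ennreal a" "0 \<le> b" "(\<integral>\<^sup>+x. ennreal (- f x) \<partial>M) = ennreal b"
    by (metis ennreal_cases infinity_ennreal_def)
  then show ?thesis
    unfolding ereal_integral_def real_lebesgue_integral_def[OF assms] by simp
qed

lemma convex_le_integral:
  assumes "\<eta> \<le>\<^sub>c\<^sub>x \<nu>" "convex_on UNIV f" "integrable \<eta> f" "integrable \<nu> f"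
  shows "(\<integral>x. f x \<partial>\<eta>) \<le> (\<integral>x. f x \<partial>\<nu>)"
proof -
  have "integral_makes_sense \<eta> f" "integral_makes_sense \<nu> f"
    using assms(3,4) unfolding integral_makes_sense_def real_integrable_def by (auto simp: less_top[symmetric])
  then show ?thesis
    using assms(1,2) unfolding convex_le_def by (auto simp: ereal_integral_eq[OF assms(3)] ereal_integral_eq[OF assms(4)])
qed

context prob_space
begin

lemma const_kernel:
  assumes "prob_space N" "sets N = sets borel"
  shows "(\<lambda>_. N) \<in> kernels M N"
proof -
  have "M \<bind> (\<lambda>_. N) = N"
    by (rule bind_const'[OF prob_space_axioms prob_space_imp_subprob_space[OF assms(1)]])
  then show ?thesis using assms by (simp add: kernels_def space_prob_algebra)
qed

lemma bary_measurable:
  assumes "k \<in> kernels M N"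
  shows "bary k \<in> borel_measurable M"
proof -
  have "(\<lambda>y::'b. y) \<in> borel_measurable borel" by simp
  from kernels_integral_measurable[OF assms this] show ?thesis unfolding bary_def .
qed

lemma bary_integrable:
  assumes "k \<in> kernels M N" "N \<in> P2"
  shows "integrable M (bary k)"
  using kernels_integral(1)[OF assms(1) P2D(5)[OF assms(2)]] unfolding bary_def .

lemma bary_jensen:
  fixes f :: "'b::euclidean_space \<Rightarrow> real"
  assumes k: "k \<in> kernels M N" and N: "N \<in> P2" and f: "convex_on UNIV f" "integrable N f"
  shows "AE x in M. f (bary k x) \<le> (\<integral>y. f y \<partial>k x)"
  using kernels_AE_integrable(1)[OF k P2D(5)[OF N]] kernels_AE_integrable(1)[OF k f(2)] AE_space
proof eventually_elim
  case (elim x)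
  show ?case unfolding bary_def by (rule jensen[OF kernels_prob[OF k elim(3)] elim(1,2) f(1)])
qed

text \<open>Conditional Jensen bounds the composition from above and a supporting affine function
  bounds it from below, both integrably.\<close>

lemma integrable_convex_bary:
  fixes f :: "'b::euclidean_space \<Rightarrow> real"
  assumes k: "k \<in> kernels M N" and N: "N \<in> P2" and f: "convex_on UNIV f" "integrable N f"
  shows "integrable M (\<lambda>x. f (bary k x))" "(\<integral>x. f (bary k x) \<partial>M) \<le> (\<integral>y. f y \<partial>N)"
proof -
  note [measurable] = bary_measurable[OF k] convex_on_UNIV_measurable[OF f(1)]
  obtain a where a: "\<And>y. f 0 + a \<bullet> (y - 0) \<le> f y" using convex_on_support[OF f(1), of 0] by blast
  show I: "integrable M (\<lambda>x. f (bary k x))"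
  proof (rule Bochner_Integration.integrable_bound)
    show "integrable M (\<lambda>x. \<bar>\<integral>y. f y \<partial>k x\<bar> + \<bar>f 0 + a \<bullet> bary k x\<bar>)"
      using kernels_integral(1)[OF k f(2)] bary_integrable[OF k N] by auto
    show "AE x in M. norm (f (bary k x)) \<le> norm (\<bar>\<integral>y. f y \<partial>k x\<bar> + \<bar>f 0 + a \<bullet> bary k x\<bar>)"
      using bary_jensen[OF k N f]
    proof eventually_elim
      case (elim x)
      then show ?case using a[of "bary k x"] by auto
    qed
  qed simp
  have "(\<integral>x. f (bary k x) \<partial>M) \<le> (\<integral>x. \<integral>y. f y \<partial>k x \<partial>M)"
    by (rule integral_mono_AE[OF I kernels_integral(1)[OF k f(2)] bary_jensen[OF k N f]])
  then show "(\<integral>x. f (bary k x) \<partial>M) \<le> (\<integral>y. f y \<partial>N)" by (simp add: kernels_integral(2)[OF k f(2)])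
qed

lemma bary_power2:
  fixes k :: "'a \<Rightarrow> 'b::euclidean_space measure"
  assumes k: "k \<in> kernels M N" and N: "N \<in> P2"
  shows "integrable M (\<lambda>x. (norm (bary k x))\<^sup>2)" "(\<integral>x. (norm (bary k x))\<^sup>2 \<partial>M) \<le> (\<integral>y. (norm y)\<^sup>2 \<partial>N)"
  using integrable_convex_bary[OF k N strictly_convex_convex_on[OF strictly_convex_norm_power2] P2D(4)[OF N]]
  by auto

lemma bary_mid_kernel:
  assumes "k \<in> kernels M N" "l \<in> kernels M N" "N \<in> P2"
  shows "AE x in M. bary (mid_kernel k l) x = (1/2) *\<^sub>R (bary k x + bary l x)"
  unfolding bary_def by (rule mid_kernel_integral[OF assms(1,2) P2D(5)[OF assms(3)]])

section \<open>Comparison of correlations for finitely many slopes\<close>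

lemma integral_finite_range:
  fixes g :: "'a \<Rightarrow> 'c::euclidean_space" and h :: "'c \<Rightarrow> real"
  assumes [measurable]: "g \<in> borel_measurable M" and fin: "finite (g ` space M)"
  shows "integrable M (\<lambda>x. h (g x))"
    and "(\<integral>x. h (g x) \<partial>M) = (\<Sum>a\<in>g ` space M. prob (g -` {a} \<inter> space M) * h a)"
proof -
  have s[measurable]: "g -` {a} \<inter> space M \<in> sets M" for a by measurable
  have eq: "h (g x) = (\<Sum>a\<in>g ` space M. indicator (g -` {a} \<inter> space M) x * h a)" if "x \<in> space M" for x
  proof -
    have "(\<Sum>a\<in>g ` space M. indicator (g -` {a} \<inter> space M) x * h a) = (\<Sum>a\<in>{g x}. indicator (g -` {a} \<inter> space M) x * h a)"
      using fin that by (intro sum.mono_neutral_right) (auto simp: indicator_def)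
    then show ?thesis using that by simp
  qed
  have I: "integrable M (\<lambda>x. indicator (g -` {a} \<inter> space M) x * h a)" for a
    using emeasure_finite by (intro integrable_mult_left integrable_real_indicator s) (auto simp: less_top[symmetric])
  show "integrable M (\<lambda>x. h (g x))"
    using I by (subst Bochner_Integration.integrable_cong[OF refl eq]) auto
  show "(\<integral>x. h (g x) \<partial>M) = (\<Sum>a\<in>g ` space M. prob (g -` {a} \<inter> space M) * h a)"
    using I by (subst Bochner_Integration.integral_cong[OF refl eq]) auto
qed

text \<open>The coupling with soft-max densities is optimal up to its entropy, which is at most the number
  of slopes; its dual potential can be replaced by a maximum of affine functions, which is convex
  and hence comparable under \<open>\<eta>\<close> and \<open>\<nu>\<close>.\<close>

lemma semidiscrete:
  fixes \<eta> \<nu> :: "'b::euclidean_space measure" and g :: "'a \<Rightarrow> 'b"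
  assumes \<eta>: "\<eta> \<in> P2" and \<nu>: "\<nu> \<in> P2" and cx: "\<eta> \<le>\<^sub>c\<^sub>x \<nu>" and q: "q \<in> kernels M \<eta>"
    and g[measurable]: "g \<in> borel_measurable M" and fin: "finite (g ` space M)"
  obtains k where "k \<in> kernels M \<nu>"
    "(\<integral>x. g x \<bullet> bary q x \<partial>M) \<le> (\<integral>x. g x \<bullet> bary k x \<partial>M) + card (g ` space M)"
proof -
  interpret \<nu>: prob_space \<nu> by (rule P2D[OF \<nu>])
  note [measurable_cong] = P2D(2)[OF \<nu>]
  let ?A = "g ` space M"
  define p where "p a = prob (g -` {a} \<inter> space M)" for a
  \<comment> \<open>The soft-max weights exist only for positive masses, and the densities below are
    divided by \<open>p a\<close>.\<close>
  define I where "I = {a \<in> ?A. 0 < p a}"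
  have fI: "finite I" using fin by (simp add: I_def)
  note fr = integral_finite_range[OF g fin, folded p_def]
  have sumI: "(\<Sum>a\<in>?A. p a * h a) = (\<Sum>a\<in>I. p a * h a)" for h :: "'b \<Rightarrow> real"
    using fin by (intro sum.mono_neutral_right) (auto simp: I_def p_def measure_nonneg less_le)
  have p1: "(\<Sum>a\<in>I. p a) = 1" using fr(2)[of "\<lambda>_. 1"] sumI[of "\<lambda>_. 1"] by (simp add: prob_space)
  then have Ine: "I \<noteq> {}" by auto
  have pp: "0 < p a" if "a \<in> I" for a using that by (simp add: I_def)
  have AEI: "AE x in M. g x \<in> I"
  proof -
    have "AE x in M. g x \<noteq> a" if "a \<in> ?A - I" for a
    proof -
      have "prob (g -` {a} \<inter> space M) = 0" using that by (auto simp: I_def p_def measure_nonneg less_le)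
      then have "AE x in M. x \<notin> g -` {a} \<inter> space M"
        by (subst (asm) prob_eq_0) auto
      with AE_space show ?thesis by eventually_elim auto
    qed
    then have "AE x in M. \<forall>a\<in>?A - I. g x \<noteq> a" using fin by (intro AE_finite_allI) auto
    with AE_space show ?thesis by eventually_elim auto
  qed
  obtain w where w: "\<And>a. a \<in> I \<Longrightarrow> (\<integral>y. softmax I w a y \<partial>\<nu>) = p a"
    using softmax_weights_exist[OF fI Ine P2D(1,2,5)[OF \<nu>] pp p1] by blast
  let ?s = "softmax I w"
  note s_meas[measurable] = softmax_measurable[OF fI Ine] 
  note s_pos = softmax_pos[OF fI Ine] and s_le1 = softmax_le_1[OF fI Ine]
  have Is: "integrable \<nu> (\<lambda>y. ?s a y * f y)" if "integrable \<nu> f" "a \<in> I" for f :: "'b \<Rightarrow> real" and a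
  proof (rule Bochner_Integration.integrable_bound[OF that(1)])
    show "AE y in \<nu>. norm (?s a y * f y) \<le> norm (f y)"
    proof (rule AE_I2)
      fix y
      have "\<bar>?s a y\<bar> * \<bar>f y\<bar> \<le> 1 * \<bar>f y\<bar>"
        using s_pos[of w a y] s_le1[OF that(2), of w y] by (intro mult_right_mono) auto
      then show "norm (?s a y * f y) \<le> norm (f y)" by (simp add: abs_mult)
    qed
    show "(\<lambda>y. ?s a y * f y) \<in> borel_measurable \<nu>"
      using borel_measurable_integrable[OF that(1)] by measurable
  qed
  have Is1: "integrable \<nu> (?s a)" if "a \<in> I" for a using Is[OF \<nu>.integrable_const[of 1] that] by simp
  \<comment> \<open>Given the slope \<open>a\<close>, the target law is \<nu> reweighted by
    \<open>softmax\<close>. Dividing by \<open>p a\<close> makes it a probability, and since the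
    soft-max weights sum to 1 the mixture is \<nu>. Slopes of mass 0 receive \<nu> merely as a
    default.\<close>
  define K where "K a = (if a \<in> I then density \<nu> (\<lambda>y. ennreal (?s a y / p a)) else \<nu>)" for a
  have Kint: "(\<integral>y. f y \<partial>K a) = (\<integral>y. (?s a y / p a) *\<^sub>R f y \<partial>\<nu>)"
    if "a \<in> I" "f \<in> borel_measurable borel" for a and f :: "'b \<Rightarrow> 'd::{banach, second_countable_topology}"
    unfolding K_def using that s_pos[of w a] pp[OF that(1)]
    by (simp, intro integral_density) (auto intro!: AE_I2 divide_nonneg_pos less_imp_le)
  have Kprob: "prob_space (K a)" for a
  proof (cases "a \<in> I")
    case True
    have "(\<integral>\<^sup>+y. ennreal (?s a y / p a) \<partial>\<nu>) = ennreal (\<integral>y. ?s a y / p a \<partial>\<nu>)"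
      using Is1[OF True] s_pos[of w a] pp[OF True]
      by (intro nn_integral_eq_integral AE_I2) (auto intro!: divide_nonneg_pos less_imp_le)
    also have "\<dots> = 1" using w[OF True] pp[OF True] by simp
    finally have "emeasure (K a) (space (K a)) = 1"
      using True by (simp add: K_def emeasure_density)
    then show ?thesis by (rule prob_spaceI)
  qed (simp add: K_def \<nu>.prob_space_axioms)
  have Ksets: "sets (K a) = sets borel" for a by (simp add: K_def P2D(2)[OF \<nu>])
  define k where "k x = K (g x)" for x
  have "g \<in> M \<rightarrow>\<^sub>M count_space ?A"
    by (subst measurable_count_space_eq2[OF fin]) auto
  moreover have "K \<in> count_space ?A \<rightarrow>\<^sub>M prob_algebra borel"
    by (auto simp: measurable_def space_prob_algebra Kprob Ksets)
  ultimately have km: "k \<in> M \<rightarrow>\<^sub>M prob_algebra borel" unfolding k_def by (rule measurable_compose)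
  then have kk: "k \<in> kernels M (M \<bind> k)" by (simp add: kernels_def)
  have "M \<bind> k = \<nu>"
  proof (rule measure_eqI)
    show s: "sets (M \<bind> k) = sets \<nu>" using kernels_sets_mixture[OF kk] P2D(2)[OF \<nu>] by simp
    fix B assume "B \<in> sets (M \<bind> k)"
    then have B[measurable]: "B \<in> sets borel" using s P2D(2)[OF \<nu>] by simp
    interpret k: prob_space "M \<bind> k" by (rule kernels_prob_mixture[OF kk])
    have indB: "integrable \<nu> (indicator B :: 'b \<Rightarrow> real)"
      using \<nu>.emeasure_finite P2D(2)[OF \<nu>] by (intro integrable_real_indicator) (auto simp: less_top[symmetric])
    have KB: "p a * measure (K a) B = (\<integral>y. ?s a y * indicator B y \<partial>\<nu>)" if "a \<in> I" for a
    proof -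
      interpret Ka: prob_space "K a" by (rule Kprob)
      have "measure (K a) B = (\<integral>y. indicator B y \<partial>K a)"
        using sets_eq_imp_space_eq[OF Ksets[of a]] by simp
      also have "\<dots> = (\<integral>y. (?s a y * indicator B y) / p a \<partial>\<nu>)"
        by (subst Kint[OF that]) auto
      finally show ?thesis using pp[OF that] by simp
    qed
    have "measure (M \<bind> k) B = (\<integral>x. measure (K (g x)) B \<partial>M)"
      using kernels_measure(2)[OF kk B] by (simp add: k_def)
    also have "\<dots> = (\<Sum>a\<in>I. \<integral>y. ?s a y * indicator B y \<partial>\<nu>)"
      unfolding fr(2)[of "\<lambda>a. measure (K a) B"] sumI by (intro sum.cong refl KB)
    also have "\<dots> = (\<integral>y. (\<Sum>a\<in>I. ?s a y) * indicator B y \<partial>\<nu>)"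
      unfolding sum_distrib_right by (intro Bochner_Integration.integral_sum[symmetric] Is indB)
    also have "\<dots> = measure \<nu> B"
      unfolding softmax_sum[OF fI Ine] using P2D(2,3)[OF \<nu>] by simp
    finally show "emeasure (M \<bind> k) B = emeasure \<nu> B"
      by (simp add: k.emeasure_eq_measure \<nu>.emeasure_eq_measure)
  qed
  with km have k: "k \<in> kernels M \<nu>" by (simp add: kernels_def)
  have Iin: "integrable \<nu> (\<lambda>y. a \<bullet> y)" "integrable \<eta> (\<lambda>y. a \<bullet> y)" for a
    using P2D(5)[OF \<nu>] P2D(5)[OF \<eta>] by auto
  have corrk: "(\<integral>x. g x \<bullet> bary k x \<partial>M) = (\<Sum>a\<in>I. \<integral>y. ?s a y * (a \<bullet> y) \<partial>\<nu>)"
  proof -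
    have "(\<integral>x. g x \<bullet> bary k x \<partial>M) = (\<Sum>a\<in>I. p a * (a \<bullet> (\<integral>y. y \<partial>K a)))"
      unfolding bary_def k_def using fr(2)[of "\<lambda>a. a \<bullet> (\<integral>y. y \<partial>K a)"] sumI by simp
    also have "\<dots> = (\<Sum>a\<in>I. \<integral>y. ?s a y * (a \<bullet> y) \<partial>\<nu>)"
    proof (rule sum.cong[OF refl])
      fix a assume a: "a \<in> I"
      have i: "integrable \<nu> (\<lambda>y. (?s a y / p a) *\<^sub>R y)"
      proof (rule Bochner_Integration.integrable_bound)
        show "integrable \<nu> (\<lambda>y. inverse (p a) *\<^sub>R y)" using P2D(5)[OF \<nu>] by simp
        show "AE y in \<nu>. norm ((?s a y / p a) *\<^sub>R y) \<le> norm (inverse (p a) *\<^sub>R y)"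
        proof (rule AE_I2)
          fix y
          have "\<bar>?s a y\<bar> * \<bar>inverse (p a)\<bar> * norm y \<le> 1 * \<bar>inverse (p a)\<bar> * norm y"
            using s_pos[of w a y] s_le1[OF a, of w y] by (intro mult_right_mono) auto
          then show "norm ((?s a y / p a) *\<^sub>R y) \<le> norm (inverse (p a) *\<^sub>R y)"
            by (simp add: divide_inverse abs_mult)
        qed
      qed (use P2D(2)[OF \<nu>] in measurable)
      have "a \<bullet> (\<integral>y. y \<partial>K a) = (\<integral>y. a \<bullet> ((?s a y / p a) *\<^sub>R y) \<partial>\<nu>)"
        unfolding Kint[OF a measurable_ident_sets[OF refl]] using i by (simp del: inner_scaleR_right)
      also have "\<dots> = (\<integral>y. (?s a y * (a \<bullet> y)) / p a \<partial>\<nu>)" by simp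
      finally show "p a * (a \<bullet> (\<integral>y. y \<partial>K a)) = (\<integral>y. ?s a y * (a \<bullet> y) \<partial>\<nu>)"
        using pp[OF a] by simp
    qed
    finally show ?thesis .
  qed
  \<comment> \<open>The convex order will be applied to this one function. It lies below
    \<open>lse I w\<close> by \<open>lse_ge\<close>.\<close>
  define \<psi> where "\<psi> y = Max ((\<lambda>a. a \<bullet> y - w a) ` I)" for y
  have \<psi>_ge: "a \<bullet> y - w a \<le> \<psi> y" if "a \<in> I" for a y
    unfolding \<psi>_def using that fI by (intro Max_ge) auto
  have \<psi>_at: "\<exists>a\<in>I. \<psi> y = a \<bullet> y - w a" for y
  proof -
    have "\<psi> y \<in> (\<lambda>a. a \<bullet> y - w a) ` I"
      unfolding \<psi>_def using fI Ine by (intro Max_in) auto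
    then show ?thesis by blast
  qed
  have \<psi>c: "convex_on UNIV \<psi>"
  proof (rule convex_on_of_support)
    fix x
    obtain a where a: "a \<in> I" "\<psi> x = a \<bullet> x - w a" using \<psi>_at by blast
    show "\<exists>a. \<forall>y. \<psi> x + a \<bullet> (y - x) \<le> \<psi> y"
      using \<psi>_ge[OF a(1)] a(2) by (intro exI[of _ a]) (auto simp: inner_diff_right)
  qed
  note \<psi>m[measurable] = convex_on_UNIV_measurable[OF \<psi>c]
  have \<psi>I: "integrable N \<psi>" if N: "N \<in> P2" for N
  proof (rule Bochner_Integration.integrable_bound)
    interpret N: prob_space N by (rule P2D[OF N])
    show "integrable N (\<lambda>y. \<Sum>a\<in>I. \<bar>a \<bullet> y - w a\<bar>)" using P2D(5)[OF N] by auto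
    show "AE y in N. norm (\<psi> y) \<le> norm (\<Sum>a\<in>I. \<bar>a \<bullet> y - w a\<bar>)"
    proof (rule AE_I2)
      fix y
      obtain a where a: "a \<in> I" "\<psi> y = a \<bullet> y - w a" using \<psi>_at by blast
      have "\<bar>a \<bullet> y - w a\<bar> \<le> (\<Sum>a\<in>I. \<bar>a \<bullet> y - w a\<bar>)" using a(1) fI by (intro member_le_sum) auto
      then show "norm (\<psi> y) \<le> norm (\<Sum>a\<in>I. \<bar>a \<bullet> y - w a\<bar>)" using a(2) by simp
    qed
    show "\<psi> \<in> borel_measurable N" using P2D(2)[OF N] by (simp cong: measurable_cong_sets)
  qed
  have lseI: "integrable \<nu> (lse I w)"
  proof (rule Bochner_Integration.integrable_bound)
    show "integrable \<nu> (\<lambda>y. ln (card I) + (\<Sum>a\<in>I. \<bar>a \<bullet> y - w a\<bar>))" using Iin by auto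
    show "AE y in \<nu>. norm (lse I w y) \<le> norm (ln (card I) + (\<Sum>a\<in>I. \<bar>a \<bullet> y - w a\<bar>))"
      using lse_bound[OF fI Ine, of w] by (intro AE_I2) (metis abs_ge_self order_trans real_norm_def)
    show "lse I w \<in> borel_measurable \<nu>" using lse_measurable[OF fI Ine] by simp
  qed
  \<comment> \<open>Weak duality: \<open>a \<bullet> y \<le> \<psi> y + w a\<close> for every slope
    \<open>a\<close>, integrated against \<open>q\<close>.\<close>
  have "(\<integral>x. g x \<bullet> bary q x \<partial>M) \<le> (\<integral>x. (\<integral>y. \<psi> y \<partial>q x) + w (g x) \<partial>M)"
  proof (rule integral_mono_AE)
    show "integrable M (\<lambda>x. g x \<bullet> bary q x)"
      by (rule integrable_inner_of_power2[OF g bary_measurable[OF q] fr(1) bary_power2(1)[OF q \<eta>]])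
    show "integrable M (\<lambda>x. (\<integral>y. \<psi> y \<partial>q x) + w (g x))"
      using kernels_integral(1)[OF q \<psi>I[OF \<eta>]] fr(1) by simp
    show "AE x in M. g x \<bullet> bary q x \<le> (\<integral>y. \<psi> y \<partial>q x) + w (g x)"
      using AEI kernels_AE_integrable(1)[OF q P2D(5)[OF \<eta>]] kernels_AE_integrable(1)[OF q \<psi>I[OF \<eta>]] AE_space
    proof eventually_elim
      case (elim x)
      interpret qx: prob_space "q x" by (rule kernels_prob[OF q elim(4)])
      have "(\<integral>y. g x \<bullet> y - w (g x) \<partial>q x) \<le> (\<integral>y. \<psi> y \<partial>q x)"
        using elim \<psi>_ge by (intro integral_mono) auto
      then show ?case using elim(2) by (simp add: bary_def qx.prob_space)
    qed
  qed
  also have "\<dots> = (\<integral>y. \<psi> y \<partial>\<eta>) + (\<Sum>a\<in>I. p a * w a)"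
    using kernels_integral[OF q \<psi>I[OF \<eta>]] fr sumI by simp
  also have "\<dots> \<le> (\<integral>y. lse I w y \<partial>\<nu>) + (\<Sum>a\<in>I. p a * w a)"
  proof -
    have "(\<integral>y. \<psi> y \<partial>\<eta>) \<le> (\<integral>y. \<psi> y \<partial>\<nu>)" by (rule convex_le_integral[OF cx \<psi>c \<psi>I[OF \<eta>] \<psi>I[OF \<nu>]])
    also have "\<dots> \<le> (\<integral>y. lse I w y \<partial>\<nu>)"
    proof (rule integral_mono[OF \<psi>I[OF \<nu>] lseI])
      show "\<psi> y \<le> lse I w y" for y using \<psi>_at[of y] lse_ge[OF fI Ine] by metis
    qed
    finally show ?thesis by simp
  qed
  \<comment> \<open>The soft-max weights enter as a partition of unity, and each \<open>p a\<close>
    is replaced by the integral it prescribes. Termwise, \<open>lse_softmax\<close> now leaves the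
    correlation of \<open>k\<close> plus an entropy.\<close>
  also have "\<dots> = (\<integral>y. (\<Sum>a\<in>I. ?s a y) * lse I w y \<partial>\<nu>) + (\<Sum>a\<in>I. (\<integral>y. ?s a y \<partial>\<nu>) * w a)"
    unfolding softmax_sum[OF fI Ine] using w by simp
  also have "\<dots> = (\<Sum>a\<in>I. (\<integral>y. ?s a y * lse I w y \<partial>\<nu>) + (\<integral>y. ?s a y * w a \<partial>\<nu>))"
    unfolding sum_distrib_right using Is[OF lseI] by (simp add: sum.distrib)
  also have "\<dots> \<le> (\<Sum>a\<in>I. (\<integral>y. ?s a y * (a \<bullet> y) \<partial>\<nu>) + 1)"
  proof (rule sum_mono)
    fix a assume a: "a \<in> I"
    have "(\<integral>y. ?s a y * lse I w y + ?s a y * w a \<partial>\<nu>) \<le> (\<integral>y. ?s a y * (a \<bullet> y) + 1 \<partial>\<nu>)"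
    proof (rule integral_mono)
      fix y
      \<comment> \<open>Multiplied by the density this bounds \<open>- s * ln s\<close> by
        \<open>1 - s\<close>, so each slope contributes at most 1 to the error.\<close>
      have "- ln (?s a y) \<le> 1 / ?s a y - 1"
        using ln_le_minus_one[of "1 / ?s a y"] s_pos[of w a y] by (simp add: ln_div)
      then have "?s a y * (- ln (?s a y)) \<le> ?s a y * (1 / ?s a y - 1)"
        using s_pos[of w a y] by (intro mult_left_mono) auto
      also have "\<dots> \<le> 1" using s_pos[of w a y] by (simp add: right_diff_distrib)
      finally have "?s a y * (- ln (?s a y)) \<le> 1" .
      then show "?s a y * lse I w y + ?s a y * w a \<le> ?s a y * (a \<bullet> y) + 1"
        by (simp add: lse_softmax[OF fI Ine, of w y a] algebra_simps)
    qed (use Is[OF lseI a] Is[OF Iin(1) a] Is1[OF a] in auto)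
    then show "(\<integral>y. ?s a y * lse I w y \<partial>\<nu>) + (\<integral>y. ?s a y * w a \<partial>\<nu>) \<le> (\<integral>y. ?s a y * (a \<bullet> y) \<partial>\<nu>) + 1"
      using Is[OF lseI a] Is[OF Iin(1) a] Is1[OF a] by (simp add: \<nu>.prob_space)
  qed
  also have "\<dots> = (\<integral>x. g x \<bullet> bary k x \<partial>M) + card I"
    unfolding corrk by (simp add: sum.distrib)
  also have "\<dots> \<le> (\<integral>x. g x \<bullet> bary k x \<partial>M) + card ?A"
    using card_mono[OF fin, of I] by (simp add: I_def)
  finally show ?thesis using k by (intro that)
qed

end

section \<open>Projection onto the barycenter maps and Strassen's theorem\<close>

lemma power2_norm_half_add_le:
  "(norm ((1/2) *\<^sub>R (u + v)))\<^sup>2 \<le> ((norm u)\<^sup>2 + (norm v)\<^sup>2) / 2" for u v :: "'a::real_inner"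
proof -
  have "0 \<le> (u - v) \<bullet> (u - v)" by simp
  then have "2 * (u \<bullet> v) \<le> u \<bullet> u + v \<bullet> v" by (simp add: inner_diff inner_commute)
  then show ?thesis unfolding power2_norm_eq_inner by (simp add: inner_add inner_commute field_simps)
qed

lemma inner_le_weighted:
  fixes u v :: "'a::real_inner"
  assumes "0 < d"
  shows "u \<bullet> v \<le> (norm u)\<^sup>2 / (2 * d) + d * (norm v)\<^sup>2 / 2"
proof -
  have "0 \<le> (u - d *\<^sub>R v) \<bullet> (u - d *\<^sub>R v)" by simp
  then have "2 * d * (u \<bullet> v) \<le> (norm u)\<^sup>2 + d * (d * (norm v)\<^sup>2)"
    unfolding power2_norm_eq_inner by (simp add: inner_diff inner_commute algebra_simps)
  then have "u \<bullet> v \<le> ((norm u)\<^sup>2 + d * (d * (norm v)\<^sup>2)) / (2 * d)"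
    using assms by (simp add: field_simps)
  also have "\<dots> = (norm u)\<^sup>2 / (2 * d) + d * (norm v)\<^sup>2 / 2"
    using assms by (simp add: add_divide_distrib)
  finally show ?thesis .
qed

lemma LIMSEQ_const_div: "(\<lambda>n. c / real (Suc n)) \<longlonglongrightarrow> 0"
  using tendsto_mult[OF tendsto_const[of c] LIMSEQ_inverse_real_of_nat] by (simp add: divide_inverse)

context prob_space
begin

text \<open>Only midpoints of kernels are available, so the first-order condition for the \<open>L\<^sup>2\<close> projection
  of \<open>T\<close> is obtained by moving from \<open>k0\<close> towards \<open>k\<close> by repeated bisection.\<close>

lemma bary_projection:
  fixes \<nu> :: "'b::euclidean_space measure" and T :: "'a \<Rightarrow> 'b"
  assumes \<nu>: "\<nu> \<in> P2" and T[measurable]: "T \<in> borel_measurable M" and T2: "integrable M (\<lambda>x. (norm (T x))\<^sup>2)"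
  obtains k0 where "k0 \<in> kernels M \<nu>"
    "\<And>k. k \<in> kernels M \<nu> \<Longrightarrow>
      (\<integral>x. (T x - bary k0 x) \<bullet> bary k x \<partial>M) \<le> (\<integral>x. (T x - bary k0 x) \<bullet> bary k0 x \<partial>M)"
proof -
  define F where "F k = (\<integral>x. (norm (T x - bary k x))\<^sup>2 \<partial>M)" for k
  note bm = bary_measurable and b2 = bary_power2(1)[OF _ \<nu>]
  have FI: "integrable M (\<lambda>x. (norm (T x - bary k x))\<^sup>2)" if "k \<in> kernels M \<nu>" for k
    by (rule integrable_norm_power2_diff[OF T bm[OF that] T2 b2[OF that]])
  obtain k0 where k0: "k0 \<in> kernels M \<nu>" and min: "\<And>k. k \<in> kernels M \<nu> \<Longrightarrow> F k0 \<le> F k"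
  proof (rule kernels_minimizer[of "kernels M \<nu>" \<nu> 0 F "\<lambda>y. y"])
    show "kernels M \<nu> \<noteq> {}" using const_kernel[OF P2D(1,2)[OF \<nu>]] by blast
    show "integrable \<nu> (\<lambda>y. y)" by (rule P2D(5)[OF \<nu>])
    show "0 \<le> F k" for k unfolding F_def by simp
    show "mid_kernel k l \<in> kernels M \<nu>" if "k \<in> kernels M \<nu>" "l \<in> kernels M \<nu>" for k l
      by (rule mid_kernel_kernels[OF that])
    show "F (mid_kernel k l) \<le> max (F k) (F l)" if kl: "k \<in> kernels M \<nu>" "l \<in> kernels M \<nu>" for k l
    proof -
      have "F (mid_kernel k l) \<le> (\<integral>x. ((norm (T x - bary k x))\<^sup>2 + (norm (T x - bary l x))\<^sup>2) / 2 \<partial>M)"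
        unfolding F_def
      proof (rule integral_mono_AE[OF FI[OF mid_kernel_kernels[OF kl]]])
        show "AE x in M. (norm (T x - bary (mid_kernel k l) x))\<^sup>2
            \<le> ((norm (T x - bary k x))\<^sup>2 + (norm (T x - bary l x))\<^sup>2) / 2"
          using bary_mid_kernel[OF kl \<nu>]
        proof eventually_elim
          case (elim x)
          have "T x = (1/2) *\<^sub>R (T x + T x)" by simp
          then have "T x - bary (mid_kernel k l) x = (1/2) *\<^sub>R ((T x - bary k x) + (T x - bary l x))"
            unfolding elim by (simp add: algebra_simps)
          then show ?case using power2_norm_half_add_le by metis
        qed
      qed (use FI kl in auto)
      also have "\<dots> = (F k + F l) / 2" unfolding F_def using FI kl by simp
      finally show ?thesis by simp
    qed
    fix kn k c
    assume kn: "\<And>n::nat. kn n \<in> kernels M \<nu>" and k: "k \<in> kernels M \<nu>"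
      and ae: "AE x in M. (\<lambda>n. \<integral>y. y \<partial>kn n x) \<longlonglongrightarrow> (\<integral>y. y \<partial>k x)"
      and c: "(\<lambda>n. F (kn n)) \<longlonglongrightarrow> c"
    have "F k \<le> c"
      unfolding F_def
    proof (rule integral_fatou(2)[OF FI[OF kn]])
      show "AE x in M. (\<lambda>n. (norm (T x - bary (kn n) x))\<^sup>2) \<longlonglongrightarrow> (norm (T x - bary k x))\<^sup>2"
        using ae unfolding bary_def by eventually_elim (intro tendsto_intros)
      show "(\<lambda>n. \<integral>x. (norm (T x - bary (kn n) x))\<^sup>2 \<partial>M) \<longlonglongrightarrow> c" using c unfolding F_def .
      show "(\<lambda>x. (norm (T x - bary k x))\<^sup>2) \<in> borel_measurable M"
        by (rule borel_measurable_integrable[OF FI[OF k]])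
    qed simp
    with k show "k \<in> kernels M \<nu> \<and> F k \<le> c" by simp
  qed auto
  define g where "g x = T x - bary k0 x" for x
  note [measurable] = bm[OF k0]
  have gm[measurable]: "g \<in> borel_measurable M" unfolding g_def by measurable
  have g2: "integrable M (\<lambda>x. (norm (g x))\<^sup>2)" using FI[OF k0] by (simp add: g_def)
  have "(\<integral>x. g x \<bullet> bary k x \<partial>M) \<le> (\<integral>x. g x \<bullet> bary k0 x \<partial>M)" if k: "k \<in> kernels M \<nu>" for k
  proof -
    note [measurable] = bm[OF k]
    define d where "d x = bary k x - bary k0 x" for x
    have dm[measurable]: "d \<in> borel_measurable M" unfolding d_def by measurable
    have d2: "integrable M (\<lambda>x. (norm (d x))\<^sup>2)"
      unfolding d_def by (rule integrable_norm_power2_diff[OF bm[OF k] bm[OF k0] b2[OF k] b2[OF k0]])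
    have gd: "integrable M (\<lambda>x. g x \<bullet> d x)" by (rule integrable_inner_of_power2[OF gm dm g2 d2])
    \<comment> \<open>Each midpoint with \<open>k0\<close> halves the displacement, so the
      barycenter map of \<open>kk n\<close> is that of \<open>k0\<close> plus
      \<open>(1/2) ^ n\<close> times \<open>d\<close>.\<close>
    define kk where "kk n = ((\<lambda>l. mid_kernel l k0) ^^ n) k" for n
    have kk: "kk n \<in> kernels M \<nu> \<and> (AE x in M. bary (kk n) x = bary k0 x + (1/2) ^ n *\<^sub>R d x)" for n
    proof (induction n)
      case 0
      then show ?case using k by (simp add: kk_def d_def)
    next
      case (Suc n)
      then have K: "kk n \<in> kernels M \<nu>" and A: "AE x in M. bary (kk n) x = bary k0 x + (1/2) ^ n *\<^sub>R d x" by auto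
      have e: "kk (Suc n) = mid_kernel (kk n) k0" by (simp add: kk_def)
      have "AE x in M. bary (kk (Suc n)) x = bary k0 x + (1/2) ^ Suc n *\<^sub>R d x"
        using bary_mid_kernel[OF K k0 \<nu>] A unfolding e
      proof eventually_elim
        case (elim x)
        have "bary k0 x = (1/2) *\<^sub>R (bary k0 x + bary k0 x)" by simp
        then show ?case unfolding elim by (simp add: scaleR_add_right algebra_simps)
      qed
      then show ?case using mid_kernel_kernels[OF K k0] e by simp
    qed
    \<comment> \<open>Minimality of \<open>k0\<close> against \<open>kk n\<close> reads
      \<open>2 * t * <g, d> \<le> t\<^sup>2 * |d|\<^sup>2\<close> with \<open>t = (1/2) ^ n\<close>.
      One factor \<open>t\<close> cancels, and the rest tends to 0.\<close>
    have bound: "(\<integral>x. g x \<bullet> d x \<partial>M) \<le> (1/2) ^ n * ((\<integral>x. (norm (d x))\<^sup>2 \<partial>M) / 2)" for n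
    proof -
      let ?t = "(1/2::real) ^ n"
      have "F (kk n) = (\<integral>x. (norm (g x))\<^sup>2 - 2 * ?t * (g x \<bullet> d x) + ?t * (?t * (norm (d x))\<^sup>2) \<partial>M)"
        unfolding F_def
      proof (rule integral_cong_AE)
        show "AE x in M. (norm (T x - bary (kk n) x))\<^sup>2 = (norm (g x))\<^sup>2 - 2 * ?t * (g x \<bullet> d x) + ?t * (?t * (norm (d x))\<^sup>2)"
          using kk[of n, THEN conjunct2]
        proof eventually_elim
          case (elim x)
          have eq: "T x - bary (kk n) x = g x - ?t *\<^sub>R d x" unfolding elim g_def by simp
          show ?case
            unfolding eq power2_norm_eq_inner by (simp add: inner_diff inner_commute algebra_simps)
        qed
      qed (use bm[OF kk[THEN conjunct1]] in measurable)
      also have "\<dots> = F k0 - 2 * ?t * (\<integral>x. g x \<bullet> d x \<partial>M) + ?t * (?t * (\<integral>x. (norm (d x))\<^sup>2 \<partial>M))"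
        using g2 gd d2 by (simp add: F_def g_def)
      finally have "2 * ?t * (\<integral>x. g x \<bullet> d x \<partial>M) \<le> ?t * (?t * (\<integral>x. (norm (d x))\<^sup>2 \<partial>M))"
        using min[OF kk[THEN conjunct1], of n] by simp
      then have "?t * (2 * (\<integral>x. g x \<bullet> d x \<partial>M)) \<le> ?t * (?t * (\<integral>x. (norm (d x))\<^sup>2 \<partial>M))"
        by (simp only: mult_ac)
      then have "2 * (\<integral>x. g x \<bullet> d x \<partial>M) \<le> ?t * (\<integral>x. (norm (d x))\<^sup>2 \<partial>M)"
        by (rule mult_left_le_imp_le) simp
      then show ?thesis by simp
    qed
    have "(\<lambda>n. (1/2::real) ^ n * ((\<integral>x. (norm (d x))\<^sup>2 \<partial>M) / 2)) \<longlonglongrightarrow> 0 * ((\<integral>x. (norm (d x))\<^sup>2 \<partial>M) / 2)"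
      by (intro tendsto_mult tendsto_const LIMSEQ_power_zero) simp
    from LIMSEQ_le_const[OF this] bound have "(\<integral>x. g x \<bullet> d x \<partial>M) \<le> 0 * ((\<integral>x. (norm (d x))\<^sup>2 \<partial>M) / 2)"
      by blast
    then have "(\<integral>x. g x \<bullet> d x \<partial>M) \<le> 0" by simp
    moreover have "(\<integral>x. g x \<bullet> d x \<partial>M) = (\<integral>x. g x \<bullet> bary k x \<partial>M) - (\<integral>x. g x \<bullet> bary k0 x \<partial>M)"
      unfolding d_def inner_diff_right
      by (rule Bochner_Integration.integral_diff[OF integrable_inner_of_power2[OF gm bm[OF k] g2 b2[OF k]]
            integrable_inner_of_power2[OF gm bm[OF k0] g2 b2[OF k0]]])
    ultimately show ?thesis by simp
  qed
  then show ?thesis using k0 unfolding g_def by (intro that)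
qed

text \<open>The part of Strassen's theorem that is needed. The defect \<open>g\<close> of the projection of \<open>bary q\<close>
  vanishes, because \<open>semidiscrete\<close>, applied to large multiples of simple approximations of \<open>g\<close>,
  contradicts the first-order condition otherwise.\<close>

lemma barycenter_lift:
  fixes \<eta> \<nu> :: "'b::euclidean_space measure"
  assumes \<eta>: "\<eta> \<in> P2" and \<nu>: "\<nu> \<in> P2" and cx: "\<eta> \<le>\<^sub>c\<^sub>x \<nu>" and q: "q \<in> kernels M \<eta>"
  obtains k where "k \<in> kernels M \<nu>" "AE x in M. bary k x = bary q x"
proof -
  define T where "T = bary q"
  have Tm[measurable]: "T \<in> borel_measurable M" unfolding T_def by (rule bary_measurable[OF q])
  have T2: "integrable M (\<lambda>x. (norm (T x))\<^sup>2)" unfolding T_def by (rule bary_power2(1)[OF q \<eta>])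
  obtain k0 where k0: "k0 \<in> kernels M \<nu>"
    and vi: "\<And>k. k \<in> kernels M \<nu> \<Longrightarrow>
      (\<integral>x. (T x - bary k0 x) \<bullet> bary k x \<partial>M) \<le> (\<integral>x. (T x - bary k0 x) \<bullet> bary k0 x \<partial>M)"
    using bary_projection[OF \<nu> Tm T2] by blast
  note bm = bary_measurable and b2 = bary_power2(1)[OF _ \<nu>]
  define g where "g x = T x - bary k0 x" for x
  note [measurable] = bm[OF k0]
  have gm[measurable]: "g \<in> borel_measurable M" unfolding g_def by measurable
  have g2: "integrable M (\<lambda>x. (norm (g x))\<^sup>2)"
    unfolding g_def by (rule integrable_norm_power2_diff[OF Tm bm[OF k0] T2 b2[OF k0]])
  have gT: "integrable M (\<lambda>x. g x \<bullet> T x)" by (rule integrable_inner_of_power2[OF gm Tm g2 T2])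
  have gb: "integrable M (\<lambda>x. g x \<bullet> bary k x)" if "k \<in> kernels M \<nu>" for k
    by (rule integrable_inner_of_power2[OF gm bm[OF that] g2 b2[OF that]])
  obtain s where s: "\<And>i::nat. simple_function M (s i)"
    "\<And>x. x \<in> space M \<Longrightarrow> (\<lambda>i. s i x) \<longlonglongrightarrow> g x"
    "\<And>i x. x \<in> space M \<Longrightarrow> norm (s i x) \<le> 2 * norm (g x)"
    using borel_measurable_implies_sequence_metric[OF gm, of 0] unfolding norm_conv_dist by blast
  have sm[measurable]: "s i \<in> borel_measurable M" for i by (rule borel_measurable_simple_function[OF s(1)])
  have sfin: "finite (s i ` space M)" for i by (rule simple_functionD(1)[OF s(1)])
  have s2: "integrable M (\<lambda>x. (norm (s i x))\<^sup>2)" for i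
    by (rule integral_finite_range(1)[OF sm sfin])
  have sg2: "integrable M (\<lambda>x. (norm (s i x - g x))\<^sup>2)" for i
    by (rule integrable_norm_power2_diff[OF sm gm s2 g2])
  define e where "e i = (\<integral>x. (norm (s i x - g x))\<^sup>2 \<partial>M)" for i
  define m2 where "m2 = (\<integral>y. (norm y)\<^sup>2 \<partial>\<nu>)"
  define A where "A = (\<integral>x. g x \<bullet> bary k0 x \<partial>M)"
  \<comment> \<open>Young's inequality with parameter \<open>d\<close> pays for replacing
    \<open>g\<close> by \<open>s i\<close>. The price is uniform in \<open>k\<close>, since by
    Jensen every barycenter map has second moment at most \<open>m2\<close>.\<close>
  have test: "(\<integral>x. s i x \<bullet> bary k x \<partial>M) \<le> A + e i / (2 * d) + d * m2 / 2"
    if k: "k \<in> kernels M \<nu>" and d: "0 < d" for k i d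
  proof -
    have "(\<integral>x. s i x \<bullet> bary k x \<partial>M) \<le> (\<integral>x. g x \<bullet> bary k x + ((norm (s i x - g x))\<^sup>2 / (2 * d) + d * (norm (bary k x))\<^sup>2 / 2) \<partial>M)"
    proof (rule integral_mono)
      show "integrable M (\<lambda>x. s i x \<bullet> bary k x)"
        by (rule integrable_inner_of_power2[OF sm bm[OF k] s2 b2[OF k]])
      show "integrable M (\<lambda>x. g x \<bullet> bary k x + ((norm (s i x - g x))\<^sup>2 / (2 * d) + d * (norm (bary k x))\<^sup>2 / 2))"
        using gb[OF k] sg2 b2[OF k] by auto
      show "s i x \<bullet> bary k x \<le> g x \<bullet> bary k x + ((norm (s i x - g x))\<^sup>2 / (2 * d) + d * (norm (bary k x))\<^sup>2 / 2)" for x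
        using inner_le_weighted[OF d, of "s i x - g x" "bary k x"] by (simp add: inner_diff_left)
    qed
    also have "\<dots> = (\<integral>x. g x \<bullet> bary k x \<partial>M) + (e i / (2 * d) + d * (\<integral>x. (norm (bary k x))\<^sup>2 \<partial>M) / 2)"
      unfolding e_def using gb[OF k] sg2 b2[OF k] by simp
    also have "\<dots> \<le> A + (e i / (2 * d) + d * m2 / 2)"
      using vi[OF k] bary_power2(2)[OF k \<nu>] d unfolding A_def g_def m2_def
      by (intro add_mono order_refl divide_right_mono mult_left_mono) auto
    finally show ?thesis by simp
  qed
  \<comment> \<open>The slopes are multiplied by \<open>Suc n\<close>, which does not increase their
    number. After division by \<open>Suc n\<close> the entropy error is at most
    \<open>?c / real (Suc n)\<close>.\<close>
  have sT: "(\<integral>x. s i x \<bullet> T x \<partial>M) \<le> A + e i / (2 * d) + d * m2 / 2" if d: "0 < d" for i d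
  proof -
    let ?c = "real (card (s i ` space M))"
    have "(\<integral>x. s i x \<bullet> T x \<partial>M) \<le> A + e i / (2 * d) + d * m2 / 2 + ?c / real (Suc n)" for n
    proof -
      let ?l = "real (Suc n)"
      have fin: "finite ((\<lambda>x. ?l *\<^sub>R s i x) ` space M)"
        using finite_imageI[OF sfin[of i], of "\<lambda>a. ?l *\<^sub>R a"] by (simp add: image_image)
      have card: "card ((\<lambda>x. ?l *\<^sub>R s i x) ` space M) \<le> card (s i ` space M)"
        using card_image_le[OF sfin[of i], of "\<lambda>a. ?l *\<^sub>R a"] by (simp add: image_image)
      have lm: "(\<lambda>x. ?l *\<^sub>R s i x) \<in> borel_measurable M" by measurable
      obtain k where k: "k \<in> kernels M \<nu>" and le: "(\<integral>x. (?l *\<^sub>R s i x) \<bullet> bary q x \<partial>M)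
          \<le> (\<integral>x. (?l *\<^sub>R s i x) \<bullet> bary k x \<partial>M) + real (card ((\<lambda>x. ?l *\<^sub>R s i x) ` space M))"
        by (rule semidiscrete[OF \<eta> \<nu> cx q lm fin])
      have "?l * (\<integral>x. s i x \<bullet> T x \<partial>M) \<le> ?l * (\<integral>x. s i x \<bullet> bary k x \<partial>M) + ?c"
        using le card unfolding inner_scaleR_left T_def by simp
      also have "\<dots> \<le> ?l * (A + e i / (2 * d) + d * m2 / 2) + ?c"
        using test[OF k d] by (intro add_right_mono mult_left_mono) auto
      also have "\<dots> = ?l * (A + e i / (2 * d) + d * m2 / 2 + ?c / ?l)"
        by (simp add: distrib_left)
      finally show ?thesis by (rule mult_left_le_imp_le) simp
    qed
    moreover have "(\<lambda>n. A + e i / (2 * d) + d * m2 / 2 + ?c / real (Suc n)) \<longlonglongrightarrow> A + e i / (2 * d) + d * m2 / 2 + 0"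
      by (intro tendsto_add tendsto_const LIMSEQ_const_div)
    ultimately show ?thesis using LIMSEQ_le_const by fastforce
  qed
  have nT: "norm (g x) * norm (T x) \<le> (norm (g x))\<^sup>2 + (norm (T x))\<^sup>2" for x
  proof -
    have "2 * (norm (g x) * norm (T x)) \<le> (norm (g x))\<^sup>2 + (norm (T x))\<^sup>2"
      using zero_le_power2[of "norm (g x) - norm (T x)"] unfolding power2_diff by simp
    moreover have "0 \<le> norm (g x) * norm (T x)" by simp
    ultimately show ?thesis by linarith
  qed
  have lim1: "(\<lambda>i. \<integral>x. s i x \<bullet> T x \<partial>M) \<longlonglongrightarrow> (\<integral>x. g x \<bullet> T x \<partial>M)"
  proof (rule integral_dominated_convergence[where w="\<lambda>x. 2 * ((norm (g x))\<^sup>2 + (norm (T x))\<^sup>2)"])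
    show "AE x in M. (\<lambda>i. s i x \<bullet> T x) \<longlonglongrightarrow> g x \<bullet> T x"
      using s(2) by (intro AE_I2 tendsto_inner tendsto_const)
    show "AE x in M. norm (s i x \<bullet> T x) \<le> 2 * ((norm (g x))\<^sup>2 + (norm (T x))\<^sup>2)" for i
    proof (rule AE_I2)
      fix x assume x: "x \<in> space M"
      have "norm (s i x \<bullet> T x) \<le> norm (s i x) * norm (T x)" using Cauchy_Schwarz_ineq2 by simp
      also have "\<dots> \<le> 2 * norm (g x) * norm (T x)" using s(3)[OF x] by (intro mult_right_mono) auto
      also have "\<dots> \<le> 2 * ((norm (g x))\<^sup>2 + (norm (T x))\<^sup>2)" using nT[of x] by simp
      finally show "norm (s i x \<bullet> T x) \<le> 2 * ((norm (g x))\<^sup>2 + (norm (T x))\<^sup>2)" .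
    qed
    show "integrable M (\<lambda>x. 2 * ((norm (g x))\<^sup>2 + (norm (T x))\<^sup>2))" using g2 T2 by simp
  qed simp_all
  have lim2: "e \<longlonglongrightarrow> 0"
  proof -
    have "(\<lambda>i. \<integral>x. (norm (s i x - g x))\<^sup>2 \<partial>M) \<longlonglongrightarrow> (\<integral>x. 0 \<partial>M)"
    proof (rule integral_dominated_convergence[where w="\<lambda>x. 9 * (norm (g x))\<^sup>2"])
      show "AE x in M. (\<lambda>i. (norm (s i x - g x))\<^sup>2) \<longlonglongrightarrow> 0"
      proof (rule AE_I2)
        fix x assume "x \<in> space M"
        then have "(\<lambda>i. (norm (s i x - g x))\<^sup>2) \<longlonglongrightarrow> (norm (g x - g x))\<^sup>2"
          by (intro tendsto_power tendsto_norm tendsto_diff tendsto_const s(2))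
        then show "(\<lambda>i. (norm (s i x - g x))\<^sup>2) \<longlonglongrightarrow> 0" by simp
      qed
      show "AE x in M. norm ((norm (s i x - g x))\<^sup>2) \<le> 9 * (norm (g x))\<^sup>2" for i
      proof (rule AE_I2)
        fix x assume "x \<in> space M"
        then have "norm (s i x - g x) \<le> 3 * norm (g x)"
          using s(3)[of x i] norm_triangle_ineq4[of "s i x" "g x"] by simp
        then have "(norm (s i x - g x))\<^sup>2 \<le> (3 * norm (g x))\<^sup>2" by (intro power_mono) auto
        then show "norm ((norm (s i x - g x))\<^sup>2) \<le> 9 * (norm (g x))\<^sup>2" by (simp add: power_mult_distrib)
      qed
      show "integrable M (\<lambda>x. 9 * (norm (g x))\<^sup>2)" using g2 by simp
    qed simp_all
    then show ?thesis unfolding e_def[abs_def] by simp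
  qed
  \<comment> \<open>The order of the limits matters: \<open>i\<close> goes to infinity at fixed
    \<open>d\<close>, where \<open>e i / (2 * d)\<close> vanishes, and only then \<open>d\<close>
    goes to 0.\<close>
  have "(\<integral>x. g x \<bullet> T x \<partial>M) \<le> A + d * m2 / 2" if d: "0 < d" for d
  proof (rule LIMSEQ_le[OF lim1])
    have "(\<lambda>i. A + e i / (2 * d) + d * m2 / 2) \<longlonglongrightarrow> A + 0 / (2 * d) + d * m2 / 2"
      using d by (intro tendsto_add tendsto_divide tendsto_const lim2) auto
    then show "(\<lambda>i. A + e i / (2 * d) + d * m2 / 2) \<longlonglongrightarrow> A + d * m2 / 2" by simp
  qed (use sT[OF d] in blast)
  from this[of "1 / real (Suc n)" for n]
  have "(\<integral>x. g x \<bullet> T x \<partial>M) \<le> A + (m2 / 2) / real (Suc n)" for n by (simp add: field_simps)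
  moreover have "(\<lambda>n. A + (m2 / 2) / real (Suc n)) \<longlonglongrightarrow> A + 0"
    by (intro tendsto_add tendsto_const LIMSEQ_const_div)
  ultimately have le: "(\<integral>x. g x \<bullet> T x \<partial>M) \<le> A" using LIMSEQ_le_const by fastforce
  \<comment> \<open>Since \<open>g\<close> is \<open>T\<close> minus the projection, its squared
    norm is the difference of the two correlations just compared.\<close>
  have "(\<integral>x. (norm (g x))\<^sup>2 \<partial>M) = (\<integral>x. g x \<bullet> T x - g x \<bullet> bary k0 x \<partial>M)"
    by (intro Bochner_Integration.integral_cong) (simp_all add: power2_norm_eq_inner g_def inner_diff_right)
  also have "\<dots> \<le> 0" using le gT gb[OF k0] by (simp add: A_def)
  finally have "(\<integral>x. (norm (g x))\<^sup>2 \<partial>M) = 0" by (simp add: order.antisym)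
  then have "AE x in M. (norm (g x))\<^sup>2 = 0"
    using integral_nonneg_eq_0_iff_AE[OF g2] by simp
  then have "AE x in M. bary k0 x = bary q x"
    by eventually_elim (simp add: g_def T_def)
  with k0 show ?thesis by (rule that)
qed

end

section \<open>Transport cost and barycenters\<close>

text \<open>An affine minorant is integrable under every member of \<open>P2\<close>. So integrals
  of convex functions make sense there and can be infinite only upwards.\<close>

lemma convex_neg_part_finite:
  fixes N :: "'a::euclidean_space measure"
  assumes N: "N \<in> P2" and f: "convex_on UNIV f"
  shows "(\<integral>\<^sup>+x. ennreal (- f x) \<partial>N) < \<infinity>"
proof -
  interpret prob_space N by (rule P2D[OF N])
  obtain a where a: "\<And>y. f 0 + a \<bullet> (y - 0) \<le> f y" using convex_on_support[OF f, of 0] by blast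
  have "(\<integral>\<^sup>+x. ennreal (- f x) \<partial>N) \<le> (\<integral>\<^sup>+x. ennreal (norm (f 0 + a \<bullet> x)) \<partial>N)"
  proof (intro nn_integral_mono ennreal_leI)
    show "- f x \<le> norm (f 0 + a \<bullet> x)" for x using a[of x] by simp
  qed
  also have "\<dots> < \<infinity>"
  proof -
    have "integrable N (\<lambda>x. f 0 + a \<bullet> x)"
      using P2D(5)[OF N] by (intro Bochner_Integration.integrable_add integrable_const integrable_inner_right)
    then show ?thesis unfolding integrable_iff_bounded by blast
  qed
  finally show ?thesis .
qed

lemma convex_makes_sense: "N \<in> P2 \<Longrightarrow> convex_on UNIV f \<Longrightarrow> integral_makes_sense N f"
  unfolding integral_makes_sense_def using convex_neg_part_finite by blast

lemma convex_integrable_of_finite: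
  fixes N :: "'a::euclidean_space measure"
  assumes N: "N \<in> P2" and f: "convex_on UNIV f" and fin: "ereal_integral N f < \<infinity>"
  shows "integrable N f"
proof -
  have "(\<integral>\<^sup>+x. ennreal (f x) \<partial>N) \<noteq> \<infinity>"
  proof
    assume "(\<integral>\<^sup>+x. ennreal (f x) \<partial>N) = \<infinity>"
    then have "ereal_integral N f = \<infinity>" unfolding ereal_integral_def by simp
    with fin show False by simp
  qed
  moreover have "f \<in> borel_measurable N"
    using convex_on_UNIV_measurable[OF f] P2D(2)[OF N] by (simp cong: measurable_cong_sets)
  ultimately show ?thesis
    using convex_neg_part_finite[OF N f] unfolding real_integrable_def by auto
qed

text \<open>The convex order is conditional Jensen for integrable \<open>f\<close>; for any other
  convex \<open>f\<close> the right-hand side is infinite.\<close>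

lemma bary_pushforward:
  fixes \<mu> \<nu> :: "'a::euclidean_space measure"
  assumes \<mu>: "\<mu> \<in> P2" and \<nu>: "\<nu> \<in> P2" and k: "k \<in> kernels \<mu> \<nu>"
  shows "bary k \<in> borel_measurable borel" "distr \<mu> borel (bary k) \<in> P2" "distr \<mu> borel (bary k) \<le>\<^sub>c\<^sub>x \<nu>"
proof -
  interpret prob_space \<mu> by (rule P2D[OF \<mu>])
  have bm[measurable]: "bary k \<in> borel_measurable \<mu>" by (rule bary_measurable[OF k])
  then show "bary k \<in> borel_measurable borel" using P2D(2)[OF \<mu>] by (simp cong: measurable_cong_sets)
  have "integrable (distr \<mu> borel (bary k)) (\<lambda>x. (norm x)\<^sup>2)"
    using bary_power2(1)[OF k \<nu>] by (subst integrable_distr_eq) auto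
  then show P: "distr \<mu> borel (bary k) \<in> P2"
    unfolding P2_def using prob_space_distr[OF bm] by simp
  show "distr \<mu> borel (bary k) \<le>\<^sub>c\<^sub>x \<nu>"
    unfolding convex_le_def
  proof (intro allI impI)
    fix f :: "'a \<Rightarrow> real" assume f: "convex_on UNIV f"
    show "ereal_integral (distr \<mu> borel (bary k)) f \<le> ereal_integral \<nu> f"
    proof (cases "ereal_integral \<nu> f < \<infinity>")
      case True
      have I: "integrable \<nu> f" by (rule convex_integrable_of_finite[OF \<nu> f True])
      have fm: "f \<in> borel_measurable borel" by (rule convex_on_UNIV_measurable[OF f])
      have "integrable (distr \<mu> borel (bary k)) f"
        using integrable_convex_bary(1)[OF k \<nu> f I] fm by (subst integrable_distr_eq) auto
      moreover have "(\<integral>x. f x \<partial>distr \<mu> borel (bary k)) = (\<integral>x. f (bary k x) \<partial>\<mu>)"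
        using fm by (subst integral_distr) auto
      ultimately show ?thesis
        using integrable_convex_bary(2)[OF k \<nu> f I] by (simp add: ereal_integral_eq I)
    qed (simp add: not_less)
  qed
qed

lemma transport_cost_eq:
  fixes \<mu> \<nu> :: "'a::euclidean_space measure"
  assumes \<mu>: "\<mu> \<in> P2" and \<nu>: "\<nu> \<in> P2" and \<pi>: "\<pi> \<in> couplings \<mu> \<nu>"
  shows "integrable \<pi> (\<lambda>z. fst z \<bullet> snd z)"
    and "transport_cost \<pi> = (\<integral>x. (norm x)\<^sup>2 \<partial>\<mu>) + (\<integral>y. (norm y)\<^sup>2 \<partial>\<nu>) - 2 * (\<integral>z. fst z \<bullet> snd z \<partial>\<pi>)"
proof -
  note C = couplingsD[OF \<pi>]
  have sets: "sets \<pi> = sets (borel \<Otimes>\<^sub>M borel)" unfolding borel_prod by (rule C(1))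
  have f[measurable]: "fst \<in> \<pi> \<rightarrow>\<^sub>M borel" and s[measurable]: "snd \<in> \<pi> \<rightarrow>\<^sub>M borel"
    using measurable_fst measurable_snd by (simp_all cong: measurable_cong_sets add: sets)
  have n: "(\<lambda>x::'a. (norm x)\<^sup>2) \<in> borel_measurable borel" by measurable
  have I1: "integrable \<pi> (\<lambda>z. (norm (fst z))\<^sup>2)" and I2: "integrable \<pi> (\<lambda>z. (norm (snd z))\<^sup>2)"
    using integrable_distr_eq[OF f n] integrable_distr_eq[OF s n] C(3,4) P2D(4)[OF \<mu>] P2D(4)[OF \<nu>] by simp_all
  show I3: "integrable \<pi> (\<lambda>z. fst z \<bullet> snd z)"
    by (rule integrable_inner_of_power2[OF f s I1 I2])
  have "transport_cost \<pi> = (\<integral>z. (norm (fst z))\<^sup>2 + (norm (snd z))\<^sup>2 - 2 * (fst z \<bullet> snd z) \<partial>\<pi>)"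
    unfolding transport_cost_def
    by (intro Bochner_Integration.integral_cong)
      (auto simp: power2_norm_eq_inner inner_diff inner_commute split: prod.splits)
  also have "\<dots> = (\<integral>z. (norm (fst z))\<^sup>2 \<partial>\<pi>) + (\<integral>z. (norm (snd z))\<^sup>2 \<partial>\<pi>) - 2 * (\<integral>z. fst z \<bullet> snd z \<partial>\<pi>)"
    using I1 I2 I3 by simp
  finally show "transport_cost \<pi> = (\<integral>x. (norm x)\<^sup>2 \<partial>\<mu>) + (\<integral>y. (norm y)\<^sup>2 \<partial>\<nu>) - 2 * (\<integral>z. fst z \<bullet> snd z \<partial>\<pi>)"
    using integral_distr[OF f n] integral_distr[OF s n] C(3,4) by simp
qed

lemma W2sq_le: "\<pi> \<in> couplings \<mu> \<nu> \<Longrightarrow> W2sq \<mu> \<nu> \<le> transport_cost \<pi>"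
  unfolding W2sq_def
  by (intro cINF_lower bdd_belowI[of _ 0]) (auto simp: transport_cost_def intro!: integral_nonneg_AE)

lemma Pair_measurable_borel:
  "Pair x \<in> (borel :: 'a::euclidean_space measure) \<rightarrow>\<^sub>M (borel :: ('a \<times> 'a) measure)"
  unfolding borel_prod[symmetric] by simp

lemma kernel_cost:
  fixes \<mu> \<nu> :: "'a::euclidean_space measure"
  assumes \<mu>: "\<mu> \<in> P2" and \<nu>: "\<nu> \<in> P2" and k: "k \<in> kernels \<mu> \<nu>"
  shows "transport_cost (kernel_prod \<mu> k)
    = (\<integral>x. (norm x)\<^sup>2 \<partial>\<mu>) + (\<integral>y. (norm y)\<^sup>2 \<partial>\<nu>) - 2 * (\<integral>x. x \<bullet> bary k x \<partial>\<mu>)"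
proof -
  interpret prob_space \<mu> by (rule P2D[OF \<mu>])
  have kp: "kernel_prod \<mu> k \<in> couplings \<mu> \<nu>" by (rule kernel_prod_couplings[OF P2D(1,2)[OF \<mu>] k])
  note kk = kernel_prod_kernels[OF P2D(2)[OF \<mu>] k]
  have m: "(\<lambda>z. fst z \<bullet> snd z) \<in> borel_measurable (borel :: ('a \<times> 'a) measure)"
    unfolding borel_prod[symmetric] by measurable
  have "(\<integral>z. fst z \<bullet> snd z \<partial>kernel_prod \<mu> k)
      = (\<integral>x. \<integral>z. fst z \<bullet> snd z \<partial>distr (k x) borel (Pair x) \<partial>\<mu>)"
    by (rule kernels_integral(2)[OF kk transport_cost_eq(1)[OF \<mu> \<nu> kp], symmetric])
  also have "\<dots> = (\<integral>x. x \<bullet> bary k x \<partial>\<mu>)"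
  proof (rule integral_cong_AE)
    show "(\<lambda>x. \<integral>z. fst z \<bullet> snd z \<partial>distr (k x) borel (Pair x)) \<in> borel_measurable \<mu>"
      by (rule kernels_integral_measurable[OF kk m])
    have "(\<lambda>x. x) \<in> borel_measurable \<mu>" by (rule measurable_ident_sets[OF P2D(2)[OF \<mu>]])
    then show "(\<lambda>x. x \<bullet> bary k x) \<in> borel_measurable \<mu>"
      using bary_measurable[OF k] by measurable
    show "AE x in \<mu>. (\<integral>z. fst z \<bullet> snd z \<partial>distr (k x) borel (Pair x)) = x \<bullet> bary k x"
      using kernels_AE_integrable(1)[OF k P2D(5)[OF \<nu>]] AE_space
    proof eventually_elim
      case (elim x)
      have "Pair x \<in> k x \<rightarrow>\<^sub>M (borel :: ('a \<times> 'a) measure)"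
        using Pair_measurable_borel kernels_sets[OF k elim(2)] by (simp cong: measurable_cong_sets)
      from integral_distr[OF this m] show ?case using elim(1) by (simp add: bary_def)
    qed
  qed
  finally show ?thesis using transport_cost_eq(2)[OF \<mu> \<nu> kp] by simp
qed

section \<open>Existence of optimal kernels\<close>

definition opt_kernels :: "'a::euclidean_space measure \<Rightarrow> 'a measure \<Rightarrow> ('a \<Rightarrow> 'a measure) set" where
  "opt_kernels \<mu> \<nu> = {k \<in> kernels \<mu> \<nu>. transport_cost (kernel_prod \<mu> k) = W2sq \<mu> \<nu>}"

lemma opt_kernels_kernels: "k \<in> opt_kernels \<mu> \<nu> \<Longrightarrow> k \<in> kernels \<mu> \<nu>"
  by (simp add: opt_kernels_def)

lemma opt_kernelsI:
  assumes "\<mu> \<in> P2" "k \<in> kernels \<mu> \<nu>" "transport_cost (kernel_prod \<mu> k) \<le> W2sq \<mu> \<nu>"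
  shows "k \<in> opt_kernels \<mu> \<nu>"
  using assms W2sq_le[OF kernel_prod_couplings[OF P2D(1,2)[OF assms(1)] assms(2)]]
  by (simp add: opt_kernels_def)

text \<open>One vector-valued test function, so that a single almost everywhere limit controls both
  the barycenter and the conditional second moment.\<close>

definition moments :: "'a::real_normed_vector \<Rightarrow> 'a \<times> real" where
  "moments y = (y, (norm y)\<^sup>2)"

lemma fst_snd_moments [simp]: "fst (moments y) = y" "snd (moments y) = (norm y)\<^sup>2"
  by (simp_all add: moments_def)

context
  fixes \<mu> \<nu> :: "'a::euclidean_space measure"
  assumes \<mu>: "\<mu> \<in> P2" and \<nu>: "\<nu> \<in> P2"
begin

interpretation prob_space \<mu> by (rule P2D[OF \<mu>])

lemma moments_integrable: "integrable \<nu> moments"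
proof -
  have "integrable \<nu> (\<lambda>y. (y, 0) + (0::'a, (norm y)\<^sup>2))"
    by (intro Bochner_Integration.integrable_add integrable_bounded_linear[OF _ P2D(5)[OF \<nu>]]
        integrable_bounded_linear[OF _ P2D(4)[OF \<nu>]] bounded_linear_Pair bounded_linear_ident bounded_linear_zero)
  then show ?thesis unfolding moments_def[abs_def] by simp
qed

lemma moments_kernel:
  assumes "k \<in> kernels \<mu> \<nu>"
  shows "AE x in \<mu>. (\<integral>y. moments y \<partial>k x) = (bary k x, \<integral>y. (norm y)\<^sup>2 \<partial>k x)"
  using kernels_AE_integrable(1)[OF assms moments_integrable]
proof eventually_elim
  case (elim x)
  have "fst (\<integral>y. moments y \<partial>k x) = (\<integral>y. y \<partial>k x)" "snd (\<integral>y. moments y \<partial>k x) = (\<integral>y. (norm y)\<^sup>2 \<partial>k x)"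
    using integral_bounded_linear[OF bounded_linear_fst elim] integral_bounded_linear[OF bounded_linear_snd elim]
    by simp_all
  then show ?case by (simp add: bary_def prod_eq_iff)
qed

lemma moments_limit:
  assumes kn: "\<And>n::nat. kn n \<in> kernels \<mu> \<nu>" and k: "k \<in> kernels \<mu> \<nu>"
    and ae: "AE x in \<mu>. (\<lambda>n. \<integral>y. moments y \<partial>kn n x) \<longlonglongrightarrow> (\<integral>y. moments y \<partial>k x)"
  shows "AE x in \<mu>. (\<lambda>n. bary (kn n) x) \<longlonglongrightarrow> bary k x"
    and "AE x in \<mu>. (\<lambda>n. \<integral>y. (norm y)\<^sup>2 \<partial>kn n x) \<longlonglongrightarrow> (\<integral>y. (norm y)\<^sup>2 \<partial>k x)"
proof -
  have "AE x in \<mu>. \<forall>n. (\<integral>y. moments y \<partial>kn n x) = (bary (kn n) x, \<integral>y. (norm y)\<^sup>2 \<partial>kn n x)"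
    using moments_kernel[OF kn] by (simp add: AE_all_countable)
  with ae moments_kernel[OF k] have both: "AE x in \<mu>. (\<lambda>n. bary (kn n) x) \<longlonglongrightarrow> bary k x
      \<and> (\<lambda>n. \<integral>y. (norm y)\<^sup>2 \<partial>kn n x) \<longlonglongrightarrow> (\<integral>y. (norm y)\<^sup>2 \<partial>k x)"
  proof eventually_elim
    case (elim x)
    then have "(\<lambda>n. (bary (kn n) x, \<integral>y. (norm y)\<^sup>2 \<partial>kn n x)) \<longlonglongrightarrow> (bary k x, \<integral>y. (norm y)\<^sup>2 \<partial>k x)" by simp
    from tendsto_fst[OF this] tendsto_snd[OF this] show ?case by simp
  qed
  from both show "AE x in \<mu>. (\<lambda>n. bary (kn n) x) \<longlonglongrightarrow> bary k x" by eventually_elim simp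
  from both show "AE x in \<mu>. (\<lambda>n. \<integral>y. (norm y)\<^sup>2 \<partial>kn n x) \<longlonglongrightarrow> (\<integral>y. (norm y)\<^sup>2 \<partial>k x)"
    by eventually_elim simp
qed

lemma inner_bary_integrable:
  assumes "k \<in> kernels \<mu> \<nu>"
  shows "integrable \<mu> (\<lambda>x. x \<bullet> bary k x)"
  by (rule integrable_inner_of_power2[OF measurable_ident_sets[OF P2D(2)[OF \<mu>]] bary_measurable[OF assms]
        P2D(4)[OF \<mu>] bary_power2(1)[OF assms \<nu>]])

lemma kernel_cost_mid:
  assumes k: "k \<in> kernels \<mu> \<nu>" and l: "l \<in> kernels \<mu> \<nu>"
  shows "transport_cost (kernel_prod \<mu> (mid_kernel k l))
    = (transport_cost (kernel_prod \<mu> k) + transport_cost (kernel_prod \<mu> l)) / 2"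
proof -
  note m = mid_kernel_kernels[OF k l]
  have "(\<integral>x. x \<bullet> bary (mid_kernel k l) x \<partial>\<mu>) = (\<integral>x. (x \<bullet> bary k x + x \<bullet> bary l x) / 2 \<partial>\<mu>)"
  proof (rule integral_cong_AE)
    show "AE x in \<mu>. x \<bullet> bary (mid_kernel k l) x = (x \<bullet> bary k x + x \<bullet> bary l x) / 2"
      using bary_mid_kernel[OF k l \<nu>] by eventually_elim (simp add: inner_add_right)
    show "(\<lambda>x. x \<bullet> bary (mid_kernel k l) x) \<in> borel_measurable \<mu>"
      by (rule borel_measurable_integrable[OF inner_bary_integrable[OF m]])
    show "(\<lambda>x. (x \<bullet> bary k x + x \<bullet> bary l x) / 2) \<in> borel_measurable \<mu>"
      using inner_bary_integrable[OF k] inner_bary_integrable[OF l]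
      by (intro borel_measurable_integrable) auto
  qed
  also have "\<dots> = ((\<integral>x. x \<bullet> bary k x \<partial>\<mu>) + (\<integral>x. x \<bullet> bary l x \<partial>\<mu>)) / 2"
    using inner_bary_integrable[OF k] inner_bary_integrable[OF l] by simp
  finally show ?thesis
    unfolding kernel_cost[OF \<mu> \<nu> m] kernel_cost[OF \<mu> \<nu> k] kernel_cost[OF \<mu> \<nu> l] by (simp add: field_simps)
qed

text \<open>The correlation alone has no sign. With the two second moments the integrand
  \<open>G l x\<close> is the expanded conditional cost, nonnegative by Jensen, and Fatou
  applies.\<close>

lemma kernel_cost_lsc:
  assumes kn: "\<And>n::nat. kn n \<in> kernels \<mu> \<nu>" and k: "k \<in> kernels \<mu> \<nu>"
    and ae: "AE x in \<mu>. (\<lambda>n. \<integral>y. moments y \<partial>kn n x) \<longlonglongrightarrow> (\<integral>y. moments y \<partial>k x)"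
    and c: "(\<lambda>n. transport_cost (kernel_prod \<mu> (kn n))) \<longlonglongrightarrow> c"
  shows "transport_cost (kernel_prod \<mu> k) \<le> c"
proof -
  define G where "G l x = (norm x)\<^sup>2 - 2 * (x \<bullet> bary l x) + (\<integral>y. (norm y)\<^sup>2 \<partial>l x)"
    for l :: "'a \<Rightarrow> 'a measure" and x
  have GI: "integrable \<mu> (G l)" and Gint: "(\<integral>x. G l x \<partial>\<mu>) = transport_cost (kernel_prod \<mu> l)"
    if l: "l \<in> kernels \<mu> \<nu>" for l
    using inner_bary_integrable[OF l] P2D(4)[OF \<mu>] kernels_integral[OF l P2D(4)[OF \<nu>]] kernel_cost[OF \<mu> \<nu> l]
    unfolding G_def[abs_def] by auto
  have "(\<integral>x. G k x \<partial>\<mu>) \<le> c"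
  proof (rule integral_fatou(2)[OF GI[OF kn]])
    show "AE x in \<mu>. 0 \<le> G (kn n) x" for n
      using bary_jensen[OF kn \<nu> strictly_convex_convex_on[OF strictly_convex_norm_power2] P2D(4)[OF \<nu>], of n]
    proof eventually_elim
      case (elim x)
      have "0 \<le> (norm (x - bary (kn n) x))\<^sup>2" by simp
      also have "\<dots> = (norm x)\<^sup>2 - 2 * (x \<bullet> bary (kn n) x) + (norm (bary (kn n) x))\<^sup>2"
        unfolding power2_norm_eq_inner by (simp add: inner_diff inner_commute)
      also have "\<dots> \<le> G (kn n) x" using elim unfolding G_def by simp
      finally show ?case .
    qed
    show "AE x in \<mu>. (\<lambda>n. G (kn n) x) \<longlonglongrightarrow> G k x"
      using moments_limit[OF kn k ae] unfolding G_def
      by eventually_elim (intro tendsto_add tendsto_diff tendsto_mult tendsto_inner tendsto_const)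
    show "(\<lambda>n. \<integral>x. G (kn n) x \<partial>\<mu>) \<longlonglongrightarrow> c" using c by (simp add: Gint[OF kn])
    show "G k \<in> borel_measurable \<mu>" by (rule borel_measurable_integrable[OF GI[OF k]])
  qed
  then show ?thesis by (simp add: Gint[OF k])
qed

text \<open>The cost is affine at midpoints and lower semicontinuous, so a minimising kernel exists;
  \<open>disintegration\<close> extends its minimality to all couplings.\<close>

lemma opt_kernel_exists:
  obtains k where "k \<in> opt_kernels \<mu> \<nu>"
proof -
  obtain k where k: "k \<in> kernels \<mu> \<nu>"
    and min: "\<And>l. l \<in> kernels \<mu> \<nu> \<Longrightarrow> transport_cost (kernel_prod \<mu> k) \<le> transport_cost (kernel_prod \<mu> l)"
  proof (rule kernels_minimizer[of "kernels \<mu> \<nu>" \<nu> 0 "\<lambda>k. transport_cost (kernel_prod \<mu> k)" moments])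
    show "kernels \<mu> \<nu> \<noteq> {}" using const_kernel[OF P2D(1,2)[OF \<nu>]] by blast
    show "mid_kernel k l \<in> kernels \<mu> \<nu>" if "k \<in> kernels \<mu> \<nu>" "l \<in> kernels \<mu> \<nu>" for k l
      by (rule mid_kernel_kernels[OF that])
    show "0 \<le> transport_cost (kernel_prod \<mu> k)" for k
      unfolding transport_cost_def by (intro integral_nonneg_AE) auto
    show "transport_cost (kernel_prod \<mu> (mid_kernel k l))
        \<le> max (transport_cost (kernel_prod \<mu> k)) (transport_cost (kernel_prod \<mu> l))"
      if "k \<in> kernels \<mu> \<nu>" "l \<in> kernels \<mu> \<nu>" for k l
      unfolding kernel_cost_mid[OF that] by simp
    show "integrable \<nu> moments" by (rule moments_integrable)
    fix kn k c
    assume kn: "\<And>n::nat. kn n \<in> kernels \<mu> \<nu>" and k: "k \<in> kernels \<mu> \<nu>"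
      and ae: "AE x in \<mu>. (\<lambda>n. \<integral>y. moments y \<partial>kn n x) \<longlonglongrightarrow> (\<integral>y. moments y \<partial>k x)"
      and c: "(\<lambda>n. transport_cost (kernel_prod \<mu> (kn n))) \<longlonglongrightarrow> c"
    show "k \<in> kernels \<mu> \<nu> \<and> transport_cost (kernel_prod \<mu> k) \<le> c"
      using k kernel_cost_lsc[OF kn k ae c] by simp
  qed auto
  have ne: "couplings \<mu> \<nu> \<noteq> {}" using kernel_prod_couplings[OF P2D(1,2)[OF \<mu>] k] by blast
  have "transport_cost (kernel_prod \<mu> k) \<le> W2sq \<mu> \<nu>"
    unfolding W2sq_def
  proof (rule cINF_greatest[OF ne])
    fix \<pi> assume "\<pi> \<in> couplings \<mu> \<nu>"
    then obtain l where "l \<in> kernels \<mu> \<nu>" "kernel_prod \<mu> l = \<pi>" by (rule disintegration)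
    then show "transport_cost (kernel_prod \<mu> k) \<le> transport_cost \<pi>" using min by blast
  qed
  then show ?thesis using opt_kernelsI[OF \<mu> k] by (intro that)
qed

end

section \<open>Passage between \<open>I_set\<close> and optimal kernels\<close>

lemma kernel_lift_cost:
  fixes \<mu> \<eta> \<nu> :: "'a::euclidean_space measure"
  assumes \<mu>: "\<mu> \<in> P2" and \<eta>: "\<eta> \<in> P2" and \<nu>: "\<nu> \<in> P2" and cx: "\<eta> \<le>\<^sub>c\<^sub>x \<nu>" and q: "q \<in> kernels \<mu> \<eta>"
  obtains k where "k \<in> kernels \<mu> \<nu>" "AE x in \<mu>. bary k x = bary q x"
    "transport_cost (kernel_prod \<mu> k) = transport_cost (kernel_prod \<mu> q)
      - (\<integral>y. (norm y)\<^sup>2 \<partial>\<eta>) + (\<integral>y. (norm y)\<^sup>2 \<partial>\<nu>)"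
proof -
  interpret prob_space \<mu> by (rule P2D[OF \<mu>])
  obtain k where k: "k \<in> kernels \<mu> \<nu>" and eq: "AE x in \<mu>. bary k x = bary q x"
    by (rule barycenter_lift[OF \<eta> \<nu> cx q])
  have "(\<integral>x. x \<bullet> bary k x \<partial>\<mu>) = (\<integral>x. x \<bullet> bary q x \<partial>\<mu>)"
  proof (rule integral_cong_AE)
    show "AE x in \<mu>. x \<bullet> bary k x = x \<bullet> bary q x" using eq by eventually_elim simp
  qed (use inner_bary_integrable[OF \<mu> \<nu> k] inner_bary_integrable[OF \<mu> \<eta> q] in
       \<open>auto intro: borel_measurable_integrable\<close>)
  then have "transport_cost (kernel_prod \<mu> k) = transport_cost (kernel_prod \<mu> q)
      - (\<integral>y. (norm y)\<^sup>2 \<partial>\<eta>) + (\<integral>y. (norm y)\<^sup>2 \<partial>\<nu>)"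
    unfolding kernel_cost[OF \<mu> \<nu> k] kernel_cost[OF \<mu> \<eta> q] by simp
  with k eq show ?thesis by (rule that)
qed

lemma graph_coupling:
  fixes \<mu> :: "'a::euclidean_space measure"
  assumes "prob_space \<mu>" "sets \<mu> = sets borel" and T: "T \<in> borel_measurable borel"
  shows "distr \<mu> borel (\<lambda>x. (x, T x)) \<in> couplings \<mu> (distr \<mu> borel T)"
    and "(\<lambda>x. (x, T x)) \<in> \<mu> \<rightarrow>\<^sub>M (borel :: ('a \<times> 'a) measure)"
proof -
  interpret prob_space \<mu> by fact
  have Tm: "T \<in> borel_measurable \<mu>" using T assms(2) by (simp cong: measurable_cong_sets)
  have im: "(\<lambda>x. x) \<in> borel_measurable \<mu>" by (rule measurable_ident_sets[OF assms(2)])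
  show g: "(\<lambda>x. (x, T x)) \<in> \<mu> \<rightarrow>\<^sub>M (borel :: ('a \<times> 'a) measure)"
    unfolding borel_prod[symmetric] using Tm im by (rule measurable_Pair[rotated])
  have f: "fst \<in> (borel :: ('a \<times> 'a) measure) \<rightarrow>\<^sub>M borel" and s: "snd \<in> (borel :: ('a \<times> 'a) measure) \<rightarrow>\<^sub>M borel"
    unfolding borel_prod[symmetric] by simp_all
  show "distr \<mu> borel (\<lambda>x. (x, T x)) \<in> couplings \<mu> (distr \<mu> borel T)"
    unfolding couplings_def
    using prob_space_distr[OF g] distr_distr[OF f g] distr_distr[OF s g] distr_id2[OF assms(2)[symmetric]]
    by (simp add: comp_def)
qed

text \<open>The graph coupling of \<open>bary k\<close> bounds \<open>W2sq\<close> to the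
  push-forward from above. Lifting an optimal kernel for the push-forward back to \<nu> gives the
  reverse bound.\<close>

lemma I_set_bary:
  fixes \<mu> \<nu> :: "'a::euclidean_space measure"
  assumes \<mu>: "\<mu> \<in> P2" and \<nu>: "\<nu> \<in> P2" and k: "k \<in> opt_kernels \<mu> \<nu>"
  shows "distr \<mu> borel (bary k) \<in> I_set \<mu> \<nu>"
proof -
  let ?\<eta> = "distr \<mu> borel (bary k)"
  have kk: "k \<in> kernels \<mu> \<nu>" by (rule opt_kernels_kernels[OF k])
  note P = bary_pushforward[OF \<mu> \<nu> kk]
  note gc = graph_coupling[OF P2D(1,2)[OF \<mu>] P(1)]
  have m: "(\<lambda>z. fst z \<bullet> snd z) \<in> borel_measurable (borel :: ('a \<times> 'a) measure)"
    unfolding borel_prod[symmetric] by measurable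
  have "W2sq \<mu> ?\<eta> \<le> transport_cost (distr \<mu> borel (\<lambda>x. (x, bary k x)))"
    by (rule W2sq_le[OF gc(1)])
  also have "\<dots> = W2sq \<mu> \<nu> - (\<integral>y. (norm y)\<^sup>2 \<partial>\<nu>) + (\<integral>z. (norm z)\<^sup>2 \<partial>?\<eta>)"
    using transport_cost_eq(2)[OF \<mu> P(2) gc(1)] integral_distr[OF gc(2) m] kernel_cost[OF \<mu> \<nu> kk] k
    by (simp add: opt_kernels_def)
  finally have le: "W2sq \<mu> ?\<eta> \<le> W2sq \<mu> \<nu> - (\<integral>y. (norm y)\<^sup>2 \<partial>\<nu>) + (\<integral>z. (norm z)\<^sup>2 \<partial>?\<eta>)" .
  obtain q where q: "q \<in> opt_kernels \<mu> ?\<eta>" by (rule opt_kernel_exists[OF \<mu> P(2)])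
  obtain l where l: "l \<in> kernels \<mu> \<nu>" and cost: "transport_cost (kernel_prod \<mu> l)
      = transport_cost (kernel_prod \<mu> q) - (\<integral>y. (norm y)\<^sup>2 \<partial>?\<eta>) + (\<integral>y. (norm y)\<^sup>2 \<partial>\<nu>)"
    by (rule kernel_lift_cost[OF \<mu> P(2) \<nu> P(3) opt_kernels_kernels[OF q]])
  have "W2sq \<mu> \<nu> \<le> W2sq \<mu> ?\<eta> - (\<integral>y. (norm y)\<^sup>2 \<partial>?\<eta>) + (\<integral>y. (norm y)\<^sup>2 \<partial>\<nu>)"
    using W2sq_le[OF kernel_prod_couplings[OF P2D(1,2)[OF \<mu>] l]] cost q by (simp add: opt_kernels_def)
  with le show ?thesis using P(2,3) by (simp add: I_set_def)
qed

text \<open>The identity in the definition of \<open>I_set\<close> says exactly that the cost of the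
  lifted kernel is \<open>W2sq \<mu> \<nu>\<close>.\<close>

lemma I_set_lift:
  fixes \<mu> \<nu> :: "'a::euclidean_space measure"
  assumes \<mu>: "\<mu> \<in> P2" and \<nu>: "\<nu> \<in> P2" and \<eta>: "\<eta> \<in> I_set \<mu> \<nu>" and q: "q \<in> opt_kernels \<mu> \<eta>"
  obtains k where "k \<in> opt_kernels \<mu> \<nu>" "AE x in \<mu>. bary k x = bary q x"
proof -
  have e: "\<eta> \<in> P2" "\<eta> \<le>\<^sub>c\<^sub>x \<nu>"
    "W2sq \<mu> \<nu> = W2sq \<mu> \<eta> + (\<integral>y. (norm y)\<^sup>2 \<partial>\<nu>) - (\<integral>z. (norm z)\<^sup>2 \<partial>\<eta>)"
    using \<eta> by (auto simp: I_set_def)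
  obtain k where k: "k \<in> kernels \<mu> \<nu>" "AE x in \<mu>. bary k x = bary q x"
    and cost: "transport_cost (kernel_prod \<mu> k)
      = transport_cost (kernel_prod \<mu> q) - (\<integral>y. (norm y)\<^sup>2 \<partial>\<eta>) + (\<integral>y. (norm y)\<^sup>2 \<partial>\<nu>)"
    by (rule kernel_lift_cost[OF \<mu> e(1) \<nu> e(2) opt_kernels_kernels[OF q]])
  have "k \<in> opt_kernels \<mu> \<nu>"
    using cost e(3) q by (intro opt_kernelsI[OF \<mu> k(1)]) (simp add: opt_kernels_def)
  then show ?thesis using k(2) by (rule that)
qed

section \<open>Minimisers of a strictly convex functional\<close>

text \<open>Optimal kernels are closed under midpoints, which serves twice: for existence through
  \<open>kernels_minimizer\<close>, and for uniqueness by comparing two minimisers with their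
  midpoint.\<close>

lemma optimal_barycenter:
  fixes \<mu> \<nu> :: "'a::euclidean_space measure"
  assumes \<mu>: "\<mu> \<in> P2" and \<nu>: "\<nu> \<in> P2" and \<phi>: "strictly_convex \<phi>" and I\<phi>: "integrable \<nu> \<phi>"
  obtains k where "k \<in> opt_kernels \<mu> \<nu>"
    "\<And>l. l \<in> opt_kernels \<mu> \<nu> \<Longrightarrow> (\<integral>x. \<phi> (bary k x) \<partial>\<mu>) \<le> (\<integral>x. \<phi> (bary l x) \<partial>\<mu>)"
    "\<And>l. l \<in> opt_kernels \<mu> \<nu> \<Longrightarrow> (\<integral>x. \<phi> (bary l x) \<partial>\<mu>) \<le> (\<integral>x. \<phi> (bary k x) \<partial>\<mu>)
      \<Longrightarrow> AE x in \<mu>. bary l x = bary k x"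
proof -
  interpret prob_space \<mu> by (rule P2D[OF \<mu>])
  have c: "convex_on UNIV \<phi>" by (rule strictly_convex_convex_on[OF \<phi>])
  note K = opt_kernels_kernels
  define F where "F k = (\<integral>x. \<phi> (bary k x) \<partial>\<mu>)" for k
  have FI: "integrable \<mu> (\<lambda>x. \<phi> (bary k x))" if "k \<in> opt_kernels \<mu> \<nu>" for k
    by (rule integrable_convex_bary(1)[OF K[OF that] \<nu> c I\<phi>])
  have mid: "mid_kernel k l \<in> opt_kernels \<mu> \<nu>" if "k \<in> opt_kernels \<mu> \<nu>" "l \<in> opt_kernels \<mu> \<nu>" for k l
    using that kernel_cost_mid[OF \<mu> \<nu> K[OF that(1)] K[OF that(2)]] mid_kernel_kernels[OF K[OF that(1)] K[OF that(2)]]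
    by (simp add: opt_kernels_def)
  have mid_le: "\<phi> ((1/2) *\<^sub>R (u + v)) \<le> (\<phi> u + \<phi> v) / 2" for u v
    using strictly_convex_midpoint[OF \<phi>, of u v] by (cases "u = v") (auto simp flip: scaleR_2)
  have AEmid: "AE x in \<mu>. \<phi> (bary (mid_kernel k l) x) \<le> (\<phi> (bary k x) + \<phi> (bary l x)) / 2"
    if "k \<in> opt_kernels \<mu> \<nu>" "l \<in> opt_kernels \<mu> \<nu>" for k l
    using bary_mid_kernel[OF K[OF that(1)] K[OF that(2)] \<nu>] by eventually_elim (simp only: mid_le)
  have Iavg: "integrable \<mu> (\<lambda>x. (\<phi> (bary k x) + \<phi> (bary l x)) / 2)"
    and avg: "(\<integral>x. (\<phi> (bary k x) + \<phi> (bary l x)) / 2 \<partial>\<mu>) = (F k + F l) / 2"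
    if "k \<in> opt_kernels \<mu> \<nu>" "l \<in> opt_kernels \<mu> \<nu>" for k l
    using FI[OF that(1)] FI[OF that(2)] by (auto simp: F_def)
  obtain a where a: "\<And>y. \<phi> 0 + a \<bullet> (y - 0) \<le> \<phi> y" using convex_on_support[OF c, of 0] by blast
  \<comment> \<open>The barycenter maps of all these kernels have the same mean, that of \<nu>. The
    affine minorant of \<phi> therefore has the same integral \<open>b\<close> along each of them
    and bounds \<open>F\<close> from below.\<close>
  define b where "b = \<phi> 0 + a \<bullet> (\<integral>y. y \<partial>\<nu>)"
  have Iaff: "integrable \<mu> (\<lambda>x. \<phi> 0 + a \<bullet> bary k x)" and aff: "(\<integral>x. \<phi> 0 + a \<bullet> bary k x \<partial>\<mu>) = b"
    if "k \<in> opt_kernels \<mu> \<nu>" for k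
  proof -
    have i: "integrable \<mu> (bary k)" by (rule bary_integrable[OF K[OF that] \<nu>])
    have "(\<integral>x. bary k x \<partial>\<mu>) = (\<integral>y. y \<partial>\<nu>)"
      unfolding bary_def by (rule kernels_integral(2)[OF K[OF that] P2D(5)[OF \<nu>]])
    with i show "integrable \<mu> (\<lambda>x. \<phi> 0 + a \<bullet> bary k x)" "(\<integral>x. \<phi> 0 + a \<bullet> bary k x \<partial>\<mu>) = b"
      by (simp_all add: b_def prob_space)
  qed
  obtain k where k: "k \<in> opt_kernels \<mu> \<nu>" and min: "\<And>l. l \<in> opt_kernels \<mu> \<nu> \<Longrightarrow> F k \<le> F l"
  proof (rule kernels_minimizer[of "opt_kernels \<mu> \<nu>" \<nu> b F moments])
    show "opt_kernels \<mu> \<nu> \<subseteq> kernels \<mu> \<nu>" using K by blast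
    show "opt_kernels \<mu> \<nu> \<noteq> {}" using opt_kernel_exists[OF \<mu> \<nu>] by blast
    show "mid_kernel k l \<in> opt_kernels \<mu> \<nu>" if "k \<in> opt_kernels \<mu> \<nu>" "l \<in> opt_kernels \<mu> \<nu>" for k l
      by (rule mid[OF that])
    show "b \<le> F k" if "k \<in> opt_kernels \<mu> \<nu>" for k
      unfolding F_def aff[OF that, symmetric] using a by (intro integral_mono Iaff[OF that] FI[OF that]) simp
    show "F (mid_kernel k l) \<le> max (F k) (F l)" if "k \<in> opt_kernels \<mu> \<nu>" "l \<in> opt_kernels \<mu> \<nu>" for k l
    proof -
      have "F (mid_kernel k l) \<le> (F k + F l) / 2"
        unfolding avg[OF that, symmetric] unfolding F_def
        by (rule integral_mono_AE[OF FI[OF mid[OF that]] Iavg[OF that] AEmid[OF that]])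
      then show ?thesis by simp
    qed
    show "integrable \<nu> moments" by (rule moments_integrable[OF \<mu> \<nu>])
    fix kn l C
    assume kn: "\<And>n::nat. kn n \<in> opt_kernels \<mu> \<nu>" and l: "l \<in> kernels \<mu> \<nu>"
      and ae: "AE x in \<mu>. (\<lambda>n. \<integral>y. moments y \<partial>kn n x) \<longlonglongrightarrow> (\<integral>y. moments y \<partial>l x)"
      and C: "(\<lambda>n. F (kn n)) \<longlonglongrightarrow> C"
    have "(\<lambda>n. transport_cost (kernel_prod \<mu> (kn n))) \<longlonglongrightarrow> W2sq \<mu> \<nu>"
      using kn by (simp add: opt_kernels_def)
    from kernel_cost_lsc[OF \<mu> \<nu> K[OF kn] l ae this] have lo: "l \<in> opt_kernels \<mu> \<nu>"
      by (rule opt_kernelsI[OF \<mu> l])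
    \<comment> \<open>Subtracting the minorant makes the integrands nonnegative for Fatou and shifts
      every value of \<open>F\<close> by the same \<open>b\<close>.\<close>
    have "(\<integral>x. \<phi> (bary l x) - (\<phi> 0 + a \<bullet> bary l x) \<partial>\<mu>) \<le> C - b"
    proof (rule integral_fatou(2))
      show "integrable \<mu> (\<lambda>x. \<phi> (bary (kn n) x) - (\<phi> 0 + a \<bullet> bary (kn n) x))" for n
        by (rule Bochner_Integration.integrable_diff[OF FI[OF kn] Iaff[OF kn]])
      show "AE x in \<mu>. 0 \<le> \<phi> (bary (kn n) x) - (\<phi> 0 + a \<bullet> bary (kn n) x)" for n
        using a by simp
      show "AE x in \<mu>. (\<lambda>n. \<phi> (bary (kn n) x) - (\<phi> 0 + a \<bullet> bary (kn n) x))
          \<longlonglongrightarrow> \<phi> (bary l x) - (\<phi> 0 + a \<bullet> bary l x)"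
        using moments_limit(1)[OF \<mu> \<nu> K[OF kn] l ae]
      proof eventually_elim
        case (elim x)
        have "isCont \<phi> (bary l x)"
          using convex_on_continuous[OF open_UNIV c] by (simp add: continuous_on_eq_continuous_at)
        from isCont_tendsto_compose[OF this elim] elim show ?case
          by (intro tendsto_diff tendsto_add tendsto_inner tendsto_const)
      qed
      show "(\<lambda>n. \<integral>x. \<phi> (bary (kn n) x) - (\<phi> 0 + a \<bullet> bary (kn n) x) \<partial>\<mu>) \<longlonglongrightarrow> C - b"
        unfolding Bochner_Integration.integral_diff[OF FI[OF kn] Iaff[OF kn]] aff[OF kn] F_def[symmetric]
        by (intro tendsto_diff C tendsto_const)
      show "(\<lambda>x. \<phi> (bary l x) - (\<phi> 0 + a \<bullet> bary l x)) \<in> borel_measurable \<mu>"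
        by (rule borel_measurable_integrable[OF Bochner_Integration.integrable_diff[OF FI[OF lo] Iaff[OF lo]]])
    qed
    then have "F l \<le> C"
      unfolding Bochner_Integration.integral_diff[OF FI[OF lo] Iaff[OF lo]] aff[OF lo] F_def[symmetric] by simp
    with lo show "l \<in> opt_kernels \<mu> \<nu> \<and> F l \<le> C" by simp
  qed auto
  have "AE x in \<mu>. bary l x = bary k x" if l: "l \<in> opt_kernels \<mu> \<nu>" and le: "F l \<le> F k" for l
  proof -
    \<comment> \<open>Two minimisers leave no room in the midpoint inequality, so it is an equality
      almost everywhere; strict convexity of \<phi> permits this only where both maps agree.\<close>
    have "AE x in \<mu>. \<phi> (bary (mid_kernel k l) x) = (\<phi> (bary k x) + \<phi> (bary l x)) / 2"
    proof (rule AE_eq_of_le_integral_eq[OF FI[OF mid[OF k l]] Iavg[OF k l] AEmid[OF k l]])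
      have "F (mid_kernel k l) \<le> (F k + F l) / 2"
        unfolding avg[OF k l, symmetric] unfolding F_def
        by (rule integral_mono_AE[OF FI[OF mid[OF k l]] Iavg[OF k l] AEmid[OF k l]])
      then show "(\<integral>x. \<phi> (bary (mid_kernel k l) x) \<partial>\<mu>) = (\<integral>x. (\<phi> (bary k x) + \<phi> (bary l x)) / 2 \<partial>\<mu>)"
        unfolding avg[OF k l] F_def[symmetric] using min[OF mid[OF k l]] min[OF l] le by simp
    qed
    then show ?thesis
      using bary_mid_kernel[OF K[OF k] K[OF l] \<nu>]
      by eventually_elim (metis strictly_convex_midpoint[OF \<phi>] less_irrefl)
  qed
  then show ?thesis using k min unfolding F_def by (intro that)
qed

text \<open>Finiteness passes down the convex order, because on \<open>P2\<close> the integrals of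
  convex functions always make sense.\<close>

lemma convex_order_integrable:
  assumes "\<eta> \<in> P2" "\<nu> \<in> P2" "\<eta> \<le>\<^sub>c\<^sub>x \<nu>" "convex_on UNIV f" "ereal_integral \<nu> f < \<infinity>"
  shows "integrable \<eta> f"
proof -
  have "ereal_integral \<eta> f \<le> ereal_integral \<nu> f"
    using assms convex_makes_sense unfolding convex_le_def by blast
  then show ?thesis using assms by (intro convex_integrable_of_finite) auto
qed

text \<open>The minimiser is unique already among all of \<open>I_set \<mu> \<nu>\<close>, so the second selection
  criterion in (ii) is vacuous.\<close>

lemma I_min_singleton:
  fixes \<mu> \<nu> :: "'a::euclidean_space measure"
  assumes \<mu>: "\<mu> \<in> P2" and \<nu>: "\<nu> \<in> P2" and \<phi>: "strictly_convex \<phi>" and fin: "ereal_integral \<nu> \<phi> < \<infinity>"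
  obtains k where "k \<in> opt_kernels \<mu> \<nu>" "I_min \<mu> \<nu> \<phi> = {distr \<mu> borel (bary k)}"
    "opt_couplings \<mu> (distr \<mu> borel (bary k)) = {distr \<mu> borel (\<lambda>x. (x, bary k x))}"
proof -
  interpret prob_space \<mu> by (rule P2D[OF \<mu>])
  have c: "convex_on UNIV \<phi>" by (rule strictly_convex_convex_on[OF \<phi>])
  have I\<nu>: "integrable \<nu> \<phi>" by (rule convex_integrable_of_finite[OF \<nu> c fin])
  have I\<eta>: "\<eta> \<in> P2" "integrable \<eta> \<phi>" if "\<eta> \<in> I_set \<mu> \<nu>" for \<eta>
    using that convex_order_integrable[OF _ \<nu> _ c fin] by (auto simp: I_set_def)
  obtain k where k: "k \<in> opt_kernels \<mu> \<nu>"
    and min: "\<And>l. l \<in> opt_kernels \<mu> \<nu> \<Longrightarrow> (\<integral>x. \<phi> (bary k x) \<partial>\<mu>) \<le> (\<integral>x. \<phi> (bary l x) \<partial>\<mu>)"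
    and uniq: "\<And>l. l \<in> opt_kernels \<mu> \<nu> \<Longrightarrow> (\<integral>x. \<phi> (bary l x) \<partial>\<mu>) \<le> (\<integral>x. \<phi> (bary k x) \<partial>\<mu>)
      \<Longrightarrow> AE x in \<mu>. bary l x = bary k x"
    using optimal_barycenter[OF \<mu> \<nu> \<phi> I\<nu>] by blast
  define \<eta>0 where "\<eta>0 = distr \<mu> borel (bary k)"
  define m where "m = (\<integral>x. \<phi> (bary k x) \<partial>\<mu>)"
  have kk: "k \<in> kernels \<mu> \<nu>" by (rule opt_kernels_kernels[OF k])
  have bk: "bary k \<in> borel_measurable borel" and bm: "bary k \<in> borel_measurable \<mu>"
    using bary_pushforward(1)[OF \<mu> \<nu> kk] bary_measurable[OF kk] by auto
  have \<eta>0: "\<eta>0 \<in> I_set \<mu> \<nu>" unfolding \<eta>0_def by (rule I_set_bary[OF \<mu> \<nu> k])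
  have m0: "(\<integral>z. \<phi> z \<partial>\<eta>0) = m"
    unfolding \<eta>0_def m_def by (rule integral_distr[OF bm convex_on_UNIV_measurable[OF c]])
  \<comment> \<open>The first bound lifts \<open>q\<close> to an optimal kernel for \<nu> with the
    same barycenter map and uses minimality of \<open>k\<close>; the second is Jensen. If the ends
    meet, uniqueness identifies the maps.\<close>
  have key: "m \<le> (\<integral>x. \<phi> (bary q x) \<partial>\<mu>)" "(\<integral>x. \<phi> (bary q x) \<partial>\<mu>) \<le> (\<integral>z. \<phi> z \<partial>\<eta>)"
    "(\<integral>z. \<phi> z \<partial>\<eta>) \<le> m \<Longrightarrow> AE x in \<mu>. bary q x = bary k x"
    if \<eta>: "\<eta> \<in> I_set \<mu> \<nu>" and q: "q \<in> opt_kernels \<mu> \<eta>" for \<eta> q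
  proof -
    have qq: "q \<in> kernels \<mu> \<eta>" by (rule opt_kernels_kernels[OF q])
    obtain l where l: "l \<in> opt_kernels \<mu> \<nu>" and lq: "AE x in \<mu>. bary l x = bary q x"
      by (rule I_set_lift[OF \<mu> \<nu> \<eta> q])
    have "(\<integral>x. \<phi> (bary l x) \<partial>\<mu>) = (\<integral>x. \<phi> (bary q x) \<partial>\<mu>)"
    proof (rule integral_cong_AE)
      show "AE x in \<mu>. \<phi> (bary l x) = \<phi> (bary q x)" using lq by eventually_elim simp
    qed (use measurable_compose[OF bary_measurable[OF opt_kernels_kernels[OF l]] convex_on_UNIV_measurable[OF c]]
          measurable_compose[OF bary_measurable[OF qq] convex_on_UNIV_measurable[OF c]] in auto)
    then show le: "m \<le> (\<integral>x. \<phi> (bary q x) \<partial>\<mu>)"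
      and le': "(\<integral>x. \<phi> (bary q x) \<partial>\<mu>) \<le> (\<integral>z. \<phi> z \<partial>\<eta>)"
      using min[OF l] integrable_convex_bary(2)[OF qq I\<eta>(1)[OF \<eta>] c I\<eta>(2)[OF \<eta>]] by (simp_all add: m_def)
    assume "(\<integral>z. \<phi> z \<partial>\<eta>) \<le> m"
    with le' \<open>(\<integral>x. \<phi> (bary l x) \<partial>\<mu>) = _\<close> have "AE x in \<mu>. bary l x = bary k x"
      by (intro uniq[OF l]) (simp add: m_def)
    with lq show "AE x in \<mu>. bary q x = bary k x" by eventually_elim simp
  qed
  have low: "m \<le> (\<integral>z. \<phi> z \<partial>\<eta>)" if \<eta>: "\<eta> \<in> I_set \<mu> \<nu>" for \<eta>
  proof -
    obtain q where "q \<in> opt_kernels \<mu> \<eta>" by (rule opt_kernel_exists[OF \<mu> I\<eta>(1)[OF \<eta>]])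
    from key(1,2)[OF \<eta> this] show ?thesis by (rule order_trans)
  qed
  have inf: "(INF \<eta>\<in>I_set \<mu> \<nu>. ereal_integral \<eta> \<phi>) = ereal m"
  proof (rule antisym)
    show "(INF \<eta>\<in>I_set \<mu> \<nu>. ereal_integral \<eta> \<phi>) \<le> ereal m"
      using \<eta>0 m0 I\<eta>(2)[OF \<eta>0] by (intro INF_lower2[of \<eta>0]) (simp_all add: ereal_integral_eq)
    show "ereal m \<le> (INF \<eta>\<in>I_set \<mu> \<nu>. ereal_integral \<eta> \<phi>)"
      using low I\<eta>(2) by (intro INF_greatest) (simp add: ereal_integral_eq)
  qed
  have Imin: "\<eta> \<in> I_min \<mu> \<nu> \<phi> \<longleftrightarrow> \<eta> \<in> I_set \<mu> \<nu> \<and> (\<integral>z. \<phi> z \<partial>\<eta>) = m" for \<eta>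
    unfolding I_min_def inf using I\<eta>(2) by (auto simp: ereal_integral_eq)
  \<comment> \<open>For a minimising \<eta> all inequalities in \<open>key\<close> are equalities.
    Equality in Jensen for strictly convex \<phi> makes almost every \<open>q x\<close> a point mass
    at its barycenter, which is \<open>bary k x\<close>.\<close>
  have coup: "\<pi> = distr \<mu> borel (\<lambda>x. (x, bary k x))"
    if \<eta>: "\<eta> \<in> I_min \<mu> \<nu> \<phi>" and \<pi>: "\<pi> \<in> opt_couplings \<mu> \<eta>" for \<eta> \<pi>
  proof -
    have \<eta>I: "\<eta> \<in> I_set \<mu> \<nu>" and \<eta>m: "(\<integral>z. \<phi> z \<partial>\<eta>) = m" using \<eta> Imin by auto
    note \<eta>2 = I\<eta>[OF \<eta>I]
    have "\<pi> \<in> couplings \<mu> \<eta>" using \<pi> by (simp add: opt_couplings_def)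
    then obtain q where qq: "q \<in> kernels \<mu> \<eta>" and q\<pi>: "kernel_prod \<mu> q = \<pi>" by (rule disintegration)
    have q: "q \<in> opt_kernels \<mu> \<eta>" using qq q\<pi> \<pi> by (simp add: opt_kernels_def opt_couplings_def)
    have bq: "AE x in \<mu>. bary q x = bary k x" using key(3)[OF \<eta>I q] \<eta>m by simp
    have "AE x in \<mu>. \<phi> (bary q x) = (\<integral>y. \<phi> y \<partial>q x)"
    proof (rule AE_eq_of_le_integral_eq[OF integrable_convex_bary(1)[OF qq \<eta>2(1) c \<eta>2(2)]
          kernels_integral(1)[OF qq \<eta>2(2)] bary_jensen[OF qq \<eta>2(1) c \<eta>2(2)]])
      show "(\<integral>x. \<phi> (bary q x) \<partial>\<mu>) = (\<integral>x. \<integral>y. \<phi> y \<partial>q x \<partial>\<mu>)"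
        unfolding kernels_integral(2)[OF qq \<eta>2(2)] using key(1,2)[OF \<eta>I q] \<eta>m by simp
    qed
    then have "AE x in \<mu>. distr (q x) borel (Pair x) = return borel (x, bary k x)"
      using bq kernels_AE_integrable(1)[OF qq P2D(5)[OF \<eta>2(1)]] kernels_AE_integrable(1)[OF qq \<eta>2(2)] AE_space
    proof eventually_elim
      case (elim x)
      interpret qx: prob_space "q x" by (rule kernels_prob[OF qq elim(5)])
      have "AE y in q x. y = bary k x"
        using jensen_strict[OF qx.prob_space_axioms elim(3,4) \<phi>] elim(1,2) by (simp add: bary_def)
      moreover have "Pair x \<in> q x \<rightarrow>\<^sub>M (borel :: ('a \<times> 'a) measure)"
        using Pair_measurable_borel kernels_sets[OF qq elim(5)] by (simp cong: measurable_cong_sets)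
      ultimately have "distr (q x) borel (Pair x) = distr (q x) borel (\<lambda>_. (x, bary k x))"
        by (intro distr_cong_AE) auto
      also have "\<dots> = return borel (x, bary k x)" by (rule qx.distr_const) simp
      finally show ?case .
    qed
    moreover have gm: "(\<lambda>x. (x, bary k x)) \<in> \<mu> \<rightarrow>\<^sub>M (borel :: ('a \<times> 'a) measure)"
      by (rule graph_coupling(2)[OF P2D(1,2)[OF \<mu>] bk])
    moreover have "(\<lambda>x. return borel (x, bary k x)) \<in> \<mu> \<rightarrow>\<^sub>M subprob_algebra (borel :: ('a \<times> 'a) measure)"
      by (rule measurable_compose[OF gm return_measurable])
    ultimately have "\<pi> = \<mu> \<bind> (\<lambda>x. return borel (x, bary k x))"
      unfolding q\<pi>[symmetric] kernel_prod_def
      by (intro bind_cong_AE[OF refl kernels_measurable_subprob[OF kernel_prod_kernels[OF P2D(2)[OF \<mu>] qq]]])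
    also have "\<dots> = distr \<mu> borel (\<lambda>x. (x, bary k x))" by (rule bind_return_distr'[OF not_empty gm])
    finally show ?thesis .
  qed
  have ex: "\<exists>\<pi>. \<pi> \<in> opt_couplings \<mu> \<eta>" if \<eta>: "\<eta> \<in> P2" for \<eta>
  proof -
    obtain q where "q \<in> opt_kernels \<mu> \<eta>" by (rule opt_kernel_exists[OF \<mu> \<eta>])
    then have "kernel_prod \<mu> q \<in> opt_couplings \<mu> \<eta>"
      using kernel_prod_couplings[OF P2D(1,2)[OF \<mu>]] by (simp add: opt_kernels_def opt_couplings_def)
    then show ?thesis ..
  qed
  have \<eta>0min: "\<eta>0 \<in> I_min \<mu> \<nu> \<phi>" using \<eta>0 m0 Imin by simp
  \<comment> \<open>By \<open>coup\<close> all minimisers share the same optimal coupling, and each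
    is recovered as its second marginal.\<close>
  have "\<eta> = \<eta>0" if \<eta>: "\<eta> \<in> I_min \<mu> \<nu> \<phi>" for \<eta>
  proof -
    have "\<eta> \<in> P2" using \<eta> Imin I\<eta>(1) by blast
    then obtain \<pi> where \<pi>: "\<pi> \<in> opt_couplings \<mu> \<eta>" using ex by blast
    from coup[OF \<eta> \<pi>] have "distr \<pi> borel snd = \<eta>0"
      using couplingsD(4)[OF graph_coupling(1)[OF P2D(1,2)[OF \<mu>] bk]] by (simp add: \<eta>0_def)
    then show ?thesis using couplingsD(4)[of \<pi> \<mu> \<eta>] \<pi> by (simp add: opt_couplings_def)
  qed
  then have 1: "I_min \<mu> \<nu> \<phi> = {\<eta>0}" using \<eta>0min by blast
  have 2: "opt_couplings \<mu> \<eta>0 = {distr \<mu> borel (\<lambda>x. (x, bary k x))}"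
    using ex[OF I\<eta>(1)[OF \<eta>0]] coup[OF \<eta>0min] by blast
  show ?thesis using k 1 2 unfolding \<eta>0_def by (rule that)
qed

theorem theorem1p11:
  fixes \<mu> \<nu> :: "'a::euclidean_space measure" and \<phi> :: "'a \<Rightarrow> real"
  assumes "\<mu> \<in> P2" and "\<nu> \<in> P2"
    and "strictly_convex \<phi>" and "ereal_integral \<nu> \<phi> < \<infinity>"
  shows "(I_min \<mu> \<nu> \<phi> \<noteq> {} \<and> I_min \<mu> \<nu> \<phi> \<subseteq> I_tilde \<mu> \<nu> \<and>
       (\<forall>\<eta>\<in>I_min \<mu> \<nu> \<phi>. \<exists>T\<in>borel \<rightarrow>\<^sub>M borel.
          opt_couplings \<mu> \<eta> = {distr \<mu> borel (\<lambda>x. (x, T x))}))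
    \<and> (\<exists>!\<eta>. \<eta> \<in> I_min \<mu> \<nu> \<phi> \<and>
          (\<integral>z. (norm z)\<^sup>2 \<partial>\<eta>) = (INF \<eta>'\<in>I_min \<mu> \<nu> \<phi>. \<integral>z. (norm z)\<^sup>2 \<partial>\<eta>'))
    \<and> (\<exists>!\<eta>. \<eta> \<in> I_min \<mu> \<nu> (\<lambda>x. (norm x)\<^sup>2))"
proof (intro conjI)
  obtain k where k: "k \<in> opt_kernels \<mu> \<nu>" and Imin: "I_min \<mu> \<nu> \<phi> = {distr \<mu> borel (bary k)}"
    and opt: "opt_couplings \<mu> (distr \<mu> borel (bary k)) = {distr \<mu> borel (\<lambda>x. (x, bary k x))}"
    by (rule I_min_singleton[OF assms])
  have kk: "k \<in> kernels \<mu> \<nu>" by (rule opt_kernels_kernels[OF k])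
  show "I_min \<mu> \<nu> \<phi> \<noteq> {}" by (simp add: Imin)
  have "kernel_prod \<mu> k \<in> opt_couplings \<mu> \<nu>"
    using k kernel_prod_couplings[OF P2D(1,2)[OF assms(1)] kk] by (simp add: opt_kernels_def opt_couplings_def)
  moreover have "k \<in> borel \<rightarrow>\<^sub>M prob_algebra borel"
    using kernels_measurable[OF kk] P2D(2)[OF assms(1)] by (simp cong: measurable_cong_sets)
  ultimately show "I_min \<mu> \<nu> \<phi> \<subseteq> I_tilde \<mu> \<nu>"
    unfolding Imin I_tilde_def bary_def by blast
  show "\<forall>\<eta>\<in>I_min \<mu> \<nu> \<phi>. \<exists>T\<in>borel \<rightarrow>\<^sub>M borel. opt_couplings \<mu> \<eta> = {distr \<mu> borel (\<lambda>x. (x, T x))}"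
    using opt bary_pushforward(1)[OF assms(1,2) kk] unfolding Imin by blast
  show "\<exists>!\<eta>. \<eta> \<in> I_min \<mu> \<nu> \<phi> \<and>
      (\<integral>z. (norm z)\<^sup>2 \<partial>\<eta>) = (INF \<eta>'\<in>I_min \<mu> \<nu> \<phi>. \<integral>z. (norm z)\<^sup>2 \<partial>\<eta>')"
    unfolding Imin by (intro ex1I[of _ "distr \<mu> borel (bary k)"]) auto
  have "ereal_integral \<nu> (\<lambda>x. (norm x)\<^sup>2) < \<infinity>"
    by (simp add: ereal_integral_eq[OF P2D(4)[OF assms(2)]])
  then obtain l where "I_min \<mu> \<nu> (\<lambda>x. (norm x)\<^sup>2) = {distr \<mu> borel (bary l)}"
    by (rule I_min_singleton[OF assms(1,2) strictly_convex_norm_power2])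
  then show "\<exists>!\<eta>. \<eta> \<in> I_min \<mu> \<nu> (\<lambda>x. (norm x)\<^sup>2)" by simp
qed

end
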